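(* Let $A$ be a locally closed subset of a reduced complex space $X$. The following are equivalent: (1) $A$ is set-theoretically weakly $1$-pseudoconcave; (2) for every $p\in A$ there is an open neighbourhood $U_p$ of $p$ in $A$ such that for every open $V\Subset U_p$ and every $u\in\mathscr{O}_A(V)\cap\mathcal{C}^0(\overline V)$ one has $\sup_V|u|\le\sup_{\partial_A V}|u|$; (3) there is an ordinal $\alpha>0$ such that for every $p\in A$ there is an open neighbourhood $U_p$ of $p$ in $A$ such that for every open $V\Subset U_p$ and every $u\in\mathscr{O}_{A,\alpha}(V)\cap\mathcal{C}^0(\overline V)$ one has $\sup_V|u|\le\sup_{\partial_A V}|u|$; (4) for every $p\in A$ there is an open neighbourhood $U_p$ of $p$ in $A$ such that for every open $V\Subset U_p$ and every $u\in\tilde{\mathscr{O}}_A(V)\cap\mathcal{C}^0(\overline V)$ one has $\sup_V|u|\le\sup_{\partial_A V}|u|$.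
   Context: Complex spaces are Hausdorff, and $X$ is a reduced complex space of pure dimension. $\partial_A V$ is the boundary of $V$ in the subspace topology of $A$; $V\Subset U$ means that $V$ is relatively compact in $U$. The supremum of nonnegative numbers over the empty set is $0$. Pseudoconcavity. Let $q$ be an integer, $p\in A$. $A$ is set-theoretically $q$-pseudoconvex at $p$ if there are an open neighbourhood $\omega_p$ of $p$ in $X$, an isomorphism $z$ of $\omega_p$ onto a local model $Z$ (a closed analytic subvariety of an open set $U\subset\mathbb{C}^N$, with its reduced structure), a function $\rho\in\mathcal{C}^\infty(U,\mathbb{R})$ and an open set $\omega'_p$ with $p\in\omega'_p\subseteq\omega_p$ such that $z(A\cap\omega'_p)\subseteq\{\rho\le\rho(z(p))\}$ and the complex Hessian $(\partial^2\rho/\partial z_i\partial\bar z_j)$ at $z(p)$ has at least $N-q+1$ positive eigenvalues. (This does not depend on the choice of the local model.) $A$ is set-theoretically weakly $q$-pseudoconcave at $p$ if it is not set-theoretically $q$-pseudoconvex at $p$; it is set-theoretically weakly $q$-pseudoconcave if this holds at every $p\in A$. LACR functions. $\mathcal{C}_A$ is the sheaf of germs of continuous complex valued functions on $A$. $\mathscr{O}_A\subseteq\mathcal{C}_A$ is the subsheaf of germs of functions that are, near each point, restrictions to $A$ of holomorphic functions on open subsets of $X$. For a set $\mathcal{H}$ of germs of continuous functions on $A$ and $U$ open in $A$, $\mathcal{H}(U)$ is the set of continuous functions on $U$ all of whose germs belong to $\mathcal{H}$; $\mathcal{H}^c$ is the set of germs $f_{(x)}$ having, on some open neighbourhood $U_x$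 of $x$ in $A$, a representative which is the limit, uniformly on compact subsets of $U_x$, of a sequence in $\mathcal{H}(U_x)$. $\mathcal{H}^{(c)}$ is the smallest set of germs that contains $\mathcal{H}$ and is stable under $\mathcal{H}\mapsto\mathcal{H}^c$. Set $\mathscr{O}_{A,0}=\mathscr{O}_A$ and, for ordinals $\alpha>0$, $\mathscr{O}_{A,\alpha}=\big(\bigcup_{\beta<\alpha}\mathscr{O}_{A,\beta}\big)^c$. The sheaf of LACR (locally approximable continuous CR) functions is $\tilde{\mathscr{O}}_A=\mathscr{O}_A^{(c)}$, which equals $\mathscr{O}_{A,\alpha}$ for all sufficiently large $\alpha$. *)

theory Defs
  imports
    "HOL-Analysis.Analysis"
    "Jordan_Normal_Form.Char_Poly"
begin

section \<open>Function theory on open subsets of complex number space\<close>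

text \<open>
  The dimension of the ambient number space of a local model varies from point to point, so it
  has to be a term and not a type.  Complex $N$-space is therefore realised, like
  \<^term>\<open>Euclidean_space\<close> in the library, as the set of sequences vanishing from index $N$ on,
  with the topology induced by the product topology.
\<close>

definition Cspace :: "nat \<Rightarrow> (nat \<Rightarrow> complex) set" where
  "Cspace N = {w. \<forall>i\<ge>N. w i = 0}"

abbreviation open_in_C :: "nat \<Rightarrow> (nat \<Rightarrow> complex) set \<Rightarrow> bool" where
  "open_in_C N U \<equiv> openin (top_of_set (Cspace N)) U"

definition holo_C :: "nat \<Rightarrow> (nat \<Rightarrow> complex) set \<Rightarrow> ((nat \<Rightarrow> complex) \<Rightarrow> complex) \<Rightarrow> bool" where
  "holo_C N U f \<longleftrightarrow> continuous_on U f \<and>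
     (\<forall>w\<in>U. \<forall>j<N. (\<lambda>\<zeta>. f (w(j := \<zeta>))) field_differentiable (at (w j)))"

text \<open>
  Real partial derivative in the $j$-th complex coordinate along the direction \<open>c\<close>: for
  $c = 1$ this is $\partial/\partial x_j$, for $c = \mathrm{i}$ it is $\partial/\partial y_j$.
\<close>

definition line_C :: "(nat \<Rightarrow> complex) \<Rightarrow> nat \<Rightarrow> complex \<Rightarrow> real \<Rightarrow> (nat \<Rightarrow> complex)" where
  "line_C w j c t = w(j := w j + of_real t * c)"

definition pd :: "nat \<Rightarrow> complex \<Rightarrow> ((nat \<Rightarrow> complex) \<Rightarrow> 'b::real_normed_vector) \<Rightarrow> (nat \<Rightarrow> complex) \<Rightarrow> 'b"
  where "pd j c f w = vector_derivative (\<lambda>t. f (line_C w j c t)) (at 0)"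

primrec Ck_C ::
  "nat \<Rightarrow> nat \<Rightarrow> (nat \<Rightarrow> complex) set \<Rightarrow> ((nat \<Rightarrow> complex) \<Rightarrow> 'b::real_normed_vector) \<Rightarrow> bool" where
  "Ck_C 0 N U f \<longleftrightarrow> continuous_on U f"
| "Ck_C (Suc k) N U f \<longleftrightarrow> continuous_on U f \<and>
     (\<forall>j<N. \<forall>c\<in>{1, \<i>}.
        (\<forall>w\<in>U. (\<lambda>t. f (line_C w j c t)) differentiable (at 0)) \<and> Ck_C k N U (pd j c f))"

definition smooth_C ::
  "nat \<Rightarrow> (nat \<Rightarrow> complex) set \<Rightarrow> ((nat \<Rightarrow> complex) \<Rightarrow> 'b::real_normed_vector) \<Rightarrow> bool" where
  "smooth_C N U f \<longleftrightarrow> (\<forall>k. Ck_C k N U f)"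

definition wirt :: "nat \<Rightarrow> ((nat \<Rightarrow> complex) \<Rightarrow> complex) \<Rightarrow> (nat \<Rightarrow> complex) \<Rightarrow> complex" where
  "wirt j f w = (pd j 1 f w - \<i> * pd j \<i> f w) / 2"

definition wirt_bar :: "nat \<Rightarrow> ((nat \<Rightarrow> complex) \<Rightarrow> complex) \<Rightarrow> (nat \<Rightarrow> complex) \<Rightarrow> complex" where
  "wirt_bar j f w = (pd j 1 f w + \<i> * pd j \<i> f w) / 2"

definition complex_hessian ::
  "nat \<Rightarrow> ((nat \<Rightarrow> complex) \<Rightarrow> real) \<Rightarrow> (nat \<Rightarrow> complex) \<Rightarrow> complex Matrix.mat" where
  "complex_hessian N \<rho> w =
     Matrix.mat N N (\<lambda>(i, j). wirt i (wirt_bar j (\<lambda>v. complex_of_real (\<rho> v))) w)"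

text \<open>The number of positive eigenvalues, counted with multiplicity.\<close>

definition num_pos_eigenvalues :: "complex Matrix.mat \<Rightarrow> nat" where
  "num_pos_eigenvalues H =
     (\<Sum>l\<in>{l::real. 0 < l \<and> eigenvalue H (complex_of_real l)}.
        Polynomial.order (complex_of_real l) (char_poly H))"


section \<open>Reduced complex spaces\<close>

text \<open>The points \<open>a\<close> below range over all of \<open>U\<close>, so \<open>Z\<close> is closed in \<open>U\<close>.\<close>

definition analytic_subvariety :: "nat \<Rightarrow> (nat \<Rightarrow> complex) set \<Rightarrow> (nat \<Rightarrow> complex) set \<Rightarrow> bool" where
  "analytic_subvariety N U Z \<longleftrightarrow> Z \<subseteq> U \<and>
     (\<forall>a\<in>U. \<exists>W F. open_in_C N W \<and> a \<in> W \<and> W \<subseteq> U \<and> finite F \<and> (\<forall>f\<in>F. holo_C N W f) \<and>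
        Z \<inter> W = {w \<in> W. \<forall>f\<in>F. f w = 0})"

text \<open>
  Sections, over a relatively open subset \<open>T\<close> of a local model, of its reduced structure sheaf.
\<close>

definition model_sections :: "nat \<Rightarrow> (nat \<Rightarrow> complex) set \<Rightarrow> ((nat \<Rightarrow> complex) \<Rightarrow> complex) set" where
  "model_sections N T = {g. \<forall>a\<in>T. \<exists>W h. open_in_C N W \<and> a \<in> W \<and> holo_C N W h \<and>
     (\<forall>w\<in>W \<inter> T. g w = h w)}"

text \<open>
  The structure sheaf of a reduced complex space is a sheaf of complex valued functions.  It is
  given here by \<open>Osh\<close>, where \<open>Osh W\<close> is the set of all total functions whose restriction to
  the open set \<open>W\<close> is a section over \<open>W\<close>; values outside \<open>W\<close> are irrelevant.

  \<open>is_local_model X Osh \<omega> N U Z z\<close>: the map \<open>z\<close> is an isomorphism of the open subspace \<open>\<omega>\<close>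
  onto the local model \<open>Z\<close>, a closed analytic subvariety of the open set \<open>U\<close> in complex $N$-space.
\<close>

definition is_local_model ::
  "'a topology \<Rightarrow> ('a set \<Rightarrow> ('a \<Rightarrow> complex) set) \<Rightarrow> 'a set \<Rightarrow> nat \<Rightarrow> (nat \<Rightarrow> complex) set \<Rightarrow>
     (nat \<Rightarrow> complex) set \<Rightarrow> ('a \<Rightarrow> nat \<Rightarrow> complex) \<Rightarrow> bool" where
  "is_local_model X Osh \<omega> N U Z z \<longleftrightarrow>
     openin X \<omega> \<and> open_in_C N U \<and> analytic_subvariety N U Z \<and>
     homeomorphic_map (subtopology X \<omega>) (top_of_set Z) z \<and>
     (\<forall>T g. openin (top_of_set Z) T \<longrightarrow>
        (g \<in> model_sections N T \<longleftrightarrow> g \<circ> z \<in> Osh {x \<in> \<omega>. z x \<in> T}))"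

definition function_sheaf :: "'a topology \<Rightarrow> ('a set \<Rightarrow> ('a \<Rightarrow> complex) set) \<Rightarrow> bool" where
  "function_sheaf X Osh \<longleftrightarrow>
     (\<forall>W f g. openin X W \<and> f \<in> Osh W \<and> (\<forall>x\<in>W. g x = f x) \<longrightarrow> g \<in> Osh W) \<and>
     (\<forall>W W'. openin X W \<and> openin X W' \<and> W' \<subseteq> W \<longrightarrow> Osh W \<subseteq> Osh W') \<and>
     (\<forall>W f. openin X W \<and> (\<forall>x\<in>W. \<exists>W'. openin X W' \<and> x \<in> W' \<and> W' \<subseteq> W \<and> f \<in> Osh W')
        \<longrightarrow> f \<in> Osh W)"

definition reduced_complex_space :: "'a topology \<Rightarrow> ('a set \<Rightarrow> ('a \<Rightarrow> complex) set) \<Rightarrow> bool" where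
  "reduced_complex_space X Osh \<longleftrightarrow> Hausdorff_space X \<and> function_sheaf X Osh \<and>
     (\<forall>p\<in>topspace X. \<exists>\<omega> N U Z z. p \<in> \<omega> \<and> is_local_model X Osh \<omega> N U Z z)"

text \<open>
  The dimension of a reduced complex space at \<open>p\<close> is the upper limit, for \<open>x\<close> tending to \<open>p\<close>, of
  the dimensions at the regular points \<open>x\<close>, that is, the points near which the space is a
  complex manifold.
\<close>

definition regular_of_dim :: "'a topology \<Rightarrow> ('a set \<Rightarrow> ('a \<Rightarrow> complex) set) \<Rightarrow> nat \<Rightarrow> 'a \<Rightarrow> bool" where
  "regular_of_dim X Osh m x \<longleftrightarrow> (\<exists>\<omega> U z. x \<in> \<omega> \<and> is_local_model X Osh \<omega> m U U z)"

definition has_dim_at :: "'a topology \<Rightarrow> ('a set \<Rightarrow> ('a \<Rightarrow> complex) set) \<Rightarrow> 'a \<Rightarrow> nat \<Rightarrow> bool" where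
  "has_dim_at X Osh p n \<longleftrightarrow>
     (\<forall>\<omega>. openin X \<omega> \<and> p \<in> \<omega> \<longrightarrow> (\<exists>x\<in>\<omega>. regular_of_dim X Osh n x)) \<and>
     (\<exists>\<omega>. openin X \<omega> \<and> p \<in> \<omega> \<and> (\<forall>x\<in>\<omega>. \<forall>m. regular_of_dim X Osh m x \<longrightarrow> m \<le> n))"

definition pure_dimensional :: "'a topology \<Rightarrow> ('a set \<Rightarrow> ('a \<Rightarrow> complex) set) \<Rightarrow> bool" where
  "pure_dimensional X Osh \<longleftrightarrow> (\<exists>n. \<forall>p\<in>topspace X. has_dim_at X Osh p n)"

definition locally_closed_in :: "'a topology \<Rightarrow> 'a set \<Rightarrow> bool" where
  "locally_closed_in X A \<longleftrightarrow> (\<exists>U C. openin X U \<and> closedin X C \<and> A = U \<inter> C)"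


section \<open>Set-theoretic pseudoconcavity\<close>

definition set_pseudoconvex_at ::
  "'a topology \<Rightarrow> ('a set \<Rightarrow> ('a \<Rightarrow> complex) set) \<Rightarrow> 'a set \<Rightarrow> int \<Rightarrow> 'a \<Rightarrow> bool" where
  "set_pseudoconvex_at X Osh A q p \<longleftrightarrow>
     (\<exists>\<omega> N U Z z \<rho> \<omega>'. p \<in> \<omega> \<and> is_local_model X Osh \<omega> N U Z z \<and>
        smooth_C N U (\<rho> :: (nat \<Rightarrow> complex) \<Rightarrow> real) \<and>
        openin X \<omega>' \<and> p \<in> \<omega>' \<and> \<omega>' \<subseteq> \<omega> \<and>
        z ` (A \<inter> \<omega>') \<subseteq> {w \<in> U. \<rho> w \<le> \<rho> (z p)} \<and>
        int (num_pos_eigenvalues (complex_hessian N \<rho> (z p))) \<ge> int N - q + 1)"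

definition set_weakly_pseudoconcave ::
  "'a topology \<Rightarrow> ('a set \<Rightarrow> ('a \<Rightarrow> complex) set) \<Rightarrow> 'a set \<Rightarrow> int \<Rightarrow> bool" where
  "set_weakly_pseudoconcave X Osh A q \<longleftrightarrow> (\<forall>p\<in>A. \<not> set_pseudoconvex_at X Osh A q p)"


section \<open>Germs and locally approximable functions\<close>

text \<open>
  A germ at \<open>x\<close> on the space \<open>T\<close> is the point \<open>x\<close> together with the class of all functions that
  agree on a neighbourhood of \<open>x\<close> in \<open>T\<close>.
\<close>

type_synonym 'a germ = "'a \<times> ('a \<Rightarrow> complex) set"

definition germ_at :: "'a topology \<Rightarrow> 'a \<Rightarrow> ('a \<Rightarrow> complex) \<Rightarrow> 'a germ" where
  "germ_at T x f = (x, {g. \<exists>W. openin T W \<and> x \<in> W \<and> (\<forall>y\<in>W. g y = f y)})"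

definition germ_sections :: "'a topology \<Rightarrow> 'a germ set \<Rightarrow> 'a set \<Rightarrow> ('a \<Rightarrow> complex) set" where
  "germ_sections T \<H> U =
     {f. continuous_map (subtopology T U) euclidean f \<and> (\<forall>x\<in>U. germ_at T x f \<in> \<H>)}"

definition approx_germs :: "'a topology \<Rightarrow> 'a germ set \<Rightarrow> 'a germ set" where
  "approx_germs T \<H> = {germ_at T x f | x f. \<exists>U. openin T U \<and> x \<in> U \<and>
     continuous_map (subtopology T U) euclidean f \<and>
     (\<exists>s :: nat \<Rightarrow> 'a \<Rightarrow> complex. (\<forall>n. s n \<in> germ_sections T \<H> U) \<and>
        (\<forall>K. compactin T K \<and> K \<subseteq> U \<longrightarrow> uniform_limit K s f sequentially))}"

definition approx_closure :: "'a topology \<Rightarrow> 'a germ set \<Rightarrow> 'a germ set" where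
  "approx_closure T \<H> = \<Inter>{\<G>. \<H> \<subseteq> \<G> \<and> approx_germs T \<G> \<subseteq> \<G>}"

definition restricted_holo_germs ::
  "'a topology \<Rightarrow> ('a set \<Rightarrow> ('a \<Rightarrow> complex) set) \<Rightarrow> 'a set \<Rightarrow> 'a germ set" where
  "restricted_holo_germs X Osh A =
     {germ_at (subtopology X A) x f | x f. x \<in> A \<and> (\<exists>W. openin X W \<and> x \<in> W \<and> f \<in> Osh W)}"

definition LACR_germs ::
  "'a topology \<Rightarrow> ('a set \<Rightarrow> ('a \<Rightarrow> complex) set) \<Rightarrow> 'a set \<Rightarrow> 'a germ set" where
  "LACR_germs X Osh A = approx_closure (subtopology X A) (restricted_holo_germs X Osh A)"

text \<open>
  HOL has no type of all ordinals.  As in the library, an ordinal is represented by a well-order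
  \<open>r\<close> and the order of ordinals is \<^const>\<open>ordLess\<close>; the ordinal \<open>0\<close> is the empty relation.
  If \<open>r\<close> lives on the type \<open>'i\<close>, then so do representatives of all ordinals below it, hence the
  union over all \<open>s\<close> on \<open>'i\<close> is the union over all smaller ordinals.  A type variable \<open>'i\<close> in a
  theorem is universally quantified, so ordinals of every size that HOL knows are covered.
\<close>

definition iter_germs ::
  "'a topology \<Rightarrow> ('a set \<Rightarrow> ('a \<Rightarrow> complex) set) \<Rightarrow> 'a set \<Rightarrow> 'i rel \<Rightarrow> 'a germ set" where
  "iter_germs X Osh A = wfrec ordLess (\<lambda>I r.
     if r = {} then restricted_holo_germs X Osh A
     else approx_germs (subtopology X A) (\<Union>s\<in>{s. (s, r) \<in> ordLess}. I s))"

lemma iter_germs_zero: "iter_germs X Osh A {} = restricted_holo_germs X Osh A"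
  unfolding iter_germs_def by (subst wfrec[OF wf_ordLess]) simp

lemma iter_germs_pos:
  fixes r :: "'i rel"
  assumes "r \<noteq> {}"
  shows "iter_germs X Osh A r =
    approx_germs (subtopology X A) (\<Union>s\<in>{s :: 'i rel. (s, r) \<in> ordLess}. iter_germs X Osh A s)"
proof -
  have "(\<Union>s\<in>{s :: 'i rel. (s, r) \<in> ordLess}. cut (iter_germs X Osh A) ordLess r s) =
      (\<Union>s\<in>{s :: 'i rel. (s, r) \<in> ordLess}. iter_germs X Osh A s)"
    by (rule SUP_cong) (auto simp: cut_apply)
  then show ?thesis
    using assms unfolding iter_germs_def by (subst wfrec[OF wf_ordLess]) simp
qed


section \<open>The local maximum modulus principle\<close>

text \<open>The supremum of nonnegative numbers, \<open>0\<close> for the empty set.\<close>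

definition sup_norm_on :: "'a set \<Rightarrow> ('a \<Rightarrow> complex) \<Rightarrow> real" where
  "sup_norm_on S u = (if S = {} then 0 else SUP x\<in>S. cmod (u x))"

definition relatively_compact_in :: "'a topology \<Rightarrow> 'a set \<Rightarrow> 'a set \<Rightarrow> bool" where
  "relatively_compact_in T V U \<longleftrightarrow> V \<subseteq> U \<and>
     compactin (subtopology T U) ((subtopology T U) closure_of V)"

definition local_max_principle :: "'a topology \<Rightarrow> 'a germ set \<Rightarrow> bool" where
  "local_max_principle T \<H> \<longleftrightarrow>
     (\<forall>p\<in>topspace T. \<exists>U. openin T U \<and> p \<in> U \<and>
        (\<forall>V u. openin T V \<and> relatively_compact_in T V U \<and> u \<in> germ_sections T \<H> V \<and>
            continuous_map (subtopology T (T closure_of V)) euclidean u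
          \<longrightarrow> sup_norm_on V u \<le> sup_norm_on (T frontier_of V) u))"

end

theory Submission
  imports Defs "HOL-Complex_Analysis.Complex_Analysis"
begin

text \<open>
  From weak pseudoconcavity to the maximum principle: in a local model, consider the germs $f$ at
  $x$ such that no function $\mathrm{Re}(\theta f) + c\,|z - a|^2$ with $c > 0$ has a local maximum
  on $A$ at $x$.  If $A$ is weakly 1-pseudoconcave, all holomorphic germs are of this kind, because
  the complex Hessian of such a function is $c$ times the identity.  The class is stable under
  locally uniform limits: subtracting $\frac c2 |z - z(x)|^2$ makes a maximum strict, and a strict
  maximum persists, at a nearby point, for the approximating functions.  Hence the class contains all
  LACR germs.  If the maximum principle failed for $u$, then $\mathrm{Re}(\theta u) +
  \varepsilon |z - z(q)|^2$ with small $\varepsilon$ would have an interior maximum.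

  Conversely, if $A \subseteq \{\rho \le \rho(p)\}$ near $p$ with positive definite Levi form, the
  second order Taylor expansion of $\rho$ gives a quadratic polynomial $P$ with $P(p) = 0$ and
  $\mathrm{Re}\,P \le -\varepsilon |z - p|^2$ on $A$ near $p$; then $\exp P$ peaks at $p$ and
  violates the maximum principle.
\<close>

section \<open>The topology of complex number space\<close>

text \<open>As an introduction rule it matches every function-valued goal and makes the search diverge.\<close>

declare continuous_on_coordinatewise_then_product [continuous_intros del]

text \<open>The class of germs without local maxima must be stable under its own perturbations. Its
  test functions therefore carry every c > 0 and every centre a: taking
  \<open>c / 2 * |z - b|^2\<close> away from \<open>c * |z - a|^2\<close> leaves, up to a constant,
  c / 2 times the squared distance from \<open>2 * a - b\<close>, again a test term. The rotation
  \<theta> lets real parts control the modulus. Pseudoconvexity asks for smooth functions, whereas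
  \<open>holo_C\<close> only means continuous and separately holomorphic. So derivatives of
  holomorphic functions must be shown to be holomorphic, and Taylor's formula and the symmetry of
  second derivatives must be drawn from \<open>Ck_C\<close>, which knows nothing but coordinate
  derivatives. Condition (3) is squeezed: at every positive ordinal, \<open>iter_germs\<close>
  contains the restricted holomorphic germs and lies in the LACR germs, while a larger class makes
  the maximum principle stronger. The distance is squared because this makes it smooth with constant
  complex Hessian; it serves as perturbation and, through compactness, as substitute for a norm on
  \<open>Cspace N\<close>.\<close>

definition sqdist :: "nat \<Rightarrow> (nat \<Rightarrow> complex) \<Rightarrow> (nat \<Rightarrow> complex) \<Rightarrow> real" where
  "sqdist N a w = (\<Sum>i<N. (cmod (w i - a i))\<^sup>2)"

lemma sqdist_nonneg [simp]: "0 \<le> sqdist N a w"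
  by (simp add: sqdist_def sum_nonneg)

lemma sqdist_self [simp]: "sqdist N a a = 0"
  by (simp add: sqdist_def)

lemma sqdist_eq_0_iff:
  assumes "a \<in> Cspace N" "w \<in> Cspace N"
  shows "sqdist N a w = 0 \<longleftrightarrow> w = a"
proof
  assume "sqdist N a w = 0"
  then have "\<forall>i<N. w i = a i"
    by (simp add: sqdist_def sum_nonneg_eq_0_iff)
  with assms show "w = a"
    by (intro ext) (metis (mono_tags) Cspace_def mem_Collect_eq not_le)
qed simp

lemma continuous_on_sqdist [continuous_intros]:
  assumes "continuous_on S f"
  shows "continuous_on S (\<lambda>x. sqdist N a (f x))"
  unfolding sqdist_def by (intro continuous_intros continuous_on_product_then_coordinatewise[OF assms])

lemma cmod_diff_le_sqdist: "i < N \<Longrightarrow> (cmod (w i - a i))\<^sup>2 \<le> sqdist N a w"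
  unfolding sqdist_def by (rule member_le_sum) auto

text \<open>A closed subset of a product of discs, completed by factors {0} from index N on;
  Tychonoff's theorem makes the product compact.\<close>

lemma compact_closed_ball_Cspace: "compact {w \<in> Cspace N. sqdist N a w \<le> r}"
proof -
  define B where "B = (\<lambda>i. if i < N then cball (a i) (sqrt r) else {0 :: complex})"
  have "compactin (product_topology (\<lambda>i. euclidean) UNIV) (PiE UNIV B)"
    unfolding compactin_PiE by (auto simp: B_def compactin_euclidean_iff)
  then have "compact (PiE UNIV B)"
    by (simp add: euclidean_product_topology compactin_euclidean_iff)
  moreover have "closed {w. sqdist N a w \<le> r}"
    by (intro closed_Collect_le continuous_intros)
  moreover have "{w \<in> Cspace N. sqdist N a w \<le> r} = PiE UNIV B \<inter> {w. sqdist N a w \<le> r}"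
  proof -
    have "w i \<in> B i" if w: "w \<in> Cspace N" "sqdist N a w \<le> r" for w i
      using cmod_diff_le_sqdist[of i N w a] w
      by (auto simp: B_def Cspace_def dist_norm norm_minus_commute intro!: real_le_rsqrt)
    moreover have "w \<in> Cspace N" if "\<And>i. w i \<in> B i" for w
      unfolding Cspace_def using that by (auto simp: B_def) (metis not_le singletonD)
    ultimately show ?thesis
      by (auto simp: PiE_iff)
  qed
  ultimately show ?thesis
    by (simp add: compact_Int_closed)
qed

text \<open>The topology comes from the product topology, so the radius is found by compactness: on
  the part of the unit ball that misses the open set, \<open>sqdist N p\<close> has a positive
  minimum.\<close>

lemma open_in_C_contains_ball:
  assumes "open_in_C N U" "p \<in> U"
  obtains r where "r > 0" "\<And>w. w \<in> Cspace N \<Longrightarrow> sqdist N p w \<le> r \<Longrightarrow> w \<in> U"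
proof -
  obtain O' where O': "open O'" "U = Cspace N \<inter> O'"
    using assms(1) by (auto simp: openin_open)
  define C where "C = {w \<in> Cspace N. sqdist N p w \<le> 1} - O'"
  have "compact C"
    unfolding C_def by (intro compact_diff compact_closed_ball_Cspace O')
  show thesis
  proof (cases "C = {}")
    case True
    then show ?thesis
      by (intro that[of 1]) (auto simp: C_def O')
  next
    case False
    have "continuous_on C (sqdist N p)"
      using continuous_on_sqdist[OF continuous_on_id, of C N p] by simp
    then obtain m where m: "m \<in> C" "\<And>w. w \<in> C \<Longrightarrow> sqdist N p m \<le> sqdist N p w"
      using continuous_attains_inf[OF \<open>compact C\<close> False] by blast
    have p: "p \<in> Cspace N" "p \<in> O'" and "m \<noteq> p"
      using assms(2) O' m(1) by (auto simp: C_def)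
    then have "sqdist N p m \<noteq> 0"
      using m(1) sqdist_eq_0_iff[of p N m] by (simp add: C_def)
    then have pos: "sqdist N p m > 0"
      using sqdist_nonneg[of N p m] by linarith
    \<comment> \<open>The minimum itself is too large, as \<open>m\<close> attains it outside
      \<open>O'\<close>; hence its half.\<close>
    show ?thesis
    proof (rule that[of "min 1 (sqdist N p m / 2)"])
      fix w assume w: "w \<in> Cspace N" "sqdist N p w \<le> min 1 (sqdist N p m / 2)"
      show "w \<in> U"
      proof (rule ccontr)
        assume "w \<notin> U"
        then have "w \<in> C"
          using w O' by (simp add: C_def)
        then show False
          using m(2)[of w] w pos by simp
      qed
    qed (use pos in simp)
  qed
qed

lemma open_in_C_ball: "open_in_C N {w \<in> Cspace N. sqdist N a w < r}"
proof -
  have "open {w. sqdist N a w < r}"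
    by (intro open_Collect_less continuous_intros)
  then show ?thesis
    by (auto simp: openin_open)
qed

lemma open_in_C_subset: "open_in_C N U \<Longrightarrow> w \<in> U \<Longrightarrow> w \<in> Cspace N"
  using openin_subset by fastforce

section \<open>Slices in one complex coordinate\<close>

lemma sqdist_upd:
  "j < N \<Longrightarrow> sqdist N a (w(j := \<zeta>)) = sqdist N a w - (cmod (w j - a j))\<^sup>2 + (cmod (\<zeta> - a j))\<^sup>2"
  unfolding sqdist_def
  by (subst (1 2) sum.remove[of "{..<N}" j]) (auto intro!: sum.cong)

lemma Cspace_upd: "w \<in> Cspace N \<Longrightarrow> j < N \<Longrightarrow> w(j := \<zeta>) \<in> Cspace N"
  by (auto simp: Cspace_def)

lemma continuous_on_upd [continuous_intros]:
  assumes "continuous_on S (f :: 'x::topological_space \<Rightarrow> 'i \<Rightarrow> 'b::topological_space)" 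
    "continuous_on S g"
  shows "continuous_on S (\<lambda>x. (f x)(j := g x))"
proof (rule continuous_on_coordinatewise_then_product)
  fix i
  show "continuous_on S (\<lambda>x. ((f x)(j := g x)) i)"
    using assms continuous_on_product_then_coordinatewise[OF assms(1), of i]
    by (cases "i = j") auto
qed

lemma open_in_C_slice:
  assumes "open_in_C N U" "w \<in> Cspace N" "j < N"
  shows "open {\<zeta>. w(j := \<zeta>) \<in> U}"
proof -
  obtain O' where O': "open O'" "U = Cspace N \<inter> O'"
    using assms(1) by (auto simp: openin_open)
  have "{\<zeta>. w(j := \<zeta>) \<in> U} = (\<lambda>\<zeta>. w(j := \<zeta>)) -` O'"
    using O' Cspace_upd[OF assms(2,3)] by auto
  then show ?thesis
    using O'(1) by (auto intro!: open_vimage continuous_on_upd continuous_intros)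
qed

text \<open>Through these slices the one-variable theorems of Weierstrass, Cauchy and Taylor
  enter.\<close>

lemma holo_C_slice:
  assumes "holo_C N U f" "open_in_C N U" "w \<in> Cspace N" "j < N"
  shows "(\<lambda>\<zeta>. f (w(j := \<zeta>))) holomorphic_on {\<zeta>. w(j := \<zeta>) \<in> U}"
proof -
  have "(\<lambda>\<zeta>. f (w(j := \<zeta>))) field_differentiable at \<zeta>" if "w(j := \<zeta>) \<in> U" for \<zeta>
    using assms(1,4) that unfolding holo_C_def by fastforce
  then show ?thesis
    by (simp add: holomorphic_on_def field_differentiable_at_within)
qed

section \<open>Partial derivatives of holomorphic functions\<close>

text \<open>This is \<partial>f/\<partial>z_j; for holomorphic f the real derivative along c is c
  times it, so real derivatives of holomorphic functions reduce to it.\<close>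

definition cpd :: "nat \<Rightarrow> ((nat \<Rightarrow> complex) \<Rightarrow> complex) \<Rightarrow> (nat \<Rightarrow> complex) \<Rightarrow> complex" where
  "cpd j f w = deriv (\<lambda>\<zeta>. f (w(j := \<zeta>))) (w j)"

lemma holo_C_subset: "holo_C N U f \<Longrightarrow> V \<subseteq> U \<Longrightarrow> holo_C N V f"
  by (auto simp: holo_C_def intro: continuous_on_subset)

lemma holo_C_local:
  assumes "open_in_C N U"
    and "\<And>w. w \<in> U \<Longrightarrow> \<exists>W. open_in_C N W \<and> w \<in> W \<and> W \<subseteq> U \<and> holo_C N W f"
  shows "holo_C N U f"
  unfolding holo_C_def
proof (intro conjI ballI allI impI)
  show "continuous_on U f"
    unfolding continuous_on_eq_continuous_within
  proof
    fix w assume "w \<in> U"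
    then obtain W where W: "open_in_C N W" "w \<in> W" "W \<subseteq> U" "holo_C N W f"
      using assms(2) by blast
    obtain O' where O': "open O'" "W = Cspace N \<inter> O'"
      using W(1) by (auto simp: openin_open)
    have "U \<inter> O' = W"
      using O' W(3) openin_subset[OF assms(1)] by auto
    moreover have "continuous (at w within W) f"
      using W by (auto simp: holo_C_def continuous_on_eq_continuous_within)
    ultimately show "continuous (at w within U) f"
      using at_within_nhd[of w O' U W] O' W(2,3) by (auto simp: continuous_within)
  qed
qed (use assms(2) in \<open>fastforce simp: holo_C_def\<close>)

text \<open>Continuity survives the limit on U as a whole, and holomorphy in each variable by
  Weierstrass's theorem on the slices.\<close>

lemma holo_C_uniform_limit:
  assumes "open_in_C N U" "\<And>n. holo_C N U (q n)" "uniform_limit U q g sequentially"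
  shows "holo_C N U g"
  unfolding holo_C_def
proof (intro conjI ballI allI impI)
  have "continuous_on U (q n)" for n
    using assms(2) unfolding holo_C_def by blast
  then show "continuous_on U g"
    using uniform_limit_theorem[OF _ assms(3)] by simp
  fix w j assume w: "w \<in> U" "j < N"
  define S where "S = {\<zeta>. w(j := \<zeta>) \<in> U}"
  have S: "open S" "w j \<in> S"
    unfolding S_def using open_in_C_slice[OF assms(1) open_in_C_subset[OF assms(1) w(1)] w(2)] w by auto
  have u: "uniform_limit S (\<lambda>n \<zeta>. q n (w(j := \<zeta>))) (\<lambda>\<zeta>. g (w(j := \<zeta>))) sequentially"
    using assms(3) unfolding uniform_limit_iff S_def by (auto elim!: eventually_mono)
  have h: "(\<lambda>\<zeta>. q n (w(j := \<zeta>))) holomorphic_on S" for n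
    unfolding S_def
    by (rule holo_C_slice[OF assms(2,1) open_in_C_subset[OF assms(1) w(1)] w(2)])
  have "(\<lambda>\<zeta>. g (w(j := \<zeta>))) holomorphic_on S"
  proof (rule holomorphic_uniform_sequence[OF S(1) h])
    fix x assume "x \<in> S"
    then obtain d where "d > 0" "cball x d \<subseteq> S"
      using S(1) open_contains_cball by blast
    with u show "\<exists>d. 0 < d \<and> cball x d \<subseteq> S \<and>
        uniform_limit (cball x d) (\<lambda>n \<zeta>. q n (w(j := \<zeta>))) (\<lambda>\<zeta>. g (w(j := \<zeta>))) sequentially"
      using uniform_limit_on_subset by blast
  qed
  then show "(\<lambda>\<zeta>. g (w(j := \<zeta>))) field_differentiable at (w j)"
    using S by (simp add: holomorphic_on_imp_differentiable_at)
qed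

text \<open>Taylor's formula of order one, with Cauchy's inequality bounding the second derivative
  on the disc of half the radius. The constant depends on M and \<delta> alone, so difference
  quotients will converge uniformly in the remaining variables.\<close>

lemma deriv_remainder_bound:
  assumes "\<phi> holomorphic_on S" "open S" "cball z \<delta> \<subseteq> S" "0 < \<delta>"
    and "\<And>\<zeta>. \<zeta> \<in> cball z \<delta> \<Longrightarrow> cmod (\<phi> \<zeta>) \<le> M" and "cmod t \<le> \<delta> / 2"
  shows "cmod (\<phi> (z + t) - \<phi> z - deriv \<phi> z * t) \<le> 8 * M / \<delta>\<^sup>2 * (cmod t)\<^sup>2"
proof -
  have sub: "cball x (\<delta> / 2) \<subseteq> cball z \<delta>" if "x \<in> cball z (\<delta> / 2)" for x
  proof
    fix y assume "y \<in> cball x (\<delta> / 2)"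
    then show "y \<in> cball z \<delta>"
      using that dist_triangle[of z y x] by auto
  qed
  have "cmod ((deriv ^^ 2) \<phi> x) \<le> fact 2 * M / (\<delta> / 2)\<^sup>2" if x: "x \<in> cball z (\<delta> / 2)" for x
  proof (rule Cauchy_inequality)
    have "cball x (\<delta> / 2) \<subseteq> S"
      using sub[OF x] assms(3) by blast
    then show "\<phi> holomorphic_on ball x (\<delta> / 2)" "continuous_on (cball x (\<delta> / 2)) \<phi>"
      using assms(1) ball_subset_cball holomorphic_on_imp_continuous_on holomorphic_on_subset
      by (metis subset_trans)+
    show "cmod (\<phi> y) \<le> M" if "cmod (x - y) = \<delta> / 2" for y
      using sub[OF x] that by (intro assms(5)) (auto simp: dist_norm)
  qed (use assms(4) in simp)
  \<comment> \<open>Here 8 is 2! times 4, the 4 coming from the radius \<delta> / 2.\<close>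
  then have bd: "cmod ((deriv ^^ 2) \<phi> x) \<le> 8 * M / \<delta>\<^sup>2" if "x \<in> cball z (\<delta> / 2)" for x
    using that by (simp add: power_divide fact_numeral)
  have "cmod ((deriv ^^ 0) \<phi> (z + t) - (\<Sum>i\<le>1. (deriv ^^ i) \<phi> z * (z + t - z) ^ i / fact i))
      \<le> 8 * M / \<delta>\<^sup>2 * cmod (z + t - z) ^ Suc 1 / fact 1"
  proof (rule complex_Taylor)
    show "convex (cball z (\<delta> / 2))" by simp
    fix i x assume x: "x \<in> cball z (\<delta> / 2)"
    then have "x \<in> S"
      using assms(3,4) by auto
    then show "((deriv ^^ i) \<phi> has_field_derivative (deriv ^^ Suc i) \<phi> x) (at x within cball z (\<delta> / 2))"
      using holomorphic_higher_deriv[OF assms(1,2), of i] assms(2)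
      by (simp add: has_field_derivative_at_within holomorphic_derivI)
  qed (use bd assms in \<open>auto simp: dist_norm numeral_2_eq_2\<close>)
  then show ?thesis
    by (simp add: algebra_simps power2_eq_square)
qed

text \<open>Rests on (a + b)^2 \<le> 2 a^2 + 2 b^2; squared distances obey no triangle inequality,
  and this weak form replaces it.\<close>

lemma sqdist_shift_le: "j < N \<Longrightarrow> sqdist N p (w(j := w j + t)) \<le> 2 * sqdist N p w + 2 * (cmod t)\<^sup>2"
proof -
  assume j: "j < N"
  have "(cmod (w j + t - p j))\<^sup>2 \<le> (cmod (w j - p j) + cmod t)\<^sup>2"
    using norm_triangle_ineq[of "w j - p j" t] by (intro power_mono) (auto simp: algebra_simps)
  also have "\<dots> \<le> 2 * (cmod (w j - p j))\<^sup>2 + 2 * (cmod t)\<^sup>2"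
    using sum_squares_bound[of "cmod (w j - p j)" "cmod t"] by (simp add: power2_sum)
  finally show ?thesis
    using cmod_diff_le_sqdist[OF j, of w p] by (simp add: sqdist_upd[OF j])
qed

text \<open>In direction j the slice is translated; in any other direction the two updates
  commute.\<close>

lemma holo_C_shift:
  assumes "holo_C N U f" "\<And>w. w \<in> W \<Longrightarrow> w(j := w j + t) \<in> U" "j < N"
  shows "holo_C N W (\<lambda>w. f (w(j := w j + t)))"
  unfolding holo_C_def
proof (intro conjI ballI allI impI)
  have "continuous_on W (\<lambda>w. w(j := w j + t))"
    by (intro continuous_on_upd continuous_intros continuous_on_product_then_coordinatewise)
  then show "continuous_on W (\<lambda>w. f (w(j := w j + t)))"
    using assms(1,2) by (auto simp: holo_C_def intro!: continuous_on_compose2[of U f])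
  fix w k assume w: "w \<in> W" "k < N"
  show "(\<lambda>\<zeta>. f ((w(k := \<zeta>))(j := (w(k := \<zeta>)) j + t))) field_differentiable at (w k)"
  proof (cases "k = j")
    case True
    have "(\<lambda>\<zeta>. f ((w(j := w j + t))(j := \<zeta>))) field_differentiable at ((w(j := w j + t)) j)"
      using assms w unfolding holo_C_def by blast
    then have *: "(\<lambda>\<zeta>. f (w(j := \<zeta>))) field_differentiable at (w j + t)"
      by simp
    have "((\<lambda>\<zeta>. f (w(j := \<zeta>))) \<circ> (\<lambda>\<zeta>. \<zeta> + t)) field_differentiable at (w j)"
      by (intro field_differentiable_compose * derivative_intros) 
    then show ?thesis
      by (simp add: True o_def)
  next
    case False
    have "(\<lambda>\<zeta>. f ((w(j := w j + t))(k := \<zeta>))) field_differentiable at ((w(j := w j + t)) k)"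
      using assms w unfolding holo_C_def by blast
    then show ?thesis
      using False by (simp add: fun_upd_twist)
  qed
qed

lemma holo_C_const [intro]: "holo_C N U (\<lambda>w. c)"
  by (simp add: holo_C_def)

lemma holo_C_coord [intro]: "holo_C N U (\<lambda>w. w i)"
  unfolding holo_C_def
proof (intro conjI ballI allI impI)
  show "continuous_on U (\<lambda>w. w i)"
    using continuous_on_product_then_coordinatewise[OF continuous_on_id, of U i] by simp
  show "(\<lambda>\<zeta>. (w(j := \<zeta>)) i) field_differentiable at (w j)" for w :: "nat \<Rightarrow> complex" and j
    by (cases "i = j") auto
qed

lemma holo_C_add [intro]: "holo_C N U f \<Longrightarrow> holo_C N U g \<Longrightarrow> holo_C N U (\<lambda>w. f w + g w)"
  by (auto simp: holo_C_def intro!: continuous_intros field_differentiable_add)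

lemma holo_C_diff [intro]: "holo_C N U f \<Longrightarrow> holo_C N U g \<Longrightarrow> holo_C N U (\<lambda>w. f w - g w)"
  by (auto simp: holo_C_def intro!: continuous_intros field_differentiable_diff)

lemma holo_C_mult [intro]: "holo_C N U f \<Longrightarrow> holo_C N U g \<Longrightarrow> holo_C N U (\<lambda>w. f w * g w)"
  by (auto simp: holo_C_def intro!: continuous_intros field_differentiable_mult)

lemma holo_C_sum [intro]: "(\<And>i. i \<in> I \<Longrightarrow> holo_C N U (f i)) \<Longrightarrow> holo_C N U (\<lambda>w. \<Sum>i\<in>I. f i w)"
  by (induction I rule: infinite_finite_induct) auto

lemma holo_C_exp [intro]:
  assumes "holo_C N U f" shows "holo_C N U (\<lambda>w. exp (f w))"
  unfolding holo_C_def
proof (intro conjI ballI allI impI)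
  show "continuous_on U (\<lambda>w. exp (f w))"
    using assms by (auto simp: holo_C_def intro!: continuous_intros)
  fix w j assume "w \<in> U" "j < N"
  then have "(exp \<circ> (\<lambda>\<zeta>. f (w(j := \<zeta>)))) field_differentiable at (w j)"
    using assms by (intro field_differentiable_compose) (auto simp: holo_C_def field_differentiable_within_exp)
  then show "(\<lambda>\<zeta>. exp (f (w(j := \<zeta>)))) field_differentiable at (w j)"
    by (simp add: o_def)
qed

text \<open>Near each point \<open>cpd j f\<close> is a uniform limit of difference quotients, and
  these are holomorphic in all variables at once. This takes the place of a Cauchy integral
  depending on parameters.\<close>

lemma holo_C_cpd:
  assumes f: "holo_C N U f" and U: "open_in_C N U" and j: "j < N"
  shows "holo_C N U (cpd j f)"
proof (rule holo_C_local[OF U])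
  fix p assume p: "p \<in> U"
  obtain r where r: "r > 0" "\<And>w. w \<in> Cspace N \<Longrightarrow> sqdist N p w \<le> r \<Longrightarrow> w \<in> U"
    using open_in_C_contains_ball[OF U p] by metis
  define B where "B = {w \<in> Cspace N. sqdist N p w \<le> r}"
  have "compact (f ` B)"
  proof (rule compact_continuous_image)
    show "continuous_on B f"
      using f r(2) unfolding holo_C_def B_def by (elim conjE continuous_on_subset) blast
  qed (simp add: B_def compact_closed_ball_Cspace)
  then obtain M where M: "\<And>w. w \<in> B \<Longrightarrow> cmod (f w) \<le> M"
    by (meson bounded_iff compact_imp_bounded imageI)
  \<comment> \<open>Points with squared distance below r / 4 and shifts of length at most \<delta>,
    where \<delta>^2 = r / 4: by \<open>sqdist_shift_le\<close> the result has squared distance at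
    most r and stays in the compact ball \<open>B\<close>, where \<open>f\<close> is bounded by
    \<open>M\<close>.\<close>
  define W where "W = {w \<in> Cspace N. sqdist N p w < r / 4}"
  define \<delta> where "\<delta> = sqrt r / 2"
  have \<delta>: "\<delta> > 0" "\<delta>\<^sup>2 = r / 4"
    using r(1) by (auto simp: \<delta>_def power_divide)
  have shift: "w(j := w j + t) \<in> B" if "w \<in> W" "cmod t \<le> \<delta>" for w t
  proof -
    have "(cmod t)\<^sup>2 \<le> r / 4"
      using power_mono[OF that(2), of 2] \<delta> by simp
    then show ?thesis
      using that sqdist_shift_le[OF j, of p w t] j by (auto simp: B_def W_def Cspace_upd)
  qed
  \<comment> \<open>Nonzero steps tending to 0 and bounded by \<delta> / 2, the range of
    \<open>deriv_remainder_bound\<close>.\<close>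
  define t where "t n = complex_of_real (\<delta> / 2 / real (Suc n))" for n
  have t: "cmod (t n) \<le> \<delta> / 2" "t n \<noteq> 0" for n
  proof -
    have "cmod (t n) = \<delta> / 2 / real (Suc n)"
      using \<delta>(1) unfolding t_def norm_of_real by simp
    moreover have "\<delta> / 2 / real (Suc n) \<le> \<delta> / 2 / 1"
      using \<delta>(1) by (intro divide_left_mono) auto
    ultimately show "cmod (t n) \<le> \<delta> / 2" by simp
    show "t n \<noteq> 0"
      using \<delta>(1) unfolding t_def of_real_eq_0_iff by simp
  qed
  define q where "q n w = (f (w(j := w j + t n)) - f w) * inverse (t n)" for n w
  have Wp: "open_in_C N W" "p \<in> W" "W \<subseteq> U" 
    using open_in_C_ball[of N p "r / 4"] r open_in_C_subset[OF U p] by (auto simp: W_def)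
  have q: "holo_C N W (q n)" for n
    unfolding q_def
  proof (intro holo_C_mult holo_C_diff holo_C_const holo_C_shift[OF f _ j] holo_C_subset[OF f])
    show "w(j := w j + t n) \<in> U" if "w \<in> W" for w
      using shift[OF that, of "t n"] t(1)[of n] \<delta>(1) r(2) by (simp add: B_def)
  qed (rule Wp(3))
  have "uniform_limit W q (cpd j f) sequentially"
    unfolding uniform_limit_iff
  proof (intro allI impI)
    fix e :: real assume "0 < e"
    have bd: "cmod (q n w - cpd j f w) \<le> 8 * M / \<delta>\<^sup>2 * cmod (t n)" if w: "w \<in> W" for n w
    proof -
      have wC: "w \<in> Cspace N" using w by (simp add: W_def)
      have cb: "cball (w j) \<delta> \<subseteq> {\<zeta>. w(j := \<zeta>) \<in> B}"
      proof
        fix \<zeta> assume "\<zeta> \<in> cball (w j) \<delta>"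
        then show "\<zeta> \<in> {\<zeta>. w(j := \<zeta>) \<in> B}"
          using shift[OF w, of "\<zeta> - w j"] by (simp add: dist_norm norm_minus_commute)
      qed
      have "cmod (f (w(j := w j + t n)) - f (w(j := w j)) - deriv (\<lambda>\<zeta>. f (w(j := \<zeta>))) (w j) * t n)
          \<le> 8 * M / \<delta>\<^sup>2 * (cmod (t n))\<^sup>2"
      proof (rule deriv_remainder_bound[OF holo_C_slice[OF f U wC j] open_in_C_slice[OF U wC j]])
        show "cball (w j) \<delta> \<subseteq> {\<zeta>. w(j := \<zeta>) \<in> U}"
          using cb r(2) by (auto simp: B_def)
        show "cmod (f (w(j := \<zeta>))) \<le> M" if "\<zeta> \<in> cball (w j) \<delta>" for \<zeta>
          using cb M that by blast
      qed (use \<delta> t in auto)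
      then have "cmod ((q n w - cpd j f w) * t n) \<le> 8 * M / \<delta>\<^sup>2 * cmod (t n) * cmod (t n)"
        using t(2)[of n] by (simp add: q_def cpd_def left_diff_distrib power2_eq_square mult.assoc)
      then show ?thesis
        using t(2)[of n] by (simp only: norm_mult mult_le_cancel_right) auto
    qed
    have "(\<lambda>n. 8 * M / \<delta>\<^sup>2 * cmod (t n)) \<longlonglongrightarrow> 8 * M / \<delta>\<^sup>2 * cmod (of_real (\<delta> / 2 * 0))"
      unfolding t_def divide_inverse[of "\<delta> / 2"]
      by (intro tendsto_intros LIMSEQ_inverse_real_of_nat)
    then have "eventually (\<lambda>n. 8 * M / \<delta>\<^sup>2 * cmod (t n) < e) sequentially"
      using \<open>0 < e\<close> by (auto dest: order_tendstoD)
    then show "\<forall>\<^sub>F n in sequentially. \<forall>w\<in>W. dist (q n w) (cpd j f w) < e"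
    proof eventually_elim
      case (elim n)
      show ?case
      proof
        fix w assume "w \<in> W"
        then show "dist (q n w) (cpd j f w) < e"
          using bd[of w n] elim by (simp add: dist_norm)
      qed
    qed
  qed
  then have "holo_C N W (cpd j f)"
    by (rule holo_C_uniform_limit[OF Wp(1) q])
  then show "\<exists>W. open_in_C N W \<and> p \<in> W \<and> W \<subseteq> U \<and> holo_C N W (cpd j f)"
    using Wp by blast
qed

section \<open>Smoothness and complex Hessians\<close>

lemma continuous_on_line_C: "continuous_on S (\<lambda>t. line_C w j c t)"
  unfolding line_C_def by (intro continuous_on_upd continuous_intros)

lemma line_C_0 [simp]: "line_C w j c 0 = w"
  by (simp add: line_C_def)

lemma line_C_in_Cspace: "w \<in> Cspace N \<Longrightarrow> j < N \<Longrightarrow> line_C w j c t \<in> Cspace N"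
  by (simp add: line_C_def Cspace_upd)

lemma eventually_line_C:
  assumes "open_in_C N U" "w \<in> U" "j < N"
  shows "eventually (\<lambda>t. line_C w j c t \<in> U) (nhds 0)"
proof -
  obtain O' where O': "open O'" "U = Cspace N \<inter> O'"
    using assms(1) by (auto simp: openin_open)
  have w: "w \<in> Cspace N"
    using assms by (rule_tac open_in_C_subset)
  have "open ((\<lambda>t. line_C w j c t) -` O')"
    using O'(1) by (intro open_vimage continuous_on_line_C)
  then have "eventually (\<lambda>t. t \<in> (\<lambda>t. line_C w j c t) -` O') (nhds 0)"
    using O' assms(2) by (intro eventually_nhds_in_open) auto
  then show ?thesis
    by eventually_elim (use O' line_C_in_Cspace[OF w assms(3)] in auto)
qed

lemma has_vector_derivative_line_cong:
  assumes "open_in_C N U" "w \<in> U" "j < N" "\<And>v. v \<in> U \<Longrightarrow> f v = g v"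
  shows "((\<lambda>t. f (line_C w j c t)) has_vector_derivative d) (at 0) \<longleftrightarrow>
    ((\<lambda>t. g (line_C w j c t)) has_vector_derivative d) (at 0)"
  using eventually_line_C[OF assms(1-3), of c] assms(2,4)
  by (intro has_vector_derivative_cong_ev) (auto elim: eventually_mono)

lemma pd_cong:
  assumes "open_in_C N U" "w \<in> U" "j < N" "\<And>v. v \<in> U \<Longrightarrow> f v = g v"
  shows "pd j c f w = pd j c g w"
  unfolding pd_def vector_derivative_def
  using has_vector_derivative_line_cong[OF assms(1-3), of f g] assms(4) by simp

lemma Ck_C_cong:
  assumes "open_in_C N U" "\<And>v. v \<in> U \<Longrightarrow> f v = g v"
  shows "Ck_C k N U f \<longleftrightarrow> Ck_C k N U g"
  using assms(2)
proof (induction k arbitrary: f g)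
  case 0
  then show ?case
    by (simp cong: continuous_on_cong)
next
  case (Suc k)
  have "continuous_on U f \<longleftrightarrow> continuous_on U g"
    using Suc.prems by (simp cong: continuous_on_cong)
  moreover have "((\<lambda>t. f (line_C w j c t)) differentiable (at 0)) \<longleftrightarrow>
      ((\<lambda>t. g (line_C w j c t)) differentiable (at 0))" if "w \<in> U" "j < N" for w j c
    using has_vector_derivative_line_cong[OF assms(1) that, of f g] Suc.prems
    by (meson differentiableI_vector vector_derivative_works)
  moreover have "Ck_C k N U (pd j c f) \<longleftrightarrow> Ck_C k N U (pd j c g)" if "j < N" for j c
    using pd_cong[OF assms(1) _ that Suc.prems] by (intro Suc.IH)
  ultimately show ?case
    by simp
qed

text \<open>\<open>Ck_C\<close> iterates the total function \<open>pd j c f\<close>, for which a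
  formula is known only on U. This rule lets an explicit derivative D take its place.\<close>

lemma Ck_C_SucI:
  assumes U: "open_in_C N U" and "continuous_on U f"
    and der: "\<And>w j c. w \<in> U \<Longrightarrow> j < N \<Longrightarrow> c \<in> {1, \<i>} \<Longrightarrow>
      ((\<lambda>t. f (line_C w j c t)) has_vector_derivative D j c w) (at 0)"
    and "\<And>j c. j < N \<Longrightarrow> c \<in> {1, \<i>} \<Longrightarrow> Ck_C k N U (D j c)"
  shows "Ck_C (Suc k) N U f"
proof -
  have "pd j c f w = D j c w" if "w \<in> U" "j < N" "c \<in> {1, \<i>}" for w j c
    unfolding pd_def using der[OF that] by (rule vector_derivative_at)
  then have "Ck_C k N U (pd j c f)" if "j < N" "c \<in> {1, \<i>}" for j c
    using assms(4)[OF that] Ck_C_cong[OF U, of "pd j c f" "D j c" k] that by blast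
  then show ?thesis
    using assms(2) der differentiableI_vector by (simp, blast)
qed

lemma holo_C_line_derivative:
  assumes "holo_C N U h" "w \<in> U" "j < N"
  shows "((\<lambda>t. h (line_C w j c t)) has_vector_derivative c * cpd j h w) (at 0)"
proof -
  have "((\<lambda>\<zeta>. h (w(j := \<zeta>))) has_field_derivative cpd j h w) (at (w j))"
    using assms unfolding holo_C_def cpd_def by (simp add: DERIV_deriv_iff_field_differentiable)
  moreover have "((\<lambda>t. w j + of_real t * c) has_vector_derivative c) (at 0)"
    by (auto intro!: derivative_eq_intros)
  ultimately have "((\<lambda>\<zeta>. h (w(j := \<zeta>))) \<circ> (\<lambda>t. w j + of_real t * c) has_vector_derivative c * cpd j h w) (at 0)"
    by (intro field_vector_diff_chain_at) auto
  then show ?thesis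
    by (simp add: o_def line_C_def)
qed

lemma holo_C_continuous_on: "holo_C N U h \<Longrightarrow> continuous_on U h"
  by (simp add: holo_C_def)

text \<open>The induction closes because the derivative of Re h along c is the real part of
  \<open>c * cpd j h\<close>, which is holomorphic again.\<close>

lemma Ck_C_Re_holo:
  assumes U: "open_in_C N U" and "holo_C N U h"
  shows "Ck_C k N U (\<lambda>w. Re (h w))"
  using assms(2)
proof (induction k arbitrary: h)
  case 0
  then show ?case
    by (auto intro!: continuous_intros holo_C_continuous_on)
next
  case (Suc k)
  show ?case
  proof (rule Ck_C_SucI[OF U, where D = "\<lambda>j c w. Re (c * cpd j h w)"])
    show "continuous_on U (\<lambda>w. Re (h w))"
      using Suc.prems by (auto intro!: continuous_intros holo_C_continuous_on)
    show "((\<lambda>t. Re (h (line_C w j c t))) has_vector_derivative Re (c * cpd j h w)) (at 0)"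
      if "w \<in> U" "j < N" for w j c
      by (rule bounded_linear.has_vector_derivative[OF bounded_linear_Re
            holo_C_line_derivative[OF Suc.prems that]])
    show "Ck_C k N U (\<lambda>w. Re (c * cpd j h w))" if "j < N" for j c
      by (intro Suc.IH holo_C_mult holo_C_const holo_C_cpd Suc.prems U that)
  qed
qed

text \<open>Along a coordinate line \<open>sqdist\<close> is a polynomial of degree two in t, whose
  linear coefficient is the derivative.\<close>

lemma sqdist_line_derivative:
  assumes "j < N"
  shows "((\<lambda>t. sqdist N a (line_C w j c t)) has_vector_derivative 2 * Re (cnj c * (w j - a j))) (at 0)"
proof -
  have "sqdist N a (line_C w j c t) =
      sqdist N a w + 2 * t * Re (cnj c * (w j - a j)) + t\<^sup>2 * (cmod c)\<^sup>2" for t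
    unfolding line_C_def sqdist_upd[OF assms] cmod_power2
    by (simp add: power2_eq_square algebra_simps)
  then show ?thesis
    unfolding has_real_derivative_iff_has_vector_derivative[symmetric]
    by (auto intro!: derivative_eq_intros)
qed

lemma quadratic_line_derivative:
  fixes c :: real
  assumes "holo_C N U h" "w \<in> U" "j < N"
  shows "((\<lambda>t. Re (h (line_C w j d t)) + c * sqdist N a (line_C w j d t)) has_vector_derivative
    Re (d * cpd j h w + 2 * of_real c * cnj d * (w j - a j))) (at 0)"
proof -
  have "((\<lambda>t. Re (h (line_C w j d t)) + c * sqdist N a (line_C w j d t)) has_vector_derivative
      Re (d * cpd j h w) + c * (2 * Re (cnj d * (w j - a j)))) (at 0)"
    by (intro has_vector_derivative_add bounded_linear.has_vector_derivative[OF bounded_linear_Re]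
      holo_C_line_derivative[OF assms] bounded_linear.has_vector_derivative[OF bounded_linear_mult_right]
      sqdist_line_derivative[OF assms(3)])
  then show ?thesis
    by (simp add: algebra_simps)
qed

text \<open>One differentiation turns \<open>sqdist\<close> into the real part of a complex affine
  function, so from the first derivatives on \<open>Ck_C_Re_holo\<close> covers the whole
  sum.\<close>

lemma smooth_C_quadratic:
  assumes U: "open_in_C N U" and h: "holo_C N U h"
  shows "smooth_C N U (\<lambda>w. Re (h w) + c * sqdist N a w)"
proof -
  have cont: "continuous_on U (\<lambda>w. Re (h w) + c * sqdist N a w)"
    by (intro continuous_intros holo_C_continuous_on[OF h])
  have "Ck_C k N U (\<lambda>w. Re (h w) + c * sqdist N a w)" for k
  proof (cases k)
    case (Suc m)
    show ?thesis
      unfolding Suc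
    proof (rule Ck_C_SucI[OF U cont quadratic_line_derivative[OF h]])
      show "Ck_C m N U (\<lambda>w. Re (d * cpd j h w + 2 * complex_of_real c * cnj d * (w j - a j)))"
        if "j < N" for j d
        by (intro Ck_C_Re_holo U holo_C_add holo_C_mult holo_C_diff holo_C_const holo_C_coord
            holo_C_cpd h that)
    qed
  qed (use cont in simp)
  then show ?thesis
    by (simp add: smooth_C_def)
qed

text \<open>$\mathrm{Re}\,h$ is pluriharmonic and does not contribute to the complex Hessian.\<close>

lemma complex_hessian_quadratic:
  assumes U: "open_in_C N U" and h: "holo_C N U h" and p: "p \<in> U"
  shows "complex_hessian N (\<lambda>w. Re (h w) + c * sqdist N a w) p =
    Matrix.mat N N (\<lambda>(i, j). if i = j then complex_of_real c else 0)"
proof -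
  let ?\<rho> = "\<lambda>w. complex_of_real (Re (h w) + c * sqdist N a w)"
  have "wirt i (wirt_bar j ?\<rho>) p = (if i = j then complex_of_real c else 0)"
    if ij: "i < N" "j < N" for i j
  proof -
    \<comment> \<open>The conjugate of \<open>cpd j h\<close> is antiholomorphic, so the outer
      \<open>wirt i\<close> annihilates it and only the affine summand contributes.\<close>
    define G where "G w = cnj (cpd j h w) / 2 + of_real c * (w j - a j)" for w
    have "pd j d ?\<rho> w = of_real (Re (d * cpd j h w + 2 * of_real c * cnj d * (w j - a j)))"
      if "w \<in> U" for w d
      unfolding pd_def
      by (intro vector_derivative_at bounded_linear.has_vector_derivative[OF bounded_linear_of_real]
          quadratic_line_derivative[OF h that ij(2)])
    then have G: "wirt_bar j ?\<rho> w = G w" if "w \<in> U" for w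
      using that by (simp add: wirt_bar_def G_def complex_eq_iff)
    have "pd i d (wirt_bar j ?\<rho>) p = cnj (d * cpd i (cpd j h) p) / 2 + of_real c * (if i = j then d else 0)"
      for d
    proof -
      have 1: "((\<lambda>t. cnj (cpd j h (line_C p i d t)) / 2) has_vector_derivative
          cnj (d * cpd i (cpd j h) p) / 2) (at 0)"
        by (intro bounded_linear.has_vector_derivative[OF bounded_linear_divide]
          bounded_linear.has_vector_derivative[OF bounded_linear_cnj]
          holo_C_line_derivative[OF holo_C_cpd[OF h U ij(2)] p ij(1)])
      have "((\<lambda>t. (line_C p i d t) j) has_vector_derivative (if i = j then d else 0)) (at 0)"
        unfolding line_C_def by (cases "i = j") (auto intro!: derivative_eq_intros)
      then have 2: "((\<lambda>t. of_real c * (line_C p i d t j - a j)) has_vector_derivative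
          of_real c * ((if i = j then d else 0) - 0)) (at 0)"
        by (intro bounded_linear.has_vector_derivative[OF bounded_linear_mult_right]
          has_vector_derivative_diff has_vector_derivative_const)
      have "pd i d (wirt_bar j ?\<rho>) p = pd i d G p"
        by (rule pd_cong[OF U p ij(1) G])
      also have "\<dots> = cnj (d * cpd i (cpd j h) p) / 2 + of_real c * ((if i = j then d else 0) - 0)"
        unfolding pd_def G_def by (intro vector_derivative_at has_vector_derivative_add 1 2)
      finally show ?thesis by simp
    qed
    then show ?thesis
      by (simp add: wirt_def complex_eq_iff)
  qed
  then show ?thesis
    unfolding complex_hessian_def by (intro cong_mat) auto
qed

lemma num_pos_eigenvalues_scalar:
  assumes "0 < (c :: real)"
  shows "num_pos_eigenvalues (Matrix.mat N N (\<lambda>(i, j). if i = j then complex_of_real c else 0)) = N"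
    (is "num_pos_eigenvalues ?A = N")
proof -
  have A: "?A \<in> carrier_mat N N" by simp
  have "char_poly ?A = (\<Prod>a\<leftarrow>diag_mat ?A. [:- a, 1:])"
    by (intro char_poly_upper_triangular[OF A]) (auto simp: upper_triangular_def)
  also have "diag_mat ?A = replicate N (complex_of_real c)"
    by (intro nth_equalityI) (auto simp: diag_mat_def)
  finally have ch: "char_poly ?A = [:- complex_of_real c, 1:] ^ N"
    by simp
  have "eigenvalue ?A k \<longleftrightarrow> k = complex_of_real c \<and> 0 < N" for k
    unfolding eigenvalue_root_char_poly[OF A] ch by (auto simp: poly_power)
  \<comment> \<open>For N = 0 there is no eigenvalue at all and the count is an empty sum.\<close>
  then have "{l :: real. 0 < l \<and> eigenvalue ?A (complex_of_real l)} = (if N = 0 then {} else {c})"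
    using assms by auto
  then show ?thesis
    unfolding num_pos_eigenvalues_def ch by (simp add: order_power_n_n)
qed

section \<open>Taylor expansion of second order\<close>

lemma sqdist_mono:
  assumes "\<And>i. i < N \<Longrightarrow> cmod (w i - a i) \<le> cmod (v i - a i)"
  shows "sqdist N a w \<le> sqdist N a v"
  unfolding sqdist_def by (intro sum_mono power_mono assms) auto

lemma continuous_on_ball_Cspace:
  fixes f :: "(nat \<Rightarrow> complex) \<Rightarrow> real"
  assumes "open_in_C N U" "continuous_on U f" "p \<in> U" "0 < e"
  obtains r where "r > 0"
    "\<And>w. w \<in> Cspace N \<Longrightarrow> sqdist N p w \<le> r \<Longrightarrow> w \<in> U \<and> \<bar>f w - f p\<bar> < e"
proof -
  have "openin (top_of_set U) (U \<inter> f -` ball (f p) e)"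
    using continuous_openin_preimage_gen[OF assms(2) open_ball] by blast
  then have o: "open_in_C N (U \<inter> f -` ball (f p) e)"
    using assms(1) openin_trans by blast
  have "p \<in> U \<inter> f -` ball (f p) e"
    using assms(3,4) by simp
  then obtain r where "r > 0" "\<And>w. w \<in> Cspace N \<Longrightarrow> sqdist N p w \<le> r \<Longrightarrow> w \<in> U \<inter> f -` ball (f p) e"
    using open_in_C_contains_ball[OF o] by metis
  then show ?thesis
    by (intro that[of r]) (auto simp: dist_real_def abs_minus_commute)
qed

lemma continuous_on_finite_ball_Cspace:
  fixes f :: "'i \<Rightarrow> (nat \<Rightarrow> complex) \<Rightarrow> real"
  assumes "finite I" "open_in_C N U" "\<And>i. i \<in> I \<Longrightarrow> continuous_on U (f i)" "p \<in> U" "0 < e"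
  obtains r where "r > 0"
    "\<And>w. w \<in> Cspace N \<Longrightarrow> sqdist N p w \<le> r \<Longrightarrow> w \<in> U \<and> (\<forall>i\<in>I. \<bar>f i w - f i p\<bar> < e)"
proof -
  have "\<exists>r>0. \<forall>w\<in>Cspace N. sqdist N p w \<le> r \<longrightarrow> w \<in> U \<and> (\<forall>i\<in>I. \<bar>f i w - f i p\<bar> < e)"
    using assms(1,3)
  proof (induction I)
    case empty
    then show ?case
      using open_in_C_contains_ball[OF assms(2,4)] by (metis empty_iff)
  next
    case (insert i I)
    then obtain r where r: "r > 0"
      "\<forall>w\<in>Cspace N. sqdist N p w \<le> r \<longrightarrow> w \<in> U \<and> (\<forall>i\<in>I. \<bar>f i w - f i p\<bar> < e)"
      by blast
    obtain s where s: "s > 0"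
      "\<And>w. w \<in> Cspace N \<Longrightarrow> sqdist N p w \<le> s \<Longrightarrow> w \<in> U \<and> \<bar>f i w - f i p\<bar> < e"
      using continuous_on_ball_Cspace[OF assms(2) _ assms(4,5), of "f i"] insert.prems by blast
    show ?case
      using r s by (intro exI[of _ "min r s"]) auto
  qed
  then show ?thesis
    using that by blast
qed

text \<open>\<open>Ck_C\<close> gives derivatives along a line at parameter 0 only. Other parameters
  are reached by moving the base point, which shifts the parameter.\<close>

lemma Ck_C_Suc_line_derivative:
  fixes f :: "(nat \<Rightarrow> complex) \<Rightarrow> real"
  assumes "Ck_C (Suc k) N U f" "line_C w j c s \<in> U" "j < N" "c \<in> {1, \<i>}"
  shows "((\<lambda>t. f (line_C w j c t)) has_real_derivative pd j c f (line_C w j c s)) (at s)"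
proof -
  have "(\<lambda>t. f (line_C (line_C w j c s) j c t)) differentiable (at 0)"
    using assms by (simp, blast)
  then have "((\<lambda>t. f (line_C (line_C w j c s) j c t)) has_real_derivative
      pd j c f (line_C w j c s)) (at 0)"
    unfolding pd_def has_real_derivative_iff_has_vector_derivative
    by (simp add: vector_derivative_works)
  moreover have "line_C (line_C w j c s) j c t = line_C w j c (t + s)" for t
    by (auto simp: line_C_def algebra_simps)
  ultimately show ?thesis
    using DERIV_shift[of "\<lambda>t. f (line_C w j c t)" _ 0 s] by simp
qed

text \<open>Mean value theorem for t of either sign. The intermediate parameter is only located by
  its absolute value, which is all that the ball estimates use.\<close>

lemma line_C_mvt:
  fixes f :: "(nat \<Rightarrow> complex) \<Rightarrow> real"
  assumes "Ck_C (Suc k) N U f" "j < N" "c \<in> {1, \<i>}"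
    and "\<And>s. \<bar>s\<bar> \<le> \<bar>t\<bar> \<Longrightarrow> line_C w j c s \<in> U"
  obtains s where "\<bar>s\<bar> \<le> \<bar>t\<bar>" "f (line_C w j c t) - f w = t * pd j c f (line_C w j c s)"
proof -
  let ?g = "\<lambda>t. f (line_C w j c t)"
  have d: "(?g has_real_derivative pd j c f (line_C w j c s)) (at s)" if "\<bar>s\<bar> \<le> \<bar>t\<bar>" for s
    by (rule Ck_C_Suc_line_derivative[OF assms(1) assms(4)[OF that] assms(2,3)])
  consider "t = 0" | "t > 0" | "t < 0" by linarith
  then show thesis
  proof cases
    case 1
    then show ?thesis by (intro that[of 0]) auto
  next
    case 2
    then obtain z where "0 < z" "z < t" "?g t - ?g 0 = (t - 0) * pd j c f (line_C w j c z)"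
      using MVT2[of 0 t ?g "\<lambda>s. pd j c f (line_C w j c s)"] d by auto
    then show ?thesis by (intro that[of z]) auto
  next
    case 3
    then obtain z where "t < z" "z < 0" "?g 0 - ?g t = (0 - t) * pd j c f (line_C w j c z)"
      using MVT2[of t 0 ?g "\<lambda>s. pd j c f (line_C w j c s)"] d by auto
    then show ?thesis by (intro that[of z]) auto
  qed
qed

text \<open>
  The pairs \<open>(j, 1)\<close> and \<open>(j, \<i>)\<close> stand for the real coordinates $x_j$ and $y_j$.
\<close>

definition rdirs :: "nat \<Rightarrow> (nat \<times> complex) set" where
  "rdirs N = {..<N} \<times> {1, \<i>}"

text \<open>\<open>Re (cnj c * h j)\<close> is the real part of \<open>h j\<close> for c = 1 and its
  imaginary part for c = \<i>.\<close>

definition rcoord :: "(nat \<Rightarrow> complex) \<Rightarrow> nat \<times> complex \<Rightarrow> real" where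
  "rcoord h a = Re (cnj (snd a) * h (fst a))"

definition rpd :: "nat \<times> complex \<Rightarrow> ((nat \<Rightarrow> complex) \<Rightarrow> real) \<Rightarrow> (nat \<Rightarrow> complex) \<Rightarrow> real" where
  "rpd a f = pd (fst a) (snd a) f"

lemma finite_rdirs [simp]: "finite (rdirs N)"
  by (simp add: rdirs_def)

lemma sum_rdirs: "(\<Sum>a\<in>rdirs N. g a) = (\<Sum>j<N. g (j, 1) + g (j, \<i>))"
proof -
  have "(\<Sum>a\<in>rdirs N. g a) = (\<Sum>(j, c)\<in>{..<N} \<times> {1, \<i>}. g (j, c))"
    by (simp add: rdirs_def)
  also have "\<dots> = (\<Sum>j<N. \<Sum>c\<in>{1, \<i>}. g (j, c))"
    by (rule sum.cartesian_product[symmetric])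
  finally show ?thesis
    by (simp add: complex_eq_iff)
qed

lemma Ck_C_rpd: "Ck_C (Suc k) N U f \<Longrightarrow> a \<in> rdirs N \<Longrightarrow> Ck_C k N U (rpd a f)"
  by (auto simp: rdirs_def rpd_def)

lemma Ck_C_continuous_on: "Ck_C k N U f \<Longrightarrow> continuous_on U f"
  by (cases k) auto

lemma abs_rcoord_le: "a \<in> rdirs N \<Longrightarrow> (rcoord (\<lambda>i. v i - p i) a)\<^sup>2 \<le> sqdist N p v"
proof -
  assume a: "a \<in> rdirs N"
  then have "\<bar>rcoord (\<lambda>i. v i - p i) a\<bar> \<le> cmod (v (fst a) - p (fst a))"
    unfolding rcoord_def using abs_Re_le_cmod[of "cnj (snd a) * (v (fst a) - p (fst a))"]
    by (auto simp: rdirs_def norm_mult)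
  then have "(rcoord (\<lambda>i. v i - p i) a)\<^sup>2 \<le> (cmod (v (fst a) - p (fst a)))\<^sup>2"
    using power_mono[of _ _ 2] by fastforce
  also have "\<dots> \<le> sqdist N p v"
    using a by (intro cmod_diff_le_sqdist) (auto simp: rdirs_def)
  finally show ?thesis .
qed

text \<open>Partial derivatives are all that is given, so v is reached from w by moving one real
  coordinate at a time. On each of the 2N segments the mean value theorem applies, with a derivative
  within e of its value at w.\<close>

lemma C1_expansion:
  fixes f :: "(nat \<Rightarrow> complex) \<Rightarrow> real"
  assumes U: "open_in_C N U" and f: "Ck_C (Suc k) N U f" and w: "w \<in> U" and e: "0 < e"
  obtains r where "r > 0"
    "\<And>v. v \<in> Cspace N \<Longrightarrow> sqdist N w v \<le> r \<Longrightarrow> v \<in> U \<and>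
      \<bar>f v - f w - (\<Sum>a\<in>rdirs N. rcoord (\<lambda>i. v i - w i) a * rpd a f w)\<bar>
        \<le> e * (\<Sum>a\<in>rdirs N. \<bar>rcoord (\<lambda>i. v i - w i) a\<bar>)"
proof -
  obtain r where r: "r > 0" and rUD: "\<And>v. v \<in> Cspace N \<Longrightarrow> sqdist N w v \<le> r \<Longrightarrow>
      v \<in> U \<and> (\<forall>a\<in>rdirs N. \<bar>rpd a f v - rpd a f w\<bar> < e)"
    using continuous_on_finite_ball_Cspace[of "rdirs N" N U "\<lambda>a. rpd a f" w e,
        OF finite_rdirs U Ck_C_continuous_on[OF Ck_C_rpd[OF f]] w e]
    by blast
  have rU: "v \<in> U" if "v \<in> Cspace N" "sqdist N w v \<le> r" for v
    using rUD[OF that] by blast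
  have rD: "\<bar>rpd a f v - rpd a f w\<bar> < e"
    if "v \<in> Cspace N" "sqdist N w v \<le> r" "a \<in> rdirs N" for v a
    using rUD[OF that(1,2)] that(3) by blast
  have wC: "w \<in> Cspace N"
    using open_in_C_subset[OF U w] .
  show thesis
  proof (rule that[OF r], intro conjI rU)
    fix v assume v: "v \<in> Cspace N" "sqdist N w v \<le> r"
    \<comment> \<open>Corners of the path: the first k complex coordinates already have their final
      values.\<close>
    define V where "V k = (\<lambda>i. if i < k then v i else w i)" for k
    define x where "x j = v j - w j" for j
    have V_C: "V k \<in> Cspace N" for k
      using v(1) wC by (auto simp: V_def Cspace_def)
    have step: "\<bar>f (line_C u j c t) - f u - t * pd j c f w\<bar> \<le> e * \<bar>t\<bar>"
      if j: "j < N" and c: "c \<in> {1, \<i>}" and u: "u \<in> Cspace N"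
        and b: "\<And>s. \<bar>s\<bar> \<le> \<bar>t\<bar> \<Longrightarrow> sqdist N w (line_C u j c s) \<le> r" for u j c t
    proof -
      have in_C: "line_C u j c s \<in> Cspace N" for s
        by (rule line_C_in_Cspace[OF u j])
      obtain s where s: "\<bar>s\<bar> \<le> \<bar>t\<bar>" "f (line_C u j c t) - f u = t * pd j c f (line_C u j c s)"
        using line_C_mvt[OF f j c, of t u] rU[OF in_C b] by blast
      have "\<bar>pd j c f (line_C u j c s) - pd j c f w\<bar> \<le> e"
        using rD[OF in_C b[OF s(1)], of "(j, c)"] j c by (simp add: rdirs_def rpd_def)
      then have "\<bar>t\<bar> * \<bar>pd j c f (line_C u j c s) - pd j c f w\<bar> \<le> \<bar>t\<bar> * e"
        by (intro mult_left_mono) auto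
      then show ?thesis
        unfolding s(2) by (simp add: abs_mult[symmetric] algebra_simps)
    qed
    have "\<bar>f (V k) - f w - (\<Sum>j<k. Re (x j) * pd j 1 f w + Im (x j) * pd j \<i> f w)\<bar>
        \<le> e * (\<Sum>j<k. \<bar>Re (x j)\<bar> + \<bar>Im (x j)\<bar>)" if "k \<le> N" for k
      using that
    proof (induction k)
      case 0
      then show ?case by (simp add: V_def)
    next
      case (Suc k)
      \<comment> \<open>The corner inside step k: real part moved, imaginary part not yet.\<close>
      define m where "m = line_C (V k) k 1 (Re (x k))"
      have k: "k < N" using Suc.prems by simp
      have "\<bar>f m - f (V k) - Re (x k) * pd k 1 f w\<bar> \<le> e * \<bar>Re (x k)\<bar>"
        unfolding m_def
      proof (rule step[OF k _ V_C])
        fix s :: real assume s: "\<bar>s\<bar> \<le> \<bar>Re (x k)\<bar>"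
        have "\<bar>s\<bar> \<le> cmod (x k)"
          using s abs_Re_le_cmod[of "x k"] by linarith
        then have "sqdist N w (line_C (V k) k 1 s) \<le> sqdist N w v"
          by (intro sqdist_mono) (auto simp: line_C_def V_def x_def)
        then show "sqdist N w (line_C (V k) k 1 s) \<le> r"
          using v(2) by simp
      qed simp
      moreover have "\<bar>f (line_C m k \<i> (Im (x k))) - f m - Im (x k) * pd k \<i> f w\<bar> \<le> e * \<bar>Im (x k)\<bar>"
      proof (rule step[OF k])
        show "m \<in> Cspace N"
          unfolding m_def by (rule line_C_in_Cspace[OF V_C k])
        fix s :: real assume s: "\<bar>s\<bar> \<le> \<bar>Im (x k)\<bar>"
        \<comment> \<open>On the second leg the real part is complete and |s| is at most the modulus
          of the imaginary part, so the leg is no farther out than \<open>x k\<close> and stays in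
          the ball.\<close>
        have "cmod (of_real (Re (x k)) + of_real s * \<i>) \<le> cmod (x k)"
          unfolding cmod_def using s by (simp add: abs_le_square_iff)
        then have "sqdist N w (line_C m k \<i> s) \<le> sqdist N w v"
          by (intro sqdist_mono) (auto simp: line_C_def V_def x_def m_def algebra_simps)
        then show "sqdist N w (line_C m k \<i> s) \<le> r"
          using v(2) by simp
      qed simp
      moreover have "line_C m k \<i> (Im (x k)) = V (Suc k)"
        by (auto simp: m_def line_C_def V_def x_def less_Suc_eq complex_eq_iff)
      ultimately show ?case
        using Suc.IH Suc.prems by (simp add: distrib_left)
    qed
    from this[of N] have "\<bar>f (V N) - f w - (\<Sum>j<N. Re (x j) * pd j 1 f w + Im (x j) * pd j \<i> f w)\<bar>
        \<le> e * (\<Sum>j<N. \<bar>Re (x j)\<bar> + \<bar>Im (x j)\<bar>)" by simp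
    moreover have "V N = v"
      using v(1) wC by (auto simp: V_def Cspace_def)
    ultimately show "\<bar>f v - f w - (\<Sum>a\<in>rdirs N. rcoord (\<lambda>i. v i - w i) a * rpd a f w)\<bar>
        \<le> e * (\<Sum>a\<in>rdirs N. \<bar>rcoord (\<lambda>i. v i - w i) a\<bar>)"
      by (simp add: sum_rdirs rcoord_def rpd_def x_def)
  qed
qed

definition ray :: "(nat \<Rightarrow> complex) \<Rightarrow> (nat \<Rightarrow> complex) \<Rightarrow> real \<Rightarrow> nat \<Rightarrow> complex" where
  "ray w h t = (\<lambda>i. w i + of_real t * h i)"

lemma ray_in_Cspace: "w \<in> Cspace N \<Longrightarrow> h \<in> Cspace N \<Longrightarrow> ray w h t \<in> Cspace N"
  by (auto simp: ray_def Cspace_def)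

lemma sqdist_ray: "sqdist N w (ray w h t) = t\<^sup>2 * sqdist N (\<lambda>_. 0) h"
  by (simp add: sqdist_def ray_def norm_mult power_mult_distrib sum_distrib_left)

text \<open>The chain rule along a ray. Expanding at the point with parameter s leaves an error e' *
  |t| * S in the increment, hence e' * S in the quotient.\<close>

lemma C1_ray_derivative:
  fixes f :: "(nat \<Rightarrow> complex) \<Rightarrow> real"
  assumes U: "open_in_C N U" and f: "Ck_C (Suc k) N U f" and h: "h \<in> Cspace N"
    and s: "ray w h s \<in> U"
  shows "((\<lambda>t. f (ray w h t)) has_real_derivative (\<Sum>a\<in>rdirs N. rcoord h a * rpd a f (ray w h s))) (at s)"
proof -
  define u where "u = ray w h s"
  define D where "D = (\<Sum>a\<in>rdirs N. rcoord h a * rpd a f u)"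
  define S where "S = (\<Sum>a\<in>rdirs N. \<bar>rcoord h a\<bar>)"
  have S: "S \<ge> 0" by (simp add: S_def sum_nonneg)
  have uU: "u \<in> U"
    using s by (simp add: u_def)
  have uC: "u \<in> Cspace N"
    by (rule open_in_C_subset[OF U uU])
  have "((\<lambda>t. f (ray u h t)) has_real_derivative D) (at 0)"
    unfolding has_field_derivative_iff LIM_eq
  proof (intro allI impI)
    fix e :: real assume e: "0 < e"
    \<comment> \<open>Adding 1 guards against S = 0; the choice of d below does the same for h =
      0.\<close>
    define e' where "e' = e / (S + 1)"
    have e': "0 < e'" "e' * S < e"
      using e S by (auto simp: e'_def field_simps)
    obtain r where r: "r > 0"
      "\<And>v. v \<in> Cspace N \<Longrightarrow> sqdist N u v \<le> r \<Longrightarrow> v \<in> U \<and>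
        \<bar>f v - f u - (\<Sum>a\<in>rdirs N. rcoord (\<lambda>i. v i - u i) a * rpd a f u)\<bar>
          \<le> e' * (\<Sum>a\<in>rdirs N. \<bar>rcoord (\<lambda>i. v i - u i) a\<bar>)"
      using C1_expansion[OF U f uU e'(1)] by blast
    define d where "d = sqrt (r / (sqdist N (\<lambda>_. 0) h + 1))"
    have hp: "0 < sqdist N (\<lambda>_. 0) h + 1"
      using sqdist_nonneg[of N "\<lambda>_. 0" h] by linarith
    have d: "d > 0" "d\<^sup>2 * (sqdist N (\<lambda>_. 0) h + 1) = r"
      using r(1) hp by (auto simp: d_def)
    show "\<exists>d>0. \<forall>t. t \<noteq> 0 \<and> norm (t - 0) < d \<longrightarrow>
        norm ((f (ray u h t) - f (ray u h 0)) / (t - 0) - D) < e"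
    proof (intro exI[of _ d] conjI d(1) allI impI)
      fix t :: real assume t: "t \<noteq> 0 \<and> norm (t - 0) < d"
      have "t\<^sup>2 * sqdist N (\<lambda>_. 0) h \<le> d\<^sup>2 * (sqdist N (\<lambda>_. 0) h + 1)"
        using t power_mono[of "\<bar>t\<bar>" d 2] by (intro mult_mono) auto
      then have "sqdist N u (ray u h t) \<le> r"
        using d(2) by (simp add: sqdist_ray)
      then have "\<bar>f (ray u h t) - f u - (\<Sum>a\<in>rdirs N. rcoord (\<lambda>i. ray u h t i - u i) a * rpd a f u)\<bar>
          \<le> e' * (\<Sum>a\<in>rdirs N. \<bar>rcoord (\<lambda>i. ray u h t i - u i) a\<bar>)"
        using r(2)[OF ray_in_Cspace[OF uC h]] by blast
      moreover have rc: "rcoord (\<lambda>i. ray u h t i - u i) a = t * rcoord h a" for a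
        by (simp add: rcoord_def ray_def algebra_simps)
      ultimately have "\<bar>f (ray u h t) - f u - t * D\<bar> \<le> e' * (\<bar>t\<bar> * S)"
        by (simp only: rc D_def S_def sum_distrib_left abs_mult mult.assoc)
      moreover have "(f (ray u h t) - f u) / t - D = (f (ray u h t) - f u - t * D) / t"
        using t by (simp add: field_simps)
      ultimately have "\<bar>(f (ray u h t) - f u) / t - D\<bar> \<le> e' * S"
        using t by (simp add: divide_le_eq mult.assoc mult.commute[of S])
      moreover have "ray u h 0 = u"
        by (simp add: ray_def)
      ultimately show "norm ((f (ray u h t) - f (ray u h 0)) / (t - 0) - D) < e"
        using e'(2) by simp
    qed
  qed
  moreover have "ray u h t = ray w h (t + s)" for t
    by (simp add: u_def ray_def algebra_simps)
  ultimately show ?thesis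
    using DERIV_shift[of "\<lambda>t. f (ray w h t)" D 0 s] by (simp add: D_def u_def)
qed

text \<open>Taylor's formula on the segment from p to v, with the chain rule applied to f and then
  to each first derivative. Continuity of the second derivatives allows the intermediate point to be
  replaced by p.\<close>

lemma C2_expansion:
  fixes f :: "(nat \<Rightarrow> complex) \<Rightarrow> real"
  assumes U: "open_in_C N U" and f: "Ck_C (Suc (Suc k)) N U f" and p: "p \<in> U" and e: "0 < e"
  obtains r where "r > 0"
    "\<And>v. v \<in> Cspace N \<Longrightarrow> sqdist N p v \<le> r \<Longrightarrow> v \<in> U \<and>
      \<bar>f v - f p - (\<Sum>a\<in>rdirs N. rcoord (\<lambda>i. v i - p i) a * rpd a f p)
         - (\<Sum>a\<in>rdirs N. \<Sum>b\<in>rdirs N. rcoord (\<lambda>i. v i - p i) a * rcoord (\<lambda>i. v i - p i) b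
              * rpd a (rpd b f) p) / 2\<bar> \<le> e * sqdist N p v"
proof -
  define n where "n = real (card (rdirs N))"
  \<comment> \<open>The error is shared by n^2 second derivatives, each weighted by at most
    \<open>sqdist N p v\<close>; adding 1 covers n = 0.\<close>
  define e' where "e' = e / (n\<^sup>2 + 1)"
  have n: "n \<ge> 0" "n\<^sup>2 + 1 > 0" by (auto simp: n_def add_nonneg_pos)
  have e': "e' > 0" "n\<^sup>2 * e' \<le> e"
    using e n by (auto simp: e'_def field_simps)
  have c: "continuous_on U (rpd (fst ab) (rpd (snd ab) f))" if "ab \<in> rdirs N \<times> rdirs N" for ab
    using Ck_C_continuous_on[OF Ck_C_rpd[OF Ck_C_rpd[OF f]]] that by auto
  obtain r where r: "r > 0" and rUD: "\<And>v. v \<in> Cspace N \<Longrightarrow> sqdist N p v \<le> r \<Longrightarrow> v \<in> U \<and>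
      (\<forall>ab\<in>rdirs N \<times> rdirs N. \<bar>rpd (fst ab) (rpd (snd ab) f) v - rpd (fst ab) (rpd (snd ab) f) p\<bar> < e')"
    using continuous_on_finite_ball_Cspace[of "rdirs N \<times> rdirs N" N U
        "\<lambda>ab. rpd (fst ab) (rpd (snd ab) f)" p e', OF finite_cartesian_product[OF finite_rdirs finite_rdirs]
        U c p e'(1)] by blast
  have rU: "v \<in> U" if "v \<in> Cspace N" "sqdist N p v \<le> r" for v
    using rUD[OF that] by blast
  have rD: "\<bar>rpd a (rpd b f) v - rpd a (rpd b f) p\<bar> < e'"
    if "v \<in> Cspace N" "sqdist N p v \<le> r" "a \<in> rdirs N" "b \<in> rdirs N" for v a b
    using rUD[OF that(1,2)] that(3,4) by auto
  have pC: "p \<in> Cspace N"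
    using open_in_C_subset[OF U p] .
  show thesis
  proof (rule that[OF r], intro conjI rU)
    fix v assume v: "v \<in> Cspace N" "sqdist N p v \<le> r"
    define h where "h = (\<lambda>i. v i - p i)"
    have h: "h \<in> Cspace N"
      using v(1) pC by (auto simp: h_def Cspace_def)
    have sh: "sqdist N (\<lambda>_. 0) h = sqdist N p v"
      by (simp add: sqdist_def h_def)
    define Q where "Q w = (\<Sum>b\<in>rdirs N. rcoord h b * (\<Sum>a\<in>rdirs N. rcoord h a * rpd a (rpd b f) w))" for w
    have ball: "sqdist N p (ray p h t) \<le> r" if "0 \<le> t" "t \<le> 1" for t
    proof -
      have "t\<^sup>2 * sqdist N p v \<le> 1 * sqdist N p v"
        using that by (intro mult_right_mono) (auto simp: power_le_one)
      then show ?thesis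
        using v(2) by (simp add: sqdist_ray sh)
    qed
    have inU: "ray p h t \<in> U" if "0 \<le> t" "t \<le> 1" for t
      by (intro rU ball that ray_in_Cspace pC h)
    \<comment> \<open>Value, first and second derivative along the segment, in the form that
      \<open>Maclaurin\<close> expects.\<close>
    define diff where "diff m = (if m = 0 then (\<lambda>t. f (ray p h t)) else if m = 1
      then (\<lambda>t. (\<Sum>b\<in>rdirs N. rcoord h b * rpd b f (ray p h t))) else (\<lambda>t. Q (ray p h t)))" for m :: nat
    have "\<forall>m t. m < 2 \<and> 0 \<le> t \<and> t \<le> 1 \<longrightarrow> (diff m has_real_derivative diff (Suc m) t) (at t)"
    proof (intro allI impI)
      fix m :: nat and t :: real assume m: "m < 2 \<and> 0 \<le> t \<and> t \<le> 1"
      have 1: "((\<lambda>t. f (ray p h t)) has_real_derivative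
          (\<Sum>b\<in>rdirs N. rcoord h b * rpd b f (ray p h t))) (at t)"
        using m by (intro C1_ray_derivative[OF U f h] inU) auto
      have 2: "((\<lambda>t. \<Sum>b\<in>rdirs N. rcoord h b * rpd b f (ray p h t)) has_real_derivative
          Q (ray p h t)) (at t)"
        unfolding Q_def using m
        by (intro DERIV_sum DERIV_cmult C1_ray_derivative[OF U Ck_C_rpd[OF f] h] inU) auto
      consider "m = 0" | "m = 1" using m by linarith
      then show "(diff m has_real_derivative diff (Suc m) t) (at t)"
        using 1 2 by cases (simp_all add: diff_def)
    qed
    then obtain t where t: "0 < t" "t < 1"
      "f (ray p h 1) = (\<Sum>m<2. diff m 0 / fact m * 1 ^ m) + diff 2 t / fact 2 * 1 ^ 2"
      using Maclaurin[of 1 2 diff "\<lambda>t. f (ray p h t)"] by (auto simp: diff_def)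
    have "ray p h 1 = v" "ray p h 0 = p"
      by (auto simp: ray_def h_def)
    with t(3) have eq: "f v = f p + (\<Sum>b\<in>rdirs N. rcoord h b * rpd b f p) + Q (ray p h t) / 2"
      by (simp add: diff_def numeral_2_eq_2)
    have "\<bar>Q (ray p h t) - Q p\<bar> = \<bar>\<Sum>b\<in>rdirs N. \<Sum>a\<in>rdirs N. rcoord h b * rcoord h a *
        (rpd a (rpd b f) (ray p h t) - rpd a (rpd b f) p)\<bar>"
      by (simp add: Q_def sum_subtractf sum_distrib_left algebra_simps)
    also have "\<dots> \<le> (\<Sum>b\<in>rdirs N. \<Sum>a\<in>rdirs N. sqdist N p v * e')"
    proof (intro order.trans[OF sum_abs] sum_mono)
      fix a b assume ab: "b \<in> rdirs N" "a \<in> rdirs N"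
      have "\<bar>rcoord h b\<bar> \<le> sqrt (sqdist N p v)" "\<bar>rcoord h a\<bar> \<le> sqrt (sqdist N p v)"
        using abs_rcoord_le[of _ N v p] ab by (auto simp: h_def real_le_rsqrt)
      then have "\<bar>rcoord h b\<bar> * \<bar>rcoord h a\<bar> \<le> sqrt (sqdist N p v) * sqrt (sqdist N p v)"
        by (intro mult_mono) auto
      moreover have "\<bar>rpd a (rpd b f) (ray p h t) - rpd a (rpd b f) p\<bar> \<le> e'"
        using rD[OF ray_in_Cspace[OF pC h] ball, of t a b] t ab by simp
      ultimately show "\<bar>rcoord h b * rcoord h a *
          (rpd a (rpd b f) (ray p h t) - rpd a (rpd b f) p)\<bar> \<le> sqdist N p v * e'"
        unfolding abs_mult by (intro mult_mono) auto
    qed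
    also have "\<dots> = (n\<^sup>2 * e') * sqdist N p v"
      by (simp add: n_def power2_eq_square)
    also have "\<dots> \<le> e * sqdist N p v"
      using e'(2) by (intro mult_right_mono) auto
    finally have "\<bar>Q (ray p h t) - Q p\<bar> / 2 \<le> e * sqdist N p v"
      using e by simp
    moreover have "(\<Sum>a\<in>rdirs N. \<Sum>b\<in>rdirs N. rcoord h a * rcoord h b * rpd a (rpd b f) p) = Q p"
      unfolding Q_def sum_distrib_left by (subst sum.swap) (simp add: mult_ac)
    ultimately show "\<bar>f v - f p - (\<Sum>a\<in>rdirs N. rcoord (\<lambda>i. v i - p i) a * rpd a f p)
         - (\<Sum>a\<in>rdirs N. \<Sum>b\<in>rdirs N. rcoord (\<lambda>i. v i - p i) a * rcoord (\<lambda>i. v i - p i) b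
              * rpd a (rpd b f) p) / 2\<bar> \<le> e * sqdist N p v"
      unfolding h_def[symmetric] eq by (simp add: diff_divide_distrib[symmetric] abs_divide)
  qed
qed

section \<open>The Levi form\<close>

lemma line_C_commute: "line_C (line_C w i c s) j d t = line_C (line_C w j d t) i c s"
  by (auto simp: line_C_def)

text \<open>Two uses of \<open>sqdist_shift_le\<close> give 2 * 2 \<delta>^2 + 2 \<delta>^2. The two
  directions may lie in the same coordinate, where the displacements add up.\<close>

lemma sqdist_line_line_le:
  assumes "i < N" "j < N" "c \<in> {1, \<i>}" "d \<in> {1, \<i>}" "\<bar>s\<bar> \<le> \<delta>" "\<bar>t\<bar> \<le> \<delta>"
  shows "sqdist N w (line_C (line_C w i c s) j d t) \<le> 6 * \<delta>\<^sup>2"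
proof -
  have sq: "(cmod (of_real r * b))\<^sup>2 \<le> \<delta>\<^sup>2" if "b \<in> {1, \<i>}" "\<bar>r\<bar> \<le> \<delta>" for r :: real and b
    using that by (intro power_mono) (auto simp: norm_mult)
  have "sqdist N w (line_C w i c s) \<le> 2 * (cmod (of_real s * c))\<^sup>2"
    using sqdist_shift_le[OF assms(1), of w w "of_real s * c"] by (simp add: line_C_def)
  moreover have "sqdist N w (line_C (line_C w i c s) j d t) \<le>
      2 * sqdist N w (line_C w i c s) + 2 * (cmod (of_real t * d))\<^sup>2"
    using sqdist_shift_le[OF assms(2), of w "line_C w i c s" "of_real t * d"]
    by (simp add: line_C_def[of _ j])
  ultimately show ?thesis
    using sq[OF assms(3,5)] sq[OF assms(4,6)] by linarith
qed

text \<open>The second difference is symmetric in the two directions. The mean value theorem in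
  direction j, applied to the difference taken in direction i, and then in direction i turns it into
  a mixed derivative at a nearby point.\<close>

lemma mixed_difference_mvt:
  fixes f :: "(nat \<Rightarrow> complex) \<Rightarrow> real"
  assumes f: "Ck_C (Suc (Suc k)) N U f" and i: "i < N" "c \<in> {1, \<i>}" and j: "j < N" "d \<in> {1, \<i>}"
    and s: "0 < s"
    and inU: "\<And>\<sigma> \<tau>. \<bar>\<sigma>\<bar> \<le> s \<Longrightarrow> \<bar>\<tau>\<bar> \<le> s \<Longrightarrow> line_C (line_C w i c \<sigma>) j d \<tau> \<in> U"
  obtains \<sigma> \<tau> where "\<bar>\<sigma>\<bar> \<le> s" "\<bar>\<tau>\<bar> \<le> s"
    "f (line_C (line_C w i c s) j d s) - f (line_C w i c s) - f (line_C w j d s) + f w =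
      s * s * pd i c (pd j d f) (line_C (line_C w i c \<sigma>) j d \<tau>)"
proof -
  have f': "Ck_C (Suc k) N U (pd j d f)"
    using f j by auto
  have inU': "line_C w j d \<tau> \<in> U" if "\<bar>\<tau>\<bar> \<le> s" for \<tau>
    using inU[of 0 \<tau>] that s by simp
  let ?\<phi> = "\<lambda>t. f (line_C (line_C w i c s) j d t) - f (line_C w j d t)"
  let ?\<phi>' = "\<lambda>t. pd j d f (line_C (line_C w i c s) j d t) - pd j d f (line_C w j d t)"
  have "(?\<phi> has_real_derivative ?\<phi>' t) (at t)" if "0 \<le> t" "t \<le> s" for t
    using that s by (intro DERIV_diff Ck_C_Suc_line_derivative[OF f] j inU inU') auto
  then obtain \<tau> where \<tau>: "0 < \<tau>" "\<tau> < s" "?\<phi> s - ?\<phi> 0 = (s - 0) * ?\<phi>' \<tau>"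
    using MVT2[OF s, of ?\<phi> ?\<phi>'] by blast
  have "line_C (line_C w j d \<tau>) i c \<sigma> \<in> U" if "\<bar>\<sigma>\<bar> \<le> \<bar>s\<bar>" for \<sigma>
    using inU[of \<sigma> \<tau>] that \<tau> s by (simp add: line_C_commute)
  then obtain \<sigma> where \<sigma>: "\<bar>\<sigma>\<bar> \<le> \<bar>s\<bar>" "pd j d f (line_C (line_C w j d \<tau>) i c s) - pd j d f (line_C w j d \<tau>) =
      s * pd i c (pd j d f) (line_C (line_C w j d \<tau>) i c \<sigma>)"
    using line_C_mvt[OF f' i, of s "line_C w j d \<tau>"] by blast
  show thesis
  proof (rule that)
    show "\<bar>\<sigma>\<bar> \<le> s" "\<bar>\<tau>\<bar> \<le> s"
      using \<sigma> \<tau> s by auto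
    show "f (line_C (line_C w i c s) j d s) - f (line_C w i c s) - f (line_C w j d s) + f w =
      s * s * pd i c (pd j d f) (line_C (line_C w i c \<sigma>) j d \<tau>)"
      using \<tau>(3) \<sigma>(2) by (simp add: line_C_commute[of w j d])
  qed
qed

text \<open>Schwarz's theorem. Evaluated in either order, the same second difference divided by s^2
  is a mixed derivative close to p; continuity at p brings the two values together.\<close>

lemma rpd_commute:
  fixes f :: "(nat \<Rightarrow> complex) \<Rightarrow> real"
  assumes U: "open_in_C N U" and f: "Ck_C (Suc (Suc k)) N U f" and p: "p \<in> U"
    and a: "a \<in> rdirs N" and b: "b \<in> rdirs N"
  shows "rpd a (rpd b f) p = rpd b (rpd a f) p"
proof (rule ccontr)
  assume ne: "rpd a (rpd b f) p \<noteq> rpd b (rpd a f) p"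
  obtain i c j d where ab: "a = (i, c)" "b = (j, d)" "i < N" "j < N" "c \<in> {1, \<i>}" "d \<in> {1, \<i>}"
    using a b by (auto simp: rdirs_def)
  \<comment> \<open>Half of the gap, since two errors below e will be added.\<close>
  define e where "e = \<bar>rpd a (rpd b f) p - rpd b (rpd a f) p\<bar> / 2"
  have e: "e > 0" using ne by (simp add: e_def)
  have pC: "p \<in> Cspace N" by (rule open_in_C_subset[OF U p])
  obtain r1 where r1: "r1 > 0" "\<And>v. v \<in> Cspace N \<Longrightarrow> sqdist N p v \<le> r1 \<Longrightarrow>
      v \<in> U \<and> \<bar>rpd a (rpd b f) v - rpd a (rpd b f) p\<bar> < e"
    using continuous_on_ball_Cspace[OF U Ck_C_continuous_on[OF Ck_C_rpd[OF Ck_C_rpd[OF f b] a]] p e]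
    by blast
  obtain r2 where r2: "r2 > 0" "\<And>v. v \<in> Cspace N \<Longrightarrow> sqdist N p v \<le> r2 \<Longrightarrow>
      v \<in> U \<and> \<bar>rpd b (rpd a f) v - rpd b (rpd a f) p\<bar> < e"
    using continuous_on_ball_Cspace[OF U Ck_C_continuous_on[OF Ck_C_rpd[OF Ck_C_rpd[OF f a] b]] p e]
    by blast
  \<comment> \<open>Makes 6 * s^2, the bound of \<open>sqdist_line_line_le\<close>, equal to the
    smaller radius.\<close>
  define s where "s = sqrt (min r1 r2 / 6)"
  have s: "s > 0" "6 * s\<^sup>2 = min r1 r2"
    using r1(1) r2(1) by (auto simp: s_def)
  have in_C: "line_C (line_C p i c \<sigma>) j d \<tau> \<in> Cspace N" for \<sigma> \<tau>
    using ab by (intro line_C_in_Cspace pC)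
  have le: "sqdist N p (line_C (line_C p i c \<sigma>) j d \<tau>) \<le> min r1 r2" if "\<bar>\<sigma>\<bar> \<le> s" "\<bar>\<tau>\<bar> \<le> s" for \<sigma> \<tau>
    using sqdist_line_line_le[OF ab(3,4,5,6) that, of p] s(2) by simp
  have inU: "line_C (line_C p i c \<sigma>) j d \<tau> \<in> U" if "\<bar>\<sigma>\<bar> \<le> s" "\<bar>\<tau>\<bar> \<le> s" for \<sigma> \<tau>
    using r1(2)[OF in_C] le[OF that] by simp
  have inU': "line_C (line_C p j d \<sigma>) i c \<tau> \<in> U" if "\<bar>\<sigma>\<bar> \<le> s" "\<bar>\<tau>\<bar> \<le> s" for \<sigma> \<tau>
    using inU[OF that(2,1)] by (simp add: line_C_commute[of p j d])
  obtain \<sigma> \<tau> where 1: "\<bar>\<sigma>\<bar> \<le> s" "\<bar>\<tau>\<bar> \<le> s"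
    "f (line_C (line_C p i c s) j d s) - f (line_C p i c s) - f (line_C p j d s) + f p =
      s * s * pd i c (pd j d f) (line_C (line_C p i c \<sigma>) j d \<tau>)"
    using mixed_difference_mvt[OF f ab(3,5,4,6) s(1) inU] by blast
  obtain \<sigma>' \<tau>' where 2: "\<bar>\<sigma>'\<bar> \<le> s" "\<bar>\<tau>'\<bar> \<le> s"
    "f (line_C (line_C p j d s) i c s) - f (line_C p j d s) - f (line_C p i c s) + f p =
      s * s * pd j d (pd i c f) (line_C (line_C p j d \<sigma>') i c \<tau>')"
    using mixed_difference_mvt[OF f ab(4,6,3,5) s(1) inU'] by blast
  have "s * s * rpd a (rpd b f) (line_C (line_C p i c \<sigma>) j d \<tau>) =
      s * s * rpd b (rpd a f) (line_C (line_C p i c \<tau>') j d \<sigma>')"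
    using 1(3) 2(3) unfolding ab rpd_def fst_conv snd_conv line_C_commute[of p j d] by linarith
  then have "rpd a (rpd b f) (line_C (line_C p i c \<sigma>) j d \<tau>) =
      rpd b (rpd a f) (line_C (line_C p i c \<tau>') j d \<sigma>')"
    using s(1) by simp
  moreover have "\<bar>rpd a (rpd b f) (line_C (line_C p i c \<sigma>) j d \<tau>) - rpd a (rpd b f) p\<bar> < e"
    using r1(2)[OF in_C] le[OF 1(1,2)] by simp
  moreover have "\<bar>rpd b (rpd a f) (line_C (line_C p i c \<tau>') j d \<sigma>') - rpd b (rpd a f) p\<bar> < e"
    using r2(2)[OF in_C] le[OF 2(2,1)] by simp
  moreover have "\<bar>y - z\<bar> \<le> \<bar>x - y\<bar> + \<bar>x - z\<bar>" for x y z :: real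
    by arith
  ultimately show False
    unfolding e_def by (smt (verit) field_sum_of_halves)
qed

section \<open>Levi matrix and holomorphic second derivatives\<close>

definition hess :: "((nat \<Rightarrow> complex) \<Rightarrow> real) \<Rightarrow> (nat \<Rightarrow> complex) \<Rightarrow> nat \<Rightarrow> complex \<Rightarrow> nat \<Rightarrow> complex \<Rightarrow> real" where
  "hess f p i c j d = rpd (i, c) (rpd (j, d) f) p"

text \<open>The mixed derivative by z_i and the conjugate of z_j, expanded from
  (\<partial>/\<partial>x_i - \<i> \<partial>/\<partial>y_i)(\<partial>/\<partial>x_j + \<i>
  \<partial>/\<partial>y_j) / 4.\<close>

definition levi :: "((nat \<Rightarrow> complex) \<Rightarrow> real) \<Rightarrow> (nat \<Rightarrow> complex) \<Rightarrow> nat \<Rightarrow> nat \<Rightarrow> complex" where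
  "levi f p i j = Complex (hess f p i 1 j 1 + hess f p i \<i> j \<i>) (hess f p i 1 j \<i> - hess f p i \<i> j 1) / 4"

text \<open>The derivative by z_i and z_j: both factors of that product now carry the minus
  sign.\<close>

definition holo_hess :: "((nat \<Rightarrow> complex) \<Rightarrow> real) \<Rightarrow> (nat \<Rightarrow> complex) \<Rightarrow> nat \<Rightarrow> nat \<Rightarrow> complex" where
  "holo_hess f p i j = Complex (hess f p i 1 j 1 - hess f p i \<i> j \<i>) (- (hess f p i 1 j \<i> + hess f p i \<i> j 1)) / 4"

lemma Ck_C_vector_derivative_of_real:
  fixes f :: "(nat \<Rightarrow> complex) \<Rightarrow> real"
  assumes "Ck_C (Suc k) N U f" "w \<in> U" "j < N" "c \<in> {1, \<i>}"
  shows "((\<lambda>t. complex_of_real (f (line_C w j c t))) has_vector_derivative of_real (pd j c f w)) (at 0)"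
proof -
  have "((\<lambda>t. f (line_C w j c t)) has_vector_derivative pd j c f w) (at 0)"
    using Ck_C_Suc_line_derivative[OF assms(1) _ assms(3,4), of w 0] assms(2)
    by (simp add: has_real_derivative_iff_has_vector_derivative)
  then show ?thesis
    by (rule bounded_linear.has_vector_derivative[OF bounded_linear_of_real])
qed

lemma complex_hessian_eq_levi:
  fixes f :: "(nat \<Rightarrow> complex) \<Rightarrow> real"
  assumes U: "open_in_C N U" and f: "Ck_C (Suc (Suc k)) N U f" and p: "p \<in> U"
  shows "complex_hessian N f p = Matrix.mat N N (\<lambda>(i, j). levi f p i j)"
proof -
  let ?f = "\<lambda>v. complex_of_real (f v)"
  have "wirt i (wirt_bar j ?f) p = levi f p i j" if ij: "i < N" "j < N" for i j
  proof -
    \<comment> \<open>\<open>wirt_bar\<close> has this form only on U; as U is open,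
      \<open>pd_cong\<close> carries it to the second derivative.\<close>
    let ?G = "\<lambda>w. complex_of_real (pd j 1 f w) / 2 + \<i> / 2 * complex_of_real (pd j \<i> f w)"
    have f1: "Ck_C (Suc k) N U (pd j c f)" if "c \<in> {1, \<i>}" for c
      using f ij that by auto
    have "pd j c ?f w = of_real (pd j c f w)" if "w \<in> U" "c \<in> {1, \<i>}" for w c
      unfolding pd_def[of j c ?f]
      by (rule vector_derivative_at[OF Ck_C_vector_derivative_of_real[OF f that(1) ij(2) that(2)]])
    then have G: "wirt_bar j ?f w = ?G w" if "w \<in> U" for w
      using that by (simp add: wirt_bar_def add_divide_distrib)
    have X: "pd i c (wirt_bar j ?f) p = of_real (hess f p i c j 1) / 2 + \<i> / 2 * of_real (hess f p i c j \<i>)"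
      if c: "c \<in> {1, \<i>}" for c
    proof -
      have "pd i c (wirt_bar j ?f) p = pd i c ?G p"
        by (rule pd_cong[OF U p ij(1) G])
      also have "\<dots> = of_real (pd i c (pd j 1 f) p) / 2 + \<i> / 2 * of_real (pd i c (pd j \<i> f) p)"
        unfolding pd_def[of i c ?G]
        by (intro vector_derivative_at has_vector_derivative_add
            bounded_linear.has_vector_derivative[OF bounded_linear_divide]
            bounded_linear.has_vector_derivative[OF bounded_linear_mult_right]
            Ck_C_vector_derivative_of_real[OF f1] p ij(1) c) auto
      finally show ?thesis
        by (simp add: hess_def rpd_def)
    qed
    show ?thesis
      unfolding wirt_def X[OF insertI1] X[OF insertI2[OF insertI1]] levi_def
      by (simp add: complex_eq_iff)
  qed
  then show ?thesis
    unfolding complex_hessian_def by (intro cong_mat) auto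
qed

text \<open>Schwarz's theorem in complex form, which opens the way to the Rayleigh quotient.\<close>

lemma levi_hermitian:
  assumes "open_in_C N U" "Ck_C (Suc (Suc k)) N U f" "p \<in> U" "i < N" "j < N"
  shows "levi f p j i = cnj (levi f p i j)"
proof -
  have "hess f p i c j d = hess f p j d i c" if "c \<in> {1, \<i>}" "d \<in> {1, \<i>}" for c d
    unfolding hess_def using assms that by (intro rpd_commute[OF assms(1-3)]) (auto simp: rdirs_def)
  then show ?thesis
    by (simp add: levi_def complex_eq_iff)
qed

text \<open>The second order Taylor term splits into the real part of a holomorphic quadratic form
  and the Levi form. The former will be absorbed into a holomorphic polynomial, so positivity is
  asked of the latter only.\<close>

lemma real_hessian_levi_decomposition:
  "(\<Sum>a\<in>rdirs N. \<Sum>b\<in>rdirs N. rcoord h a * rcoord h b * rpd a (rpd b f) p) / 2 =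
    Re (\<Sum>i<N. \<Sum>j<N. holo_hess f p i j * h i * h j) +
    Re (\<Sum>i<N. \<Sum>j<N. levi f p i j * h i * cnj (h j))"
proof -
  have "(\<Sum>a\<in>rdirs N. \<Sum>b\<in>rdirs N. rcoord h a * rcoord h b * rpd a (rpd b f) p) =
    (\<Sum>i<N. \<Sum>j<N. 2 * Re (holo_hess f p i j * h i * h j) + 2 * Re (levi f p i j * h i * cnj (h j)))"
    unfolding sum_rdirs sum.distrib[symmetric]
    by (intro sum.cong refl) (simp add: rcoord_def hess_def holo_hess_def levi_def, simp add: field_simps)
  also have "\<dots> = 2 * Re (\<Sum>i<N. \<Sum>j<N. holo_hess f p i j * h i * h j) +
      2 * Re (\<Sum>i<N. \<Sum>j<N. levi f p i j * h i * cnj (h j))"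
    by (simp only: Re_sum sum.distrib sum_distrib_left)
  finally show ?thesis
    by simp
qed

section \<open>Hermitian forms and positive eigenvalues\<close>

lemma nonneg_quadratic_imp_linear_coeff_0:
  fixes a b :: real
  assumes "\<And>t. 0 \<le> 2 * t * a + t\<^sup>2 * b"
  shows "a = 0"
proof (rule ccontr)
  assume "a \<noteq> 0"
  \<comment> \<open>With c positive and at least b, the polynomial at t = - a / c is at most - a^2 /
    c.\<close>
  define c where "c = \<bar>b\<bar> + 1"
  define t where "t = - a / c"
  have c: "c > 0" and tc: "t * c = - a"
    by (auto simp: c_def t_def add_nonneg_pos)
  have "t\<^sup>2 * b \<le> t\<^sup>2 * c"
    by (intro mult_left_mono) (auto simp: c_def)
  also have "\<dots> = t * (t * c)"
    by (simp add: power2_eq_square)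
  also have "\<dots> = - (t * a)"
    by (simp add: tc)
  finally have "0 \<le> t * a"
    using assms[of t] by simp
  moreover have "t * a = - (a * a) / c"
    by (simp add: t_def)
  moreover have "a * a / c > 0"
    using \<open>a \<noteq> 0\<close> c zero_less_power2[of a] by (simp add: power2_eq_square)
  ultimately show False
    by simp
qed

text \<open>Minimising the Rayleigh quotient produces a real eigenvalue, so no spectral theorem is needed.\<close>

lemma hermitian_min_eigenvalue:
  fixes H :: "nat \<Rightarrow> nat \<Rightarrow> complex"
  assumes herm: "\<And>i j. i < N \<Longrightarrow> j < N \<Longrightarrow> H j i = cnj (H i j)" and N: "0 < N"
  obtains \<mu> :: real where "eigenvalue (Matrix.mat N N (\<lambda>(i, j). H i j)) (complex_of_real \<mu>)"
    "\<And>h. \<mu> * sqdist N (\<lambda>_. 0) h \<le> Re (\<Sum>i<N. \<Sum>j<N. H i j * h i * cnj (h j))"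
proof -
  define q where "q h = Re (\<Sum>i<N. \<Sum>j<N. H i j * h i * cnj (h j))" for h
  let ?n = "sqdist N (\<lambda>_. 0)"
  define S where "S = {h \<in> Cspace N. ?n h \<le> 1} \<inter> {h. 1 \<le> ?n h}"
  have "closed {h. 1 \<le> ?n h}"
    by (intro closed_Collect_le continuous_intros)
  then have "compact S"
    unfolding S_def by (intro compact_Int_closed compact_closed_ball_Cspace)
  \<comment> \<open>The first unit vector shows that the sphere is nonempty; here N > 0
    enters.\<close>
  moreover have "(\<lambda>i. if i = 0 then 1 else 0) \<in> S"
    using N by (auto simp: S_def Cspace_def sqdist_def if_distrib[of "\<lambda>x. (cmod x)\<^sup>2"] cong: if_cong)
  moreover have "continuous_on S q"
    unfolding q_def
    by (intro continuous_intros continuous_on_product_then_coordinatewise[OF continuous_on_id, unfolded id_def])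
  ultimately obtain v where v: "v \<in> S" "\<And>h. h \<in> S \<Longrightarrow> q v \<le> q h"
    using continuous_attains_inf[of S q] by blast
  define \<mu> where "\<mu> = q v"
  have vn: "?n v = 1" "v \<in> Cspace N"
    using v(1) by (auto simp: S_def)
  have q_scale: "q (\<lambda>i. of_real t * h i) = t\<^sup>2 * q h" for t h
    unfolding q_def by (simp add: sum_distrib_left power2_eq_square mult_ac)
  have ge: "\<mu> * ?n h \<le> q h" for h
  proof (cases "?n h = 0")
    case True
    then have "h i = 0" if "i < N" for i
      using that by (auto simp: sqdist_def sum_nonneg_eq_0_iff)
    then have "q h = 0" by (simp add: q_def)
    with True show ?thesis by simp
  next
    case False
    then have pos: "?n h > 0"
      using sqdist_nonneg[of N "\<lambda>_. 0" h] by linarith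
    \<comment> \<open>Rescaling to the unit sphere; coordinates from N on are cut off because h is
      an arbitrary sequence while \<open>S\<close> lies in \<open>Cspace N\<close>.\<close>
    define t where "t = 1 / sqrt (?n h)"
    define g where "g = (\<lambda>i. of_real t * (if i < N then h i else 0))"
    have t2: "t\<^sup>2 = 1 / ?n h"
      using pos by (simp add: t_def power_divide)
    have "?n g = t\<^sup>2 * ?n h"
      by (simp add: sqdist_def g_def norm_mult power_mult_distrib sum_distrib_left)
    then have "g \<in> S"
      using pos t2 by (auto simp: S_def g_def Cspace_def)
    then have "\<mu> \<le> q g"
      using v(2) by (simp add: \<mu>_def)
    also have "q g = t\<^sup>2 * q (\<lambda>i. if i < N then h i else 0)"
      unfolding g_def by (rule q_scale)
    also have "q (\<lambda>i. if i < N then h i else 0) = q h"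
      by (simp add: q_def)
    finally show ?thesis
      using pos by (simp add: t2 field_simps)
  qed
  \<comment> \<open>The sesquilinear form of H minus \<mu> times the identity: its diagonal values
    have nonnegative real part, with value 0 at v.\<close>
  define F where "F h k = (\<Sum>i<N. \<Sum>j<N. H i j * h i * cnj (k j)) - of_real \<mu> * (\<Sum>i<N. h i * cnj (k i))" for h k
  have F_q: "Re (F h h) = q h - \<mu> * ?n h" for h
  proof -
    have "(\<Sum>i<N. h i * cnj (h i)) = complex_of_real (?n h)"
      by (simp only: sqdist_def diff_zero of_real_sum complex_norm_square)
    then have "F h h = (\<Sum>i<N. \<Sum>j<N. H i j * h i * cnj (h j)) - of_real (\<mu> * ?n h)"
      by (simp only: F_def of_real_mult)
    then show ?thesis
      by (simp only: q_def minus_complex.sel Re_complex_of_real)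
  qed
  have F_cnj: "F k h = cnj (F h k)" for h k
  proof -
    have "(\<Sum>i<N. \<Sum>j<N. H i j * k i * cnj (h j)) = (\<Sum>j<N. \<Sum>i<N. H i j * k i * cnj (h j))"
      by (rule sum.swap)
    also have "\<dots> = (\<Sum>j<N. \<Sum>i<N. cnj (H j i * h j * cnj (k i)))"
    proof (intro sum.cong refl)
      fix i j assume "j \<in> {..<N}" "i \<in> {..<N}"
      then have "H i j = cnj (H j i)"
        using herm[of j i] by simp
      then show "H i j * k i * cnj (h j) = cnj (H j i * h j * cnj (k i))"
        by (simp add: mult_ac)
    qed
    also have "\<dots> = cnj (\<Sum>j<N. \<Sum>i<N. H j i * h j * cnj (k i))"
      by (simp only: cnj_sum)
    finally show ?thesis
      by (simp add: F_def mult.commute)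
  qed
  have F_add: "F (\<lambda>i. a i + c * b i) k = F a k + c * F b k" for a b c k
    by (simp add: F_def sum.distrib sum_distrib_left algebra_simps)
  have F0: "F h v = 0" for h
  proof -
    \<comment> \<open>First variation: Re F is nonnegative at v + t h and zero for t = 0, so its
      linear term in t vanishes. Replacing h by \<i> h below settles the imaginary part.\<close>
    have re: "Re (F h v) = 0" for h
    proof (rule nonneg_quadratic_imp_linear_coeff_0)
      fix t :: real
      have "F (\<lambda>i. v i + of_real t * h i) (\<lambda>i. v i + of_real t * h i) =
          F v v + of_real t * (F h v + F v h) + of_real (t\<^sup>2) * F h h"
        unfolding F_add F_cnj[of _ "\<lambda>i. v i + of_real t * h i"]
        by (simp add: F_cnj[of h v] F_cnj[of v v, symmetric] F_cnj[of h h, symmetric]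
            power2_eq_square algebra_simps)
      then have "Re (F (\<lambda>i. v i + of_real t * h i) (\<lambda>i. v i + of_real t * h i)) =
          Re (F v v) + 2 * t * Re (F h v) + t\<^sup>2 * Re (F h h)"
        by (simp add: F_cnj[of v h])
      moreover have "Re (F v v) = 0"
        by (simp add: F_q vn \<mu>_def)
      ultimately show "0 \<le> 2 * t * Re (F h v) + t\<^sup>2 * Re (F h h)"
        using F_q[of "\<lambda>i. v i + of_real t * h i"] ge[of "\<lambda>i. v i + of_real t * h i"] by simp
    qed
    have "F (\<lambda>i. 0 + \<i> * h i) v = F (\<lambda>i. 0) v + \<i> * F h v"
      by (rule F_add)
    then have "F (\<lambda>i. \<i> * h i) v = \<i> * F h v"
      by (simp add: F_def)
    then have "Im (F h v) = 0"
      using re[of "\<lambda>i. \<i> * h i"] by simp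
    with re show ?thesis
      by (simp add: complex_eq_iff)
  qed
  have eig: "(\<Sum>j<N. H i j * cnj (v j)) = of_real \<mu> * cnj (v i)" if "i < N" for i
  proof -
    define G where "G k = (\<Sum>j<N. H k j * cnj (v j)) - of_real \<mu> * cnj (v k)" for k
    have "F h v = (\<Sum>k<N. h k * G k)" for h
      by (simp add: F_def G_def sum_subtractf sum_distrib_left algebra_simps)
    \<comment> \<open>Taking the i-th unit vector for h isolates row i.\<close>
    then have "0 = (\<Sum>k<N. (if k = i then 1 else 0) * G k)"
      using F0 by metis
    also have "\<dots> = (\<Sum>k<N. if k = i then G k else 0)"
      by (intro sum.cong) auto
    also have "\<dots> = G i"
      using that by simp
    finally show ?thesis
      by (simp add: G_def)
  qed
  \<comment> \<open>The form pairs \<open>H i j\<close> with \<open>h i * cnj (h j)\<close>, so the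
    eigenvector is the conjugate of v.\<close>
  let ?A = "Matrix.mat N N (\<lambda>(i, j). H i j)" and ?x = "Matrix.vec N (\<lambda>i. cnj (v i))"
  have "?x \<noteq> 0\<^sub>v N"
  proof
    assume "?x = 0\<^sub>v N"
    then have "v i = 0" if "i < N" for i
      using that by (metis complex_cnj_zero_iff index_vec index_zero_vec(1))
    then have "?n v = 0" by (simp add: sqdist_def)
    with vn show False by simp
  qed
  moreover have "?A *\<^sub>v ?x = of_real \<mu> \<cdot>\<^sub>v ?x"
    by (intro eq_vecI) (auto simp: scalar_prod_def eig lessThan_atLeast0[symmetric])
  ultimately have "eigenvalue ?A (of_real \<mu>)"
    unfolding eigenvalue_def eigenvector_def by (intro exI[of _ ?x]) auto
  then show thesis
    using ge that unfolding q_def by blast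
qed

text \<open>Root counting: the positive eigenvalues already exhaust the degree N of the
  characteristic polynomial, so a further root would exceed it.\<close>

lemma num_pos_eigenvalues_eigenvalue_pos:
  assumes A: "A \<in> carrier_mat N N" and "N \<le> num_pos_eigenvalues A"
    and ev: "eigenvalue A (complex_of_real \<mu>)"
  shows "0 < \<mu>"
proof (rule ccontr)
  assume "\<not> 0 < \<mu>"
  define L where "L = {l::real. 0 < l \<and> eigenvalue A (complex_of_real l)}"
  let ?p = "char_poly A"
  have p: "degree ?p = N" "?p \<noteq> 0"
    using degree_monic_char_poly[OF A] by auto
  have sub: "complex_of_real ` L \<subseteq> {x. poly ?p x = 0}"
    using eigenvalue_root_char_poly[OF A] by (auto simp: L_def)
  have fin: "finite {x. poly ?p x = 0}"
    by (rule poly_roots_finite[OF p(2)])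
  have \<mu>: "complex_of_real \<mu> \<in> {x. poly ?p x = 0} - complex_of_real ` L"
    using ev \<open>\<not> 0 < \<mu>\<close> eigenvalue_root_char_poly[OF A] by (auto simp: L_def)
  have "num_pos_eigenvalues A = (\<Sum>x\<in>complex_of_real ` L. Polynomial.order x ?p)"
    unfolding num_pos_eigenvalues_def L_def[symmetric]
    by (subst sum.reindex) (auto simp: inj_on_def)
  also have "\<dots> < (\<Sum>x\<in>{x. poly ?p x = 0}. Polynomial.order x ?p)"
    using \<mu> p(2) by (intro sum_strict_mono2[OF fin sub, of "complex_of_real \<mu>"])
      (auto simp: order_root)
  also have "\<dots> = size (proots ?p)"
    using p(2) by (simp add: size_multiset_overloaded_eq)
  also have "\<dots> \<le> N"
    using size_proots_le[of ?p] p by simp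
  finally show False
    using assms(2) by simp
qed

text \<open>P collects the holomorphic part of the second order Taylor polynomial. What remains is
  the Levi form, at least \<mu> times the squared distance for its smallest eigenvalue \<mu>; one
  half of this absorbs the Taylor remainder and the other half is e.\<close>

lemma levi_positive_lower_bound:
  fixes f :: "(nat \<Rightarrow> complex) \<Rightarrow> real"
  assumes U: "open_in_C N U" and f: "smooth_C N U f" and p: "p \<in> U"
    and pos: "N \<le> num_pos_eigenvalues (complex_hessian N f p)"
  obtains P e r where "\<And>V. holo_C N V P" "P p = 0" "0 < e" "0 < r"
    "\<And>v. v \<in> Cspace N \<Longrightarrow> sqdist N p v \<le> r \<Longrightarrow> v \<in> U \<and> Re (P v) + e * sqdist N p v \<le> f v - f p"
proof -
  have f2: "Ck_C (Suc (Suc 0)) N U f"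
    using f unfolding smooth_C_def by blast
  obtain \<mu> where \<mu>: "0 < \<mu>"
    "\<And>h. \<mu> * sqdist N (\<lambda>_. 0) h \<le> Re (\<Sum>i<N. \<Sum>j<N. levi f p i j * h i * cnj (h j))"
  proof (cases "N = 0")
    \<comment> \<open>Both sides vanish, and any positive constant serves.\<close>
    case True
    then show ?thesis
      by (intro that[of 1]) (auto simp: sqdist_def)
  next
    case False
    let ?A = "Matrix.mat N N (\<lambda>(i, j). levi f p i j)"
    obtain \<mu> where \<mu>: "eigenvalue ?A (complex_of_real \<mu>)"
      "\<And>h. \<mu> * sqdist N (\<lambda>_. 0) h \<le> Re (\<Sum>i<N. \<Sum>j<N. levi f p i j * h i * cnj (h j))"
      using hermitian_min_eigenvalue[of N "levi f p"] levi_hermitian[OF U f2 p] False by blast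
    have "0 < \<mu>"
      using num_pos_eigenvalues_eigenvalue_pos[OF _ _ \<mu>(1), of N] pos
      unfolding complex_hessian_eq_levi[OF U f2 p] by simp
    with \<mu>(2) show ?thesis
      using that by blast
  qed
  \<comment> \<open>The linear coefficients are 2 \<partial>f/\<partial>z_j, so that the real part
    of the linear term is the real differential of f.\<close>
  define P where "P v = (\<Sum>j<N. Complex (rpd (j, 1) f p) (- rpd (j, \<i>) f p) * (v j - p j)) +
    (\<Sum>i<N. \<Sum>j<N. holo_hess f p i j * (v i - p i) * (v j - p j))" for v
  obtain r where r: "r > 0"
    "\<And>v. v \<in> Cspace N \<Longrightarrow> sqdist N p v \<le> r \<Longrightarrow> v \<in> U \<and>
      \<bar>f v - f p - (\<Sum>a\<in>rdirs N. rcoord (\<lambda>i. v i - p i) a * rpd a f p)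
         - (\<Sum>a\<in>rdirs N. \<Sum>b\<in>rdirs N. rcoord (\<lambda>i. v i - p i) a * rcoord (\<lambda>i. v i - p i) b
              * rpd a (rpd b f) p) / 2\<bar> \<le> \<mu> / 2 * sqdist N p v"
    using C2_expansion[OF U f2 p, of "\<mu> / 2"] \<mu>(1) by auto
  show thesis
  proof (rule that[of P "\<mu> / 2" r])
    show "holo_C N V P" for V
      unfolding P_def by (intro holo_C_add holo_C_sum holo_C_mult holo_C_diff holo_C_const holo_C_coord)
    fix v assume v: "v \<in> Cspace N" "sqdist N p v \<le> r"
    have lin: "(\<Sum>a\<in>rdirs N. rcoord (\<lambda>i. v i - p i) a * rpd a f p) =
        Re (\<Sum>j<N. Complex (rpd (j, 1) f p) (- rpd (j, \<i>) f p) * (v j - p j))"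
      by (simp add: sum_rdirs rcoord_def algebra_simps)
    have "sqdist N (\<lambda>_. 0) (\<lambda>i. v i - p i) = sqdist N p v"
      by (simp add: sqdist_def)
    then have "\<mu> * sqdist N p v \<le> Re (\<Sum>i<N. \<Sum>j<N. levi f p i j * (v i - p i) * cnj (v j - p j))"
      using \<mu>(2)[of "\<lambda>i. v i - p i"] by simp
    then have "Re (P v) + \<mu> / 2 * sqdist N p v \<le> f v - f p"
      using r(2)[OF v] unfolding lin real_hessian_levi_decomposition P_def plus_complex.sel
      by (simp only: abs_le_iff) linarith
    then show "v \<in> U \<and> Re (P v) + \<mu> / 2 * sqdist N p v \<le> f v - f p"
      using r(2)[OF v] by blast
  qed (use \<mu>(1) r(1) in \<open>auto simp: P_def\<close>)
qed

section \<open>Charts of complex spaces\<close>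

lemma locally_closed_in_subset: "locally_closed_in X A \<Longrightarrow> A \<subseteq> topspace X"
  unfolding locally_closed_in_def using openin_subset by blast

lemma local_model_props:
  assumes "is_local_model X Osh \<omega> N U Z z"
  shows "openin X \<omega>" "open_in_C N U" "Z \<subseteq> U" "\<omega> \<subseteq> topspace X" "z ` \<omega> = Z" "inj_on z \<omega>"
    "continuous_map (subtopology X \<omega>) euclidean z"
proof -
  have o: "openin X \<omega>" and hm: "homeomorphic_map (subtopology X \<omega>) (top_of_set Z) z"
    using assms by (auto simp: is_local_model_def)
  show "openin X \<omega>" "open_in_C N U" "Z \<subseteq> U"
    using assms by (auto simp: is_local_model_def analytic_subvariety_def)
  show s: "\<omega> \<subseteq> topspace X"
    using openin_subset[OF o] .
  then have t: "topspace (subtopology X \<omega>) = \<omega>"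
    by (simp add: inf_absorb2)
  show "z ` \<omega> = Z" "inj_on z \<omega>"
    using homeomorphic_imp_surjective_map[OF hm] homeomorphic_imp_injective_map[OF hm] t by auto
  show "continuous_map (subtopology X \<omega>) euclidean z"
    using homeomorphic_imp_continuous_map[OF hm] continuous_map_in_subtopology by blast
qed

lemma local_model_openin_vimage:
  assumes m: "is_local_model X Osh \<omega> N U Z z" and W: "open_in_C N W"
  shows "openin X {x \<in> \<omega>. z x \<in> W}"
proof -
  obtain O' where O': "open O'" "W = Cspace N \<inter> O'"
    using W by (auto simp: openin_open)
  have "z x \<in> Cspace N" if "x \<in> \<omega>" for x
    using local_model_props(2,3,5)[OF m] that open_in_C_subset by blast
  then have "{x \<in> \<omega>. z x \<in> W} = {x \<in> topspace (subtopology X \<omega>). z x \<in> O'}"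
    using O'(2) local_model_props(4)[OF m] by auto
  moreover have "openin euclidean O'"
    using O'(1) by simp
  then have "openin (subtopology X \<omega>) {x \<in> topspace (subtopology X \<omega>). z x \<in> O'}"
    by (rule openin_continuous_map_preimage[OF local_model_props(7)[OF m]])
  ultimately show ?thesis
    using openin_trans_full[OF _ local_model_props(1)[OF m]] by simp
qed

lemma local_model_openin_Int:
  assumes m: "is_local_model X Osh \<omega> N U Z z" and W: "open_in_C N W"
  shows "openin (top_of_set Z) (Z \<inter> W)"
proof -
  obtain O' where "open O'" "W = Cspace N \<inter> O'"
    using W by (auto simp: openin_open)
  moreover have "Z \<subseteq> Cspace N"
    using local_model_props(2,3)[OF m] open_in_C_subset by blast
  ultimately have "Z \<inter> W = Z \<inter> O'" by blast
  then show ?thesis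
    using \<open>open O'\<close> by (simp add: openin_open_Int)
qed

text \<open>A section extends holomorphically only to a smaller ambient open set; this provides the
  chart that goes with it.\<close>

lemma local_model_restrict:
  assumes m: "is_local_model X Osh \<omega> N U Z z" and U': "open_in_C N U'" "U' \<subseteq> U"
  shows "is_local_model X Osh {x \<in> \<omega>. z x \<in> U'} N U' (Z \<inter> U') z"
  unfolding is_local_model_def
proof (intro conjI allI impI)
  show "openin X {x \<in> \<omega>. z x \<in> U'}"
    by (rule local_model_openin_vimage[OF m U'(1)])
  show "analytic_subvariety N U' (Z \<inter> U')"
    unfolding analytic_subvariety_def
  proof (intro conjI ballI)
    fix a assume "a \<in> U'"
    then have "a \<in> U" using U'(2) by blast
    have "\<forall>a\<in>U. \<exists>W F. open_in_C N W \<and> a \<in> W \<and> W \<subseteq> U \<and> finite F \<and> (\<forall>f\<in>F. holo_C N W f) \<and>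
        Z \<inter> W = {w \<in> W. \<forall>f\<in>F. f w = 0}"
      using m unfolding is_local_model_def analytic_subvariety_def by (elim conjE)
    from bspec[OF this \<open>a \<in> U\<close>]
    obtain W F where W: "open_in_C N W" "a \<in> W" "finite F" "\<forall>f\<in>F. holo_C N W f"
        "Z \<inter> W = {w \<in> W. \<forall>f\<in>F. f w = 0}"
      by (elim exE conjE)
    show "\<exists>W F. open_in_C N W \<and> a \<in> W \<and> W \<subseteq> U' \<and> finite F \<and> (\<forall>f\<in>F. holo_C N W f) \<and>
        Z \<inter> U' \<inter> W = {w \<in> W. \<forall>f\<in>F. f w = 0}"
    proof (intro exI conjI)
      show "open_in_C N (W \<inter> U')" using W(1) U'(1) by blast
      show "\<forall>f\<in>F. holo_C N (W \<inter> U') f" using W(4) holo_C_subset by blast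
    qed (use W \<open>a \<in> U'\<close> in auto)
  qed auto
  have hm: "homeomorphic_map (subtopology X \<omega>) (top_of_set Z) z"
    using m by (simp add: is_local_model_def)
  have "z ` (topspace (subtopology X \<omega>) \<inter> {x \<in> \<omega>. z x \<in> U'}) = topspace (top_of_set Z) \<inter> U'"
    using local_model_props(4,5)[OF m] by auto
  from homeomorphic_map_subtopologies[OF hm this]
  have "homeomorphic_map (subtopology X (\<omega> \<inter> {x \<in> \<omega>. z x \<in> U'})) (top_of_set (Z \<inter> U')) z"
    by (simp only: subtopology_subtopology)
  moreover have "\<omega> \<inter> {x \<in> \<omega>. z x \<in> U'} = {x \<in> \<omega>. z x \<in> U'}"
    by blast
  ultimately show "homeomorphic_map (subtopology X {x \<in> \<omega>. z x \<in> U'}) (top_of_set (Z \<inter> U')) z"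
    by (simp only:)
  fix T g assume T: "openin (top_of_set (Z \<inter> U')) T"
  have "openin (top_of_set Z) (Z \<inter> U')"
    using local_model_openin_Int[OF m U'(1)] .
  with T have "openin (top_of_set Z) T"
    using openin_trans by blast
  moreover have "{x \<in> {x \<in> \<omega>. z x \<in> U'}. z x \<in> T} = {x \<in> \<omega>. z x \<in> T}"
    using openin_subset[OF T] by auto
  ultimately show "(g \<in> model_sections N T) = (g \<circ> z \<in> Osh {x \<in> {x \<in> \<omega>. z x \<in> U'}. z x \<in> T})"
    using m by (simp add: is_local_model_def)
qed (use U' in auto)

text \<open>As z is a homeomorphism onto Z with the subspace topology, neighbourhoods in X are
  traces of ambient open sets.\<close>

lemma local_model_open_subset:
  assumes m: "is_local_model X Osh \<omega> N U Z z" and W: "openin X W"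
  obtains U' where "open_in_C N U'" "U' \<subseteq> U" "{x \<in> \<omega>. z x \<in> U'} = \<omega> \<inter> W"
proof -
  have hm: "homeomorphic_map (subtopology X \<omega>) (top_of_set Z) z"
    using m by (simp add: is_local_model_def)
  have "openin (subtopology X \<omega>) (\<omega> \<inter> W)"
    using W openin_subtopology_Int2 by blast
  then have "openin (top_of_set Z) (z ` (\<omega> \<inter> W))"
    using homeomorphic_imp_open_map[OF hm] by (simp add: open_map_def)
  then obtain O' where O': "open O'" "z ` (\<omega> \<inter> W) = Z \<inter> O'"
    by (auto simp: openin_open)
  show thesis
  proof (rule that[of "U \<inter> O'"])
    show "open_in_C N (U \<inter> O')"
      using local_model_props(2)[OF m] O'(1) by (simp add: openin_Int_open)
    show "{x \<in> \<omega>. z x \<in> U \<inter> O'} = \<omega> \<inter> W"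
    proof (intro Set.set_eqI iffI)
      fix x assume x: "x \<in> {x \<in> \<omega>. z x \<in> U \<inter> O'}"
      then have "z x \<in> z ` (\<omega> \<inter> W)"
        using local_model_props(5)[OF m] O'(2) by blast
      then show "x \<in> \<omega> \<inter> W"
        using x inj_onD[OF local_model_props(6)[OF m]] by blast
    next
      fix x assume "x \<in> \<omega> \<inter> W"
      then show "x \<in> {x \<in> \<omega>. z x \<in> U \<inter> O'}"
        using local_model_props(3,5)[OF m] O'(2) by blast
    qed
  qed auto
qed

text \<open>Off Z some local equation is nonzero, and it stays so nearby.\<close>

lemma analytic_subvariety_closedin:
  assumes "open_in_C N U" "analytic_subvariety N U Z"
  shows "closedin (top_of_set U) Z"
proof -
  have "openin (top_of_set U) (U - Z)"
  proof (subst openin_subopen, intro ballI)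
    fix a assume a: "a \<in> U - Z"
    then obtain W F where W: "open_in_C N W" "a \<in> W" "W \<subseteq> U" "\<forall>f\<in>F. holo_C N W f"
        "Z \<inter> W = {w \<in> W. \<forall>f\<in>F. f w = 0}"
      using assms(2) unfolding analytic_subvariety_def by blast
    then obtain f where f: "f \<in> F" "f a \<noteq> 0"
      using a by blast
    have "openin (top_of_set W) (W \<inter> f -` (- {0}))"
      using W(4) f(1) by (intro continuous_openin_preimage_gen) (auto simp: holo_C_def)
    then have "open_in_C N (W \<inter> f -` (- {0}))"
      using W(1) openin_trans by blast
    then have "openin (top_of_set U) (W \<inter> f -` (- {0}))"
      by (rule openin_subset_trans) (use W(3) openin_imp_subset[OF assms(1)] in auto)
    moreover have "a \<in> W \<inter> f -` (- {0})" "W \<inter> f -` (- {0}) \<subseteq> U - Z"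
      using W f by auto
    ultimately show "\<exists>T. openin (top_of_set U) T \<and> a \<in> T \<and> T \<subseteq> U - Z"
      by blast
  qed
  then show ?thesis
    using assms(2) by (auto simp: closedin_def analytic_subvariety_def double_diff)
qed

text \<open>Local compactness of A in quantitative form: small chart balls of X are compact because
  Z is closed in U, and on them A coincides with a closed subset of X because it is locally
  closed.\<close>

lemma compact_chart_ball:
  assumes H: "Hausdorff_space X" and m: "is_local_model X Osh \<omega> N U Z z"
    and A: "locally_closed_in X A" and p: "p \<in> A" "p \<in> \<omega>"
    and W: "openin (subtopology X A) W" "p \<in> W"
  obtains r where "r > 0" "compactin X {x \<in> A \<inter> \<omega>. sqdist N (z p) (z x) \<le> r}"
    "{x \<in> A \<inter> \<omega>. sqdist N (z p) (z x) \<le> r} \<subseteq> W"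
proof -
  obtain O' C where OC: "openin X O'" "closedin X C" "A = O' \<inter> C"
    using A by (auto simp: locally_closed_in_def)
  obtain O1 where O1: "openin X O1" "W = A \<inter> O1"
    using W(1) by (auto simp: openin_subtopology)
  \<comment> \<open>Points of the chart with image in \<open>U'\<close> lie in \<open>O'\<close>,
    where A is cut out by the closed set \<open>C\<close>, and in \<open>O1\<close>, where the
    points of A belong to W.\<close>
  obtain U' where U': "open_in_C N U'" "U' \<subseteq> U" "{x \<in> \<omega>. z x \<in> U'} = \<omega> \<inter> (O' \<inter> O1)"
    using local_model_open_subset[OF m openin_Int[OF OC(1) O1(1)]] by blast
  have "z p \<in> U'"
    using U'(3) p W(2) O1(2) OC(3) by blast
  then obtain r where r: "r > 0" "\<And>w. w \<in> Cspace N \<Longrightarrow> sqdist N (z p) w \<le> r \<Longrightarrow> w \<in> U'"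
    using open_in_C_contains_ball[OF U'(1)] by blast
  define B where "B = {w \<in> Cspace N. sqdist N (z p) w \<le> r}"
  have BU': "B \<subseteq> U'" using r(2) by (auto simp: B_def)
  have hm: "homeomorphic_map (subtopology X \<omega>) (top_of_set Z) z"
    using m by (simp add: is_local_model_def)
  have "closedin (top_of_set U) Z"
    using m by (auto simp: is_local_model_def intro: analytic_subvariety_closedin)
  then obtain C' where C': "closed C'" "Z = U \<inter> C'"
    by (auto simp: closedin_closed)
  have "Z \<inter> B = B \<inter> C'"
    using C'(2) BU' U'(2) by auto
  then have "compact (Z \<inter> B)"
    using C'(1) compact_closed_ball_Cspace[of N "z p" r] by (simp add: B_def compact_Int_closed)
  then have "compactin (top_of_set Z) (Z \<inter> B)"
    by (simp add: compactin_subtopology)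
  moreover obtain g where g: "homeomorphic_maps (subtopology X \<omega>) (top_of_set Z) z g"
    using hm homeomorphic_map_maps by blast
  ultimately have "compactin (subtopology X \<omega>) (g ` (Z \<inter> B))"
    by (auto simp: homeomorphic_maps_def intro: image_compactin)
  then have c: "compactin X (g ` (Z \<inter> B))"
    by (simp add: compactin_subtopology)
  have gz: "g (z x) = x" if "x \<in> \<omega>" for x
    using g that local_model_props(4)[OF m] by (auto simp: homeomorphic_maps_def)
  have zC: "z x \<in> Cspace N" if "x \<in> \<omega>" for x
    using local_model_props(2,3,5)[OF m] that open_in_C_subset by blast
  have "g ` (Z \<inter> B) = {x \<in> \<omega>. sqdist N (z p) (z x) \<le> r}"
  proof (intro Set.set_eqI iffI)
    fix x assume "x \<in> g ` (Z \<inter> B)"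
    then obtain y where "x = g y" "y \<in> Z \<inter> B" by blast
    moreover obtain x' where "x' \<in> \<omega>" "y = z x'"
      using \<open>y \<in> Z \<inter> B\<close> local_model_props(5)[OF m] by blast
    ultimately show "x \<in> {x \<in> \<omega>. sqdist N (z p) (z x) \<le> r}"
      using gz by (simp add: B_def)
  next
    fix x assume x: "x \<in> {x \<in> \<omega>. sqdist N (z p) (z x) \<le> r}"
    then have "z x \<in> Z \<inter> B"
      using zC local_model_props(5)[OF m] by (auto simp: B_def)
    then have "g (z x) \<in> g ` (Z \<inter> B)" by (rule imageI)
    with x gz show "x \<in> g ` (Z \<inter> B)" by simp
  qed
  with c have "compactin X (C \<inter> {x \<in> \<omega>. sqdist N (z p) (z x) \<le> r})"
    using closed_Int_compactin[OF OC(2)] by simp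
  moreover have *: "x \<in> O' \<inter> O1" if "x \<in> \<omega>" "sqdist N (z p) (z x) \<le> r" for x
    using U'(3) r(2)[OF zC[OF that(1)] that(2)] that(1) by blast
  then have "C \<inter> {x \<in> \<omega>. sqdist N (z p) (z x) \<le> r} = {x \<in> A \<inter> \<omega>. sqdist N (z p) (z x) \<le> r}"
    using OC(3) by blast
  moreover have "{x \<in> A \<inter> \<omega>. sqdist N (z p) (z x) \<le> r} \<subseteq> W"
    using * O1(2) by blast
  ultimately show thesis
    using that r(1) by simp
qed

lemma openin_chart_ball:
  assumes m: "is_local_model X Osh \<omega> N U Z z"
  shows "openin (subtopology X A) {x \<in> A \<inter> \<omega>. sqdist N a (z x) < r}"
proof -
  have "z x \<in> Cspace N" if "x \<in> \<omega>" for x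
    using local_model_props(2,3,5)[OF m] that open_in_C_subset by blast
  then have "{x \<in> A \<inter> \<omega>. sqdist N a (z x) < r} = A \<inter> {x \<in> \<omega>. z x \<in> {w \<in> Cspace N. sqdist N a w < r}}"
    by auto
  then show ?thesis
    using openin_subtopology_Int2[OF local_model_openin_vimage[OF m open_in_C_ball[of N a r]], of A]
    by simp
qed

lemma continuous_map_chart_compose:
  assumes m: "is_local_model X Osh \<omega> N U Z z" and "S \<subseteq> \<omega>" "z ` S \<subseteq> V" "continuous_on V h"
  shows "continuous_map (subtopology X S) euclidean (\<lambda>x. h (z x))"
proof -
  have "continuous_map (subtopology X S) euclidean z"
    using continuous_map_from_subtopology_mono[OF local_model_props(7)[OF m] assms(2)] .
  then have "continuous_map (subtopology X S) (top_of_set V) z"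
    using assms(3) by (auto simp: continuous_map_in_subtopology)
  moreover have "continuous_map (top_of_set V) euclidean h"
    using assms(4) by simp
  ultimately have "continuous_map (subtopology X S) euclidean (h \<circ> z)"
    by (rule continuous_map_compose)
  then show ?thesis by (simp add: o_def)
qed

lemma continuous_map_sqdist_chart:
  assumes "is_local_model X Osh \<omega> N U Z z" "S \<subseteq> \<omega>"
  shows "continuous_map (subtopology X S) euclidean (\<lambda>x. sqdist N a (z x))"
  using continuous_map_chart_compose[OF assms subset_UNIV continuous_on_sqdist[OF continuous_on_id]]
  by simp

lemma compactin_attains_max:
  fixes \<phi> :: "'a \<Rightarrow> real"
  assumes "compactin X K" "K \<noteq> {}" "continuous_map (subtopology X K) euclidean \<phi>"
  obtains y where "y \<in> K" "\<And>x. x \<in> K \<Longrightarrow> \<phi> x \<le> \<phi> y"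
proof -
  have "compactin (subtopology X K) K"
    using assms(1) by (simp add: compactin_subtopology)
  then have "compact (\<phi> ` K)"
    using image_compactin[OF _ assms(3)] by fastforce
  then show ?thesis
    using compact_attains_sup[of "\<phi> ` K"] assms(2) that by blast
qed

section \<open>The structure sheaf in a chart\<close>

lemma function_sheaf_cong:
  assumes "function_sheaf X Osh" "openin X W" "f \<in> Osh W" "\<And>x. x \<in> W \<Longrightarrow> g x = f x"
  shows "g \<in> Osh W"
proof -
  have "\<forall>W f g. openin X W \<and> f \<in> Osh W \<and> (\<forall>x\<in>W. g x = f x) \<longrightarrow> g \<in> Osh W"
    using assms(1) unfolding function_sheaf_def by (rule conjunct1)
  from this[rule_format, of W f g] assms(2-4) show ?thesis
    by simp
qed

lemma function_sheaf_restrict: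
  assumes "function_sheaf X Osh" "openin X W" "openin X W'" "W' \<subseteq> W" "f \<in> Osh W"
  shows "f \<in> Osh W'"
  using assms(1)[unfolded function_sheaf_def, THEN conjunct2, THEN conjunct1, rule_format, of W W']
    assms(2-5) by auto

text \<open>Sections over a model are locally restrictions of ambient holomorphic functions; V is
  cut down until f equals \<open>h \<circ> z\<close> on its whole preimage.\<close>

lemma structure_sheaf_local_holo:
  assumes sh: "function_sheaf X Osh" and m: "is_local_model X Osh \<omega> N U Z z"
    and W: "openin X W" "x \<in> W" "x \<in> \<omega>" and f: "f \<in> Osh W"
  obtains V h where "open_in_C N V" "V \<subseteq> U" "z x \<in> V" "holo_C N V h"
    "\<And>y. y \<in> \<omega> \<Longrightarrow> z y \<in> V \<Longrightarrow> y \<in> W \<and> f y = h (z y)"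
proof -
  note props = local_model_props[OF m]
  obtain U' where U': "open_in_C N U'" "U' \<subseteq> U" "{x \<in> \<omega>. z x \<in> U'} = \<omega> \<inter> W"
    using local_model_open_subset[OF m W(1)] by blast
  \<comment> \<open>A total function in place of f composed with the inverse chart;
    \<open>g \<circ> z\<close> agrees with f on \<omega>, and \<open>function_sheaf_cong\<close>
    transfers membership.\<close>
  define g where "g = f \<circ> inv_into \<omega> z"
  have gz: "g (z y) = f y" if "y \<in> \<omega>" for y
    using props(6) that by (simp add: g_def)
  have oW: "openin X (\<omega> \<inter> W)"
    using props(1) W(1) by blast
  have "f \<in> Osh (\<omega> \<inter> W)"
    by (rule function_sheaf_restrict[OF sh W(1) oW _ f]) simp
  then have "g \<circ> z \<in> Osh (\<omega> \<inter> W)"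
    by (rule function_sheaf_cong[OF sh oW]) (simp add: gz)
  moreover have "openin (top_of_set Z) (Z \<inter> U')"
    by (rule local_model_openin_Int[OF m U'(1)])
  moreover have "{x \<in> \<omega>. z x \<in> Z \<inter> U'} = \<omega> \<inter> W"
    using U'(3) props(5) by blast
  moreover have "openin (top_of_set Z) T \<Longrightarrow> (g \<in> model_sections N T) = (g \<circ> z \<in> Osh {x \<in> \<omega>. z x \<in> T})" for T
    using m unfolding is_local_model_def by blast
  ultimately have "g \<in> model_sections N (Z \<inter> U')"
    by simp
  moreover have "z x \<in> Z \<inter> U'"
    using U'(3) props(5) W(2,3) by blast
  ultimately obtain V h where V: "open_in_C N V" "z x \<in> V" "holo_C N V h"
      "\<And>w. w \<in> V \<inter> (Z \<inter> U') \<Longrightarrow> g w = h w"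
    unfolding model_sections_def by blast
  show thesis
  proof (rule that[of "V \<inter> U'" h])
    show "open_in_C N (V \<inter> U')" using V(1) U'(1) by blast
    show "holo_C N (V \<inter> U') h" using V(3) by (rule holo_C_subset) blast
    fix y assume y: "y \<in> \<omega>" "z y \<in> V \<inter> U'"
    then show "y \<in> W \<and> f y = h (z y)"
      using V(4)[of "z y"] gz[of y] U'(3) props(5) by auto
  qed (use V(2) \<open>z x \<in> Z \<inter> U'\<close> U'(2) in auto)
qed

section \<open>Germs without local maxima\<close>

text \<open>A strictly larger value in every neighbourhood W excludes a local maximum at x. A germ
  being a class of functions, the condition is put on all its members. Points outside the chart are
  left free, so that the class can be compared with germs on all of A.\<close>

definition nomax_germs ::
  "'a topology \<Rightarrow> 'a set \<Rightarrow> 'a set \<Rightarrow> nat \<Rightarrow> ('a \<Rightarrow> nat \<Rightarrow> complex) \<Rightarrow> 'a germ set" where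
  "nomax_germs X A \<omega> N z = {(x, S). x \<in> A \<inter> \<omega> \<longrightarrow>
     (\<forall>f\<in>S. \<forall>c a \<theta> W. 0 < c \<longrightarrow> openin (subtopology X A) W \<longrightarrow> x \<in> W \<longrightarrow>
       (\<exists>y\<in>W \<inter> \<omega>. Re (\<theta> * f x) + c * sqdist N a (z x) < Re (\<theta> * f y) + c * sqdist N a (z y)))}"

lemma germ_at_mem_nomax_iff:
  "germ_at (subtopology X A) x f \<in> nomax_germs X A \<omega> N z \<longleftrightarrow>
    (x \<in> A \<inter> \<omega> \<longrightarrow> (\<forall>g V c a \<theta> W. openin (subtopology X A) V \<longrightarrow> x \<in> V \<longrightarrow> (\<forall>y\<in>V. g y = f y) \<longrightarrow>
       0 < c \<longrightarrow> openin (subtopology X A) W \<longrightarrow> x \<in> W \<longrightarrow>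
       (\<exists>y\<in>W \<inter> \<omega>. Re (\<theta> * g x) + c * sqdist N a (z x) < Re (\<theta> * g y) + c * sqdist N a (z y))))"
  unfolding nomax_germs_def germ_at_def by blast

text \<open>Intersecting W with the set where g agrees with f reduces all representatives to
  one.\<close>

lemma nomax_germs_memI:
  assumes "\<And>c a \<theta> W. x \<in> A \<Longrightarrow> x \<in> \<omega> \<Longrightarrow> 0 < c \<Longrightarrow> openin (subtopology X A) W \<Longrightarrow> x \<in> W \<Longrightarrow>
    (\<And>y. y \<in> W \<Longrightarrow> y \<in> \<omega> \<Longrightarrow> Re (\<theta> * f y) + c * sqdist N a (z y) \<le> Re (\<theta> * f x) + c * sqdist N a (z x)) \<Longrightarrow> False"
  shows "germ_at (subtopology X A) x f \<in> nomax_germs X A \<omega> N z"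
  unfolding germ_at_mem_nomax_iff
proof (intro impI allI)
  fix g V c a \<theta> W
  assume x: "x \<in> A \<inter> \<omega>" and V: "openin (subtopology X A) V" "x \<in> V" "\<forall>y\<in>V. g y = f y"
    and c: "0 < (c :: real)" and W: "openin (subtopology X A) W" "x \<in> W"
  show "\<exists>y\<in>W \<inter> \<omega>. Re (\<theta> * g x) + c * sqdist N a (z x) < Re (\<theta> * g y) + c * sqdist N a (z y)"
  proof (rule ccontr)
    assume n: "\<not> ?thesis"
    have o: "openin (subtopology X A) (V \<inter> W)"
      using V(1) W(1) by (rule openin_Int)
    show False
    proof (rule assms[of c "V \<inter> W" \<theta> a])
      fix y assume y: "y \<in> V \<inter> W" "y \<in> \<omega>"
      then have "g y = f y" "g x = f x"
        using V by auto
      moreover have "Re (\<theta> * g y) + c * sqdist N a (z y) \<le> Re (\<theta> * g x) + c * sqdist N a (z x)"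
        using n y by force
      ultimately show "Re (\<theta> * f y) + c * sqdist N a (z y) \<le> Re (\<theta> * f x) + c * sqdist N a (z x)"
        by simp
    qed (use x c o V(2) W(2) in auto)
  qed
qed

lemma nomax_germs_memD:
  assumes "germ_at (subtopology X A) x f \<in> nomax_germs X A \<omega> N z" "A \<subseteq> topspace X"
    "x \<in> A" "x \<in> \<omega>" "0 < c" "openin (subtopology X A) W" "x \<in> W"
  obtains y where "y \<in> W" "y \<in> \<omega>"
    "Re (\<theta> * f x) + c * sqdist N a (z x) < Re (\<theta> * f y) + c * sqdist N a (z y)"
proof -
  have "openin (subtopology X A) A"
    using assms(2) by (metis inf_absorb2 openin_topspace topspace_subtopology)
  then show ?thesis
    using assms(1)[unfolded germ_at_mem_nomax_iff, THEN mp, of] assms(3-) that by blast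
qed

text \<open>At a local maximum the test function itself would be a witness \<rho> of
  pseudoconvexity, in the chart restricted to the ambient open set where f extends
  holomorphically.\<close>

lemma restricted_holo_germs_subset_nomax:
  assumes sh: "function_sheaf X Osh" and m: "is_local_model X Osh \<omega> N U Z z"
    and conc: "set_weakly_pseudoconcave X Osh A 1"
  shows "restricted_holo_germs X Osh A \<subseteq> nomax_germs X A \<omega> N z"
proof
  fix \<gamma> assume "\<gamma> \<in> restricted_holo_germs X Osh A"
  then obtain x f W where \<gamma>: "\<gamma> = germ_at (subtopology X A) x f" and x: "x \<in> A"
    and W: "openin X W" "x \<in> W" "f \<in> Osh W"
    unfolding restricted_holo_germs_def by blast
  have "germ_at (subtopology X A) x f \<in> nomax_germs X A \<omega> N z"
  proof (rule nomax_germs_memI)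
    fix c a \<theta> W2
    assume x\<omega>: "x \<in> \<omega>" and c: "0 < (c :: real)" and W2: "openin (subtopology X A) W2" "x \<in> W2"
      and max: "\<And>y. y \<in> W2 \<Longrightarrow> y \<in> \<omega> \<Longrightarrow>
        Re (\<theta> * f y) + c * sqdist N a (z y) \<le> Re (\<theta> * f x) + c * sqdist N a (z x)"
    obtain V h where V: "open_in_C N V" "V \<subseteq> U" "z x \<in> V" "holo_C N V h"
      "\<And>y. y \<in> \<omega> \<Longrightarrow> z y \<in> V \<Longrightarrow> y \<in> W \<and> f y = h (z y)"
      using structure_sheaf_local_holo[OF sh m W(1,2) x\<omega> W(3)] by metis
    define \<rho> where "\<rho> w = Re (\<theta> * h w) + c * sqdist N a w" for w
    obtain O2 where O2: "openin X O2" "W2 = O2 \<inter> A"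
      using W2(1) by (auto simp: openin_subtopology)
    have h: "holo_C N V (\<lambda>w. \<theta> * h w)"
      using V(4) by (intro holo_C_mult holo_C_const)
    let ?\<omega> = "{y \<in> \<omega>. z y \<in> V}"
    have m': "is_local_model X Osh ?\<omega> N V (Z \<inter> V) z"
      by (rule local_model_restrict[OF m V(1,2)])
    have "set_pseudoconvex_at X Osh A 1 x"
      unfolding set_pseudoconvex_at_def
    proof (intro exI conjI)
      show "is_local_model X Osh ?\<omega> N V (Z \<inter> V) z" by (rule m')
      show "smooth_C N V \<rho>"
        unfolding \<rho>_def by (rule smooth_C_quadratic[OF V(1) h])
      show "openin X (?\<omega> \<inter> O2)"
        using local_model_props(1)[OF m'] O2(1) by (rule openin_Int)
      show "z ` (A \<inter> (?\<omega> \<inter> O2)) \<subseteq> {w \<in> V. \<rho> w \<le> \<rho> (z x)}"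
      proof
        fix w assume "w \<in> z ` (A \<inter> (?\<omega> \<inter> O2))"
        then obtain y where y: "w = z y" "y \<in> A" "y \<in> \<omega>" "z y \<in> V" "y \<in> O2" by blast
        then show "w \<in> {w \<in> V. \<rho> w \<le> \<rho> (z x)}"
          using max[of y] O2(2) V(5)[of y] V(5)[OF x\<omega> V(3)] by (simp add: \<rho>_def)
      qed
      have "complex_hessian N \<rho> (z x) = Matrix.mat N N (\<lambda>(i, j). if i = j then complex_of_real c else 0)"
        unfolding \<rho>_def by (rule complex_hessian_quadratic[OF V(1) h V(3)])
      \<comment> \<open>For q = 1 all N eigenvalues have to be positive: N - 1 + 1 = N.\<close>
      then show "int (num_pos_eigenvalues (complex_hessian N \<rho> (z x))) \<ge> int N - 1 + 1"
        using num_pos_eigenvalues_scalar[OF c] by simp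
    qed (use x\<omega> V(3) W2(2) O2(2) in auto)
    then show False
      using conc x by (simp add: set_weakly_pseudoconcave_def)
  qed
  then show "\<gamma> \<in> nomax_germs X A \<omega> N z"
    by (simp add: \<gamma>)
qed

text \<open>Completing the square. It keeps the test functions stable when half of the quadratic
  coefficient is spent on making a maximum strict.\<close>

lemma sqdist_shift_center:
  obtains C where "\<And>w. c * sqdist N a w - c / 2 * sqdist N b w = c / 2 * sqdist N (\<lambda>i. 2 * a i - b i) w + C"
proof (rule that)
  fix w
  have eq: "c * (cmod (w i - a i))\<^sup>2 - c / 2 * (cmod (w i - b i))\<^sup>2 =
      c / 2 * (cmod (w i - (2 * a i - b i)))\<^sup>2 - c * (cmod (a i - b i))\<^sup>2" for i
    unfolding cmod_power2 by (simp add: power2_eq_square field_simps)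
  have "c * sqdist N a w - c / 2 * sqdist N b w =
      (\<Sum>i<N. c * (cmod (w i - a i))\<^sup>2 - c / 2 * (cmod (w i - b i))\<^sup>2)"
    by (simp add: sqdist_def sum_distrib_left sum_subtractf)
  also have "\<dots> = (\<Sum>i<N. c / 2 * (cmod (w i - (2 * a i - b i)))\<^sup>2 - c * (cmod (a i - b i))\<^sup>2)"
    by (simp only: eq)
  also have "\<dots> = c / 2 * sqdist N (\<lambda>i. 2 * a i - b i) w - c * sqdist N b a"
    by (simp add: sqdist_def sum_distrib_left sum_subtractf)
  finally show "c * sqdist N a w - c / 2 * sqdist N b w =
      c / 2 * sqdist N (\<lambda>i. 2 * a i - b i) w + - (c * sqdist N b a)" by simp
qed

lemma approx_germs_nomax_subset:
  assumes H: "Hausdorff_space X" and m: "is_local_model X Osh \<omega> N U Z z"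
    and A: "locally_closed_in X A"
  shows "approx_germs (subtopology X A) (nomax_germs X A \<omega> N z) \<subseteq> nomax_germs X A \<omega> N z"
proof
  let ?T = "subtopology X A" and ?G = "nomax_germs X A \<omega> N z"
  have AX: "A \<subseteq> topspace X" by (rule locally_closed_in_subset[OF A])
  fix \<gamma> assume "\<gamma> \<in> approx_germs ?T ?G"
  then obtain x f U0 s where \<gamma>: "\<gamma> = germ_at ?T x f" and U0: "openin ?T U0" "x \<in> U0"
    and s: "\<And>n. s n \<in> germ_sections ?T ?G U0"
    and lim: "\<And>K. compactin ?T K \<Longrightarrow> K \<subseteq> U0 \<Longrightarrow> uniform_limit K s f sequentially"
    unfolding approx_germs_def by blast
  have "germ_at ?T x f \<in> ?G"
  proof (rule nomax_germs_memI)
    fix c a \<theta> W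
    assume x: "x \<in> A" "x \<in> \<omega>" and c: "0 < (c :: real)" and W: "openin ?T W" "x \<in> W"
      and max: "\<And>y. y \<in> W \<Longrightarrow> y \<in> \<omega> \<Longrightarrow>
        Re (\<theta> * f y) + c * sqdist N a (z y) \<le> Re (\<theta> * f x) + c * sqdist N a (z x)"
    have "openin ?T (W \<inter> U0)" using W(1) U0(1) by (rule openin_Int)
    then obtain r where r: "r > 0" "compactin X {y \<in> A \<inter> \<omega>. sqdist N (z x) (z y) \<le> r}"
      "{y \<in> A \<inter> \<omega>. sqdist N (z x) (z y) \<le> r} \<subseteq> W \<inter> U0"
      using compact_chart_ball[OF H m A x] W(2) U0(2) by blast
    define K where "K = {y \<in> A \<inter> \<omega>. sqdist N (z x) (z y) \<le> r}"
    define V where "V = {y \<in> A \<inter> \<omega>. sqdist N (z x) (z y) < r}"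
    have K: "compactin X K" "K \<subseteq> W \<inter> U0" "x \<in> K" "K \<subseteq> \<omega>" "K \<subseteq> A"
      using r x by (auto simp: K_def)
    have "compactin ?T K"
      using K by (simp add: compactin_subtopology)
    then have ul: "uniform_limit K s f sequentially"
      using lim K(2) by blast
    \<comment> \<open>With \<delta> as below, \<open>s n\<close> and \<open>f\<close> give real
      parts within c * r / 8 of each other on \<open>K\<close>. Two such errors make c * r / 4, less
      than the drop of c * r / 2 that the subtracted term causes at squared distance r, so the
      maximum of \<Psi> lies in \<open>V\<close>. Adding 1 covers \<theta> = 0.\<close>
    define k where "k = cmod \<theta> + 1"
    define \<delta> where "\<delta> = c * r / (8 * k)"
    have l1: "k > 0"
      using norm_ge_zero[of \<theta>] unfolding k_def by linarith
    then have \<delta>: "\<delta> > 0"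
      using c r(1) by (simp add: \<delta>_def)
    obtain n where n: "\<And>y. y \<in> K \<Longrightarrow> dist (s n y) (f y) < \<delta>"
      using uniform_limitD[OF ul \<delta>] unfolding eventually_sequentially by blast
    have close: "\<bar>Re (\<theta> * s n y) - Re (\<theta> * f y)\<bar> \<le> c * r / 8" if "y \<in> K" for y
    proof -
      have "\<bar>Re (\<theta> * s n y) - Re (\<theta> * f y)\<bar> \<le> cmod (\<theta> * (s n y - f y))"
        using abs_Re_le_cmod[of "\<theta> * (s n y - f y)"] by (simp add: algebra_simps)
      also have "\<dots> \<le> k * \<delta>"
        unfolding norm_mult using n[OF that] l1 by (intro mult_mono) (auto simp: dist_norm k_def)
      also have "\<dots> = c * r / 8"
        using l1 by (simp add: \<delta>_def)
      finally show ?thesis .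
    qed
    define \<Psi> where "\<Psi> y = Re (\<theta> * s n y) + c * sqdist N a (z y) - c / 2 * sqdist N (z x) (z y)" for y
    have "K \<subseteq> A \<inter> U0"
      using K by blast
    then have "continuous_map (subtopology X K) euclidean (s n)"
      using s[of n] unfolding germ_sections_def subtopology_subtopology
      by (auto intro: continuous_map_from_subtopology_mono)
    moreover have "continuous_map euclidean euclidean (\<lambda>v. Re (\<theta> * v))"
      unfolding continuous_map_iff_continuous2 by (intro continuous_intros)
    ultimately have "continuous_map (subtopology X K) euclidean ((\<lambda>v. Re (\<theta> * v)) \<circ> s n)"
      by (rule continuous_map_compose)
    then have "continuous_map (subtopology X K) euclidean (\<lambda>y. Re (\<theta> * s n y))"
      by (simp only: o_def)
    then have "continuous_map (subtopology X K) euclidean \<Psi>"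
      unfolding \<Psi>_def
      by (intro continuous_map_diff continuous_map_add continuous_map_real_mult
          continuous_map_sqdist_chart[OF m K(4)] continuous_map_const[THEN iffD2]) auto
    then obtain y0 where y0: "y0 \<in> K" "\<And>y. y \<in> K \<Longrightarrow> \<Psi> y \<le> \<Psi> y0"
      using compactin_attains_max[OF K(1)] K(3) by blast
    have y0V: "y0 \<in> V"
    proof (rule ccontr)
      assume "y0 \<notin> V"
      then have "r \<le> sqdist N (z x) (z y0)"
        using y0(1) by (auto simp: V_def K_def)
      then have "c / 2 * r \<le> c / 2 * sqdist N (z x) (z y0)"
        using c by (intro mult_left_mono) auto
      moreover have "Re (\<theta> * f y0) + c * sqdist N a (z y0) \<le> Re (\<theta> * f x) + c * sqdist N a (z x)"
        using max y0(1) K by blast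
      moreover have "\<Psi> x \<le> \<Psi> y0" by (rule y0(2)[OF K(3)])
      moreover have "c * r > 0" using c r(1) by simp
      ultimately show False
        using close[OF K(3)] close[OF y0(1)] unfolding \<Psi>_def sqdist_self by linarith
    qed
    \<comment> \<open>Up to a constant, \<Psi> is a test function for \<open>s n\<close> with
      coefficient c / 2 and centre \<open>2 * a - z x\<close>; its maximum at y0 contradicts the
      property of the germ of \<open>s n\<close> there.\<close>
    obtain C where C: "\<And>w. c * sqdist N a w - c / 2 * sqdist N (z x) w =
        c / 2 * sqdist N (\<lambda>i. 2 * a i - z x i) w + C"
      using sqdist_shift_center[of c N a "z x"] by blast
    have "y0 \<in> U0" using y0(1) K by blast
    then have "germ_at ?T y0 (s n) \<in> ?G"
      using s[of n] by (simp add: germ_sections_def)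
    moreover have "openin ?T V"
      unfolding V_def by (rule openin_chart_ball[OF m])
    ultimately obtain y where y: "y \<in> V" "Re (\<theta> * s n y0) + c / 2 * sqdist N (\<lambda>i. 2 * a i - z x i) (z y0) <
        Re (\<theta> * s n y) + c / 2 * sqdist N (\<lambda>i. 2 * a i - z x i) (z y)"
      using nomax_germs_memD[of X A y0 "s n" \<omega> N z "c / 2" V \<theta> "\<lambda>i. 2 * a i - z x i"] AX y0V c
      by (auto simp: V_def)
    have "y \<in> K" using y(1) by (auto simp: V_def K_def)
    then show False
      using y0(2)[of y] y(2) C[of "z y"] C[of "z y0"] unfolding \<Psi>_def by linarith
  qed
  then show "\<gamma> \<in> ?G"
    by (simp add: \<gamma>)
qed

section \<open>Approximation closures and transfinite iteration\<close>

lemma germ_sections_mono: "\<G> \<subseteq> \<H> \<Longrightarrow> germ_sections T \<G> V \<subseteq> germ_sections T \<H> V"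
  by (auto simp: germ_sections_def)

lemma approx_germs_mono: "\<G> \<subseteq> \<H> \<Longrightarrow> approx_germs T \<G> \<subseteq> approx_germs T \<H>"
  unfolding approx_germs_def using germ_sections_mono[of \<G> \<H> T] by blast

text \<open>Monotonicity of \<open>approx_germs\<close> makes the intersection of stable sets
  stable.\<close>

lemma approx_closure_closed: "approx_germs T (approx_closure T \<H>) \<subseteq> approx_closure T \<H>"
proof -
  have "approx_germs T (approx_closure T \<H>) \<subseteq> \<G>" if "\<H> \<subseteq> \<G>" "approx_germs T \<G> \<subseteq> \<G>" for \<G>
  proof -
    have "approx_closure T \<H> \<subseteq> \<G>"
      using that unfolding approx_closure_def by blast
    then show ?thesis
      using approx_germs_mono that(2) by blast
  qed
  then show ?thesis
    unfolding approx_closure_def[of T \<H>] by blast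
qed

lemma approx_closure_increasing: "\<H> \<subseteq> approx_closure T \<H>"
  unfolding approx_closure_def by blast

text \<open>Well-founded induction on ordinals: a stable set that contains the start contains every
  iterate.\<close>

lemma iter_germs_subset_LACR:
  fixes r :: "'i rel"
  shows "iter_germs X Osh A r \<subseteq> LACR_germs X Osh A"
proof (induction r rule: wf_induct_rule[OF wf_ordLess])
  case (1 r)
  show ?case
  proof (cases "r = {}")
    case True
    then show ?thesis
      by (simp add: iter_germs_zero LACR_germs_def approx_closure_increasing)
  next
    case False
    have "(\<Union>s\<in>{s :: 'i rel. (s, r) \<in> ordLess}. iter_germs X Osh A s) \<subseteq> LACR_germs X Osh A"
      using 1 by blast
    then have "iter_germs X Osh A r \<subseteq> approx_germs (subtopology X A) (LACR_germs X Osh A)"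
      unfolding iter_germs_pos[OF False] by (rule approx_germs_mono)
    also have "\<dots> \<subseteq> LACR_germs X Osh A"
      unfolding LACR_germs_def by (rule approx_closure_closed)
    finally show ?thesis .
  qed
qed

text \<open>Constant sequences approximate, once the chart supplies a neighbourhood on which f is
  continuous with restricted holomorphic germs only.\<close>

lemma restricted_holo_germs_subset_approx:
  assumes X: "reduced_complex_space X Osh" and A: "A \<subseteq> topspace X"
  shows "restricted_holo_germs X Osh A \<subseteq>
    approx_germs (subtopology X A) (restricted_holo_germs X Osh A)"
proof
  let ?T = "subtopology X A"
  fix \<gamma> assume "\<gamma> \<in> restricted_holo_germs X Osh A"
  then obtain x f W where \<gamma>: "\<gamma> = germ_at ?T x f" and x: "x \<in> A"
    and W: "openin X W" "x \<in> W" "f \<in> Osh W"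
    unfolding restricted_holo_germs_def by blast
  have sh: "function_sheaf X Osh"
    using X by (simp add: reduced_complex_space_def)
  obtain \<omega> N U Z z where m: "x \<in> \<omega>" "is_local_model X Osh \<omega> N U Z z"
    using X x A unfolding reduced_complex_space_def by blast
  obtain V h where V: "open_in_C N V" "V \<subseteq> U" "z x \<in> V" "holo_C N V h"
    "\<And>y. y \<in> \<omega> \<Longrightarrow> z y \<in> V \<Longrightarrow> y \<in> W \<and> f y = h (z y)"
    using structure_sheaf_local_holo[OF sh m(2) W(1,2) m(1) W(3)] by metis
  define S where "S = A \<inter> {y \<in> \<omega>. z y \<in> V}"
  have S: "openin ?T S" "x \<in> S"
    unfolding S_def using openin_subtopology_Int2[OF local_model_openin_vimage[OF m(2) V(1)]] x m(1) V(3)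
    by auto
  have "continuous_map (subtopology X S) euclidean (\<lambda>y. h (z y))"
    using V(4) by (intro continuous_map_chart_compose[OF m(2), of _ V]) (auto simp: S_def holo_C_def)
  then have "continuous_map (subtopology X S) euclidean f"
    by (rule continuous_map_eq) (auto simp: S_def V(5))
  then have cont: "continuous_map (subtopology ?T S) euclidean f"
    by (simp add: subtopology_subtopology S_def)
  have "f \<in> germ_sections ?T (restricted_holo_germs X Osh A) S"
    unfolding germ_sections_def restricted_holo_germs_def
    using cont V(5) W(1,3) by (auto simp: S_def)
  then have "\<exists>s. (\<forall>n::nat. s n \<in> germ_sections ?T (restricted_holo_germs X Osh A) S) \<and>
      (\<forall>K. compactin ?T K \<and> K \<subseteq> S \<longrightarrow> uniform_limit K s f sequentially)"
    by (intro exI[of _ "\<lambda>_. f"]) (auto intro: uniform_limit_const)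
  then show "\<gamma> \<in> approx_germs ?T (restricted_holo_germs X Osh A)"
    unfolding approx_germs_def using \<gamma> S cont by blast
qed

text \<open>Otherwise r would embed into the empty relation and have empty field. This puts stage 0
  among the stages united at every positive ordinal.\<close>

lemma empty_ordLess:
  fixes r :: "'i rel"
  assumes "Well_order r" "r \<noteq> {}"
  shows "({} :: 'i rel, r) \<in> ordLess"
proof (rule ccontr)
  have e: "Well_order ({} :: 'i rel)" by simp
  assume "({} :: 'i rel, r) \<notin> ordLess"
  then have "(r, {} :: 'i rel) \<in> ordLeq"
    using not_ordLess_iff_ordLeq[OF assms(1) e] by simp
  then obtain f where "embed r ({} :: 'i rel) f"
    by (auto simp: ordLeq_def)
  then have "Field r = {}"
    using embed_Field[of r "{}" f] by simp
  then show False
    using assms(2) by (auto simp: Field_def)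
qed

lemma local_max_principleE:
  assumes "local_max_principle T \<H>" "p \<in> topspace T"
  obtains U where "openin T U" "p \<in> U"
    "\<And>V u. openin T V \<Longrightarrow> relatively_compact_in T V U \<Longrightarrow> u \<in> germ_sections T \<H> V \<Longrightarrow>
      continuous_map (subtopology T (T closure_of V)) euclidean u \<Longrightarrow>
      sup_norm_on V u \<le> sup_norm_on (T frontier_of V) u"
  using assms(1)[unfolded local_max_principle_def, rule_format, OF assms(2)] by blast

text \<open>The germ class only selects the functions u under test.\<close>

lemma local_max_principle_antimono:
  assumes "\<G> \<subseteq> \<H>" "local_max_principle T \<H>"
  shows "local_max_principle T \<G>"
  unfolding local_max_principle_def
proof
  fix p assume "p \<in> topspace T"
  then obtain U where U: "openin T U" "p \<in> U"
    "\<And>V u. openin T V \<Longrightarrow> relatively_compact_in T V U \<Longrightarrow> u \<in> germ_sections T \<H> V \<Longrightarrow>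
      continuous_map (subtopology T (T closure_of V)) euclidean u \<Longrightarrow>
      sup_norm_on V u \<le> sup_norm_on (T frontier_of V) u"
    using local_max_principleE[OF assms(2)] by blast
  show "\<exists>U. openin T U \<and> p \<in> U \<and>
      (\<forall>V u. openin T V \<and> relatively_compact_in T V U \<and> u \<in> germ_sections T \<G> V \<and>
        continuous_map (subtopology T (T closure_of V)) euclidean u
        \<longrightarrow> sup_norm_on V u \<le> sup_norm_on (T frontier_of V) u)"
    using U(1,2) by (intro exI[of _ U] conjI allI impI U(3)) (auto intro: subsetD[OF germ_sections_mono[OF assms(1)]])
qed

section \<open>The local maximum modulus principle\<close>

text \<open>The explicit bound B is there because a real supremum is meaningful only for bounded
  sets.\<close>

lemma sup_norm_on_upper:
  assumes "x \<in> S" "\<And>y. y \<in> S \<Longrightarrow> cmod (u y) \<le> B"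
  shows "cmod (u x) \<le> sup_norm_on S u"
proof -
  have "bdd_above ((\<lambda>x. cmod (u x)) ` S)"
    using assms(2) by (auto simp: bdd_above_def)
  then have "cmod (u x) \<le> (SUP x\<in>S. cmod (u x))"
    by (rule cSUP_upper[OF assms(1)])
  then show ?thesis
    using assms(1) by (auto simp: sup_norm_on_def)
qed

text \<open>The condition 0 \<le> B accounts for the empty set, where the supremum is 0 by
  convention.\<close>

lemma sup_norm_on_least:
  assumes "\<And>y. y \<in> S \<Longrightarrow> cmod (u y) \<le> B" "0 \<le> B"
  shows "sup_norm_on S u \<le> B"
  unfolding sup_norm_on_def using assms by (auto intro: cSUP_least)

lemma frontier_of_openin: "openin T V \<Longrightarrow> T frontier_of V = T closure_of V - V"
  by (simp add: frontier_of_def interior_of_openin)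

text \<open>Relative compactness speaks of the closure within U. Being compact in a Hausdorff space,
  that set is closed in T and so contains the closure taken in T.\<close>

lemma relatively_compact_in_closure:
  assumes "Hausdorff_space T" "relatively_compact_in T V U" "V \<subseteq> topspace T"
  shows "compactin T (T closure_of V)" "T closure_of V \<subseteq> U"
proof -
  let ?K = "subtopology T U closure_of V"
  have V: "V \<subseteq> U" and K: "compactin T ?K" "?K \<subseteq> U"
    using assms(2) by (auto simp: relatively_compact_in_def compactin_subtopology)
  have "V \<subseteq> ?K"
    using V assms(3) by (intro closure_of_subset) auto
  then have sub: "T closure_of V \<subseteq> ?K"
    using compactin_imp_closedin[OF assms(1) K(1)] by (rule closure_of_minimal)
  with K(2) show "T closure_of V \<subseteq> U" by blast
  show "compactin T (T closure_of V)"
    by (rule closed_compactin[OF K(1) sub closedin_closure_of])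
qed

lemma relatively_compact_inI:
  assumes "Hausdorff_space T" "compactin T K" "V \<subseteq> K" "K \<subseteq> U"
  shows "relatively_compact_in T V U" "T closure_of V \<subseteq> K"
proof -
  show sub: "T closure_of V \<subseteq> K"
    using assms(3) compactin_imp_closedin[OF assms(1,2)] by (rule closure_of_minimal)
  have "compactin T (T closure_of V)"
    by (rule closed_compactin[OF assms(2) sub closedin_closure_of])
  moreover have "subtopology T U closure_of V = T closure_of V"
    using sub assms(3,4) by (simp add: closure_of_subtopology Int_absorb1 inf_absorb2 subset_trans)
  ultimately show "relatively_compact_in T V U"
    using assms(3,4) sub by (auto simp: relatively_compact_in_def compactin_subtopology)
qed

lemma local_max_principle_LACR:
  assumes X: "reduced_complex_space X Osh" and A: "locally_closed_in X A"
    and conc: "set_weakly_pseudoconcave X Osh A 1"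
  shows "local_max_principle (subtopology X A) (LACR_germs X Osh A)"
  unfolding local_max_principle_def
proof
  let ?T = "subtopology X A"
  have H: "Hausdorff_space X" and sh: "function_sheaf X Osh"
    using X by (auto simp: reduced_complex_space_def)
  have AX: "A \<subseteq> topspace X" by (rule locally_closed_in_subset[OF A])
  fix p assume "p \<in> topspace ?T"
  then have p: "p \<in> A" "p \<in> topspace X" by auto
  obtain \<omega> N U Z z where m: "p \<in> \<omega>" "is_local_model X Osh \<omega> N U Z z"
    using X p(2) unfolding reduced_complex_space_def by blast
  let ?G = "nomax_germs X A \<omega> N z"
  \<comment> \<open>The LACR germs form the least stable class containing the holomorphic ones, so
    these two properties of \<open>?G\<close> suffice.\<close>
  have LG: "LACR_germs X Osh A \<subseteq> ?G"
    using restricted_holo_germs_subset_nomax[OF sh m(2) conc] approx_germs_nomax_subset[OF H m(2) A]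
    unfolding LACR_germs_def approx_closure_def by blast
  have o: "openin ?T (A \<inter> \<omega>)"
    by (rule openin_subtopology_Int2[OF local_model_props(1)[OF m(2)]])
  show "\<exists>U. openin ?T U \<and> p \<in> U \<and>
      (\<forall>V u. openin ?T V \<and> relatively_compact_in ?T V U \<and> u \<in> germ_sections ?T (LACR_germs X Osh A) V \<and>
        continuous_map (subtopology ?T (?T closure_of V)) euclidean u
        \<longrightarrow> sup_norm_on V u \<le> sup_norm_on (?T frontier_of V) u)"
  proof (intro exI[of _ "A \<inter> \<omega>"] conjI allI impI)
    fix V u
    assume "openin ?T V \<and> relatively_compact_in ?T V (A \<inter> \<omega>) \<and>
      u \<in> germ_sections ?T (LACR_germs X Osh A) V \<and>
      continuous_map (subtopology ?T (?T closure_of V)) euclidean u"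
    then have V: "openin ?T V" "relatively_compact_in ?T V (A \<inter> \<omega>)"
      and u: "u \<in> germ_sections ?T (LACR_germs X Osh A) V"
      and cont: "continuous_map (subtopology ?T (?T closure_of V)) euclidean u"
      by auto
    define K where "K = ?T closure_of V"
    define F where "F = ?T frontier_of V"
    have VT: "V \<subseteq> topspace ?T" by (rule openin_subset[OF V(1)])
    have K: "compactin X K" "K \<subseteq> A" "K \<subseteq> \<omega>"
      using relatively_compact_in_closure[OF Hausdorff_space_subtopology[OF H] V(2) VT]
      by (auto simp: K_def compactin_subtopology)
    have VK: "V \<subseteq> K"
      unfolding K_def by (rule closure_of_subset[OF VT])
    have F: "F = K - V"
      unfolding F_def K_def by (rule frontier_of_openin[OF V(1)])
    have cu: "continuous_map (subtopology X K) euclidean u"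
      using cont K(2) by (simp add: K_def[symmetric] subtopology_subtopology inf_absorb2)
    show "sup_norm_on V u \<le> sup_norm_on (?T frontier_of V) u"
    proof (cases "V = {}")
      case True
      then show ?thesis by (simp add: sup_norm_on_def)
    next
      case False
      show ?thesis
      proof (rule ccontr)
        define M' where "M' = sup_norm_on F u"
        assume "\<not> sup_norm_on V u \<le> sup_norm_on (?T frontier_of V) u"
        then have lt: "M' < sup_norm_on V u"
          by (simp add: M'_def F_def)
        have K0: "K \<noteq> {}" using VK False by blast
        have "continuous_map (subtopology X K) euclidean (\<lambda>x. cmod (u x))"
          using cu by (rule continuous_map_norm)
        then obtain q where q: "q \<in> K" "\<And>x. x \<in> K \<Longrightarrow> cmod (u x) \<le> cmod (u q)"
          using compactin_attains_max[OF K(1) K0] by blast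
        have F_le: "cmod (u x) \<le> M'" if "x \<in> F" for x
          unfolding M'_def using that q(2) F by (intro sup_norm_on_upper[of _ _ _ "cmod (u q)"]) auto
        have "sup_norm_on V u \<le> cmod (u q)"
          using q(2) VK by (intro sup_norm_on_least) auto
        with lt have Mq: "M' < cmod (u q)" by simp
        \<comment> \<open>Holds also for an empty boundary, where the supremum is 0. It follows that
          \<open>u q\<close> is nonzero, as \<theta> requires.\<close>
        have M0: "0 \<le> M'"
        proof (cases "F = {}")
          case True
          then show ?thesis by (simp add: M'_def sup_norm_on_def)
        next
          case False
          then obtain x where "x \<in> F" by blast
          then show ?thesis
            using F_le[of x] norm_ge_zero[of "u x"] by linarith
        qed
        \<comment> \<open>The rotation that turns \<open>u q\<close> into its modulus.\<close>
        define \<theta> where "\<theta> = cnj (u q) / of_real (cmod (u q))"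
        have "cmod (u q) > 0" using Mq M0 by linarith
        then have \<theta>: "cmod \<theta> = 1" "\<theta> * u q = of_real (cmod (u q))"
          by (auto simp: \<theta>_def norm_divide complex_norm_square[symmetric] mult.commute[of "cnj _"]
              power2_eq_square)
        have Re_le: "Re (\<theta> * u x) \<le> cmod (u x)" for x
          using complex_Re_le_cmod[of "\<theta> * u x"] \<theta>(1) by (simp add: norm_mult)
        obtain b where b: "b \<in> K" "\<And>x. x \<in> K \<Longrightarrow> sqdist N (z q) (z x) \<le> sqdist N (z q) (z b)"
          using compactin_attains_max[OF K(1) K0 continuous_map_sqdist_chart[OF m(2) K(3)]] by blast
        \<comment> \<open>Adding 1 keeps R positive even when K is the single point q.\<close>
        define R where "R = sqdist N (z q) (z b) + 1"
        have R: "R > 0" "\<And>x. x \<in> K \<Longrightarrow> sqdist N (z q) (z x) \<le> R"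
        proof -
          show "R > 0"
            using sqdist_nonneg[of N "z q" "z b"] unfolding R_def by linarith
          show "sqdist N (z q) (z x) \<le> R" if "x \<in> K" for x
            using b(2)[OF that] unfolding R_def by linarith
        qed
        \<comment> \<open>\<epsilon> * R is half of the gap between M' and |u q|. On the boundary
          \<Phi> therefore stays below \<Phi> q = |u q|, and its maximum is interior.\<close>
        define \<epsilon> where "\<epsilon> = (cmod (u q) - M') / (2 * R)"
        have \<epsilon>: "\<epsilon> > 0" "\<epsilon> * R = (cmod (u q) - M') / 2"
          using Mq R(1) by (auto simp: \<epsilon>_def)
        define \<Phi> where "\<Phi> x = Re (\<theta> * u x) + \<epsilon> * sqdist N (z q) (z x)" for x
        have "continuous_map euclidean euclidean (\<lambda>v. Re (\<theta> * v))"
          unfolding continuous_map_iff_continuous2 by (intro continuous_intros)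
        with cu have "continuous_map (subtopology X K) euclidean ((\<lambda>v. Re (\<theta> * v)) \<circ> u)"
          by (rule continuous_map_compose)
        then have "continuous_map (subtopology X K) euclidean (\<lambda>x. Re (\<theta> * u x))"
          by (simp only: o_def)
        then have "continuous_map (subtopology X K) euclidean \<Phi>"
          unfolding \<Phi>_def
          by (intro continuous_map_add continuous_map_real_mult
              continuous_map_sqdist_chart[OF m(2) K(3)] continuous_map_const[THEN iffD2]) auto
        then obtain y0 where y0: "y0 \<in> K" "\<And>x. x \<in> K \<Longrightarrow> \<Phi> x \<le> \<Phi> y0"
          using compactin_attains_max[OF K(1) K0] by blast
        have "y0 \<in> V"
        proof (rule ccontr)
          assume "y0 \<notin> V"
          then have "cmod (u y0) \<le> M'"
            using y0(1) F F_le by blast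
          moreover have "\<epsilon> * sqdist N (z q) (z y0) \<le> \<epsilon> * R"
            using R(2)[OF y0(1)] \<epsilon>(1) by (intro mult_left_mono) auto
          moreover have "\<Phi> q = cmod (u q)"
            by (simp add: \<Phi>_def \<theta>(2))
          ultimately show False
            using y0(2)[OF q(1)] Re_le[of y0] \<epsilon>(2) Mq unfolding \<Phi>_def by simp
        qed
        then have gy0: "germ_at ?T y0 u \<in> ?G"
          using u LG by (auto simp: germ_sections_def)
        have y0': "y0 \<in> A" "y0 \<in> \<omega>"
          using y0(1) K(2,3) by auto
        obtain y where "y \<in> V" "\<Phi> y0 < \<Phi> y"
          unfolding \<Phi>_def
          by (rule nomax_germs_memD[OF gy0 AX y0' \<epsilon>(1) V(1) \<open>y0 \<in> V\<close>, of \<theta> "z q"])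
        then show False
          using y0(2)[of y] VK by auto
      qed
    qed
  qed (use o p m(1) in auto)
qed

lemma weakly_pseudoconcave_of_local_max_principle:
  assumes X: "reduced_complex_space X Osh" and A: "locally_closed_in X A"
    and max: "local_max_principle (subtopology X A) (restricted_holo_germs X Osh A)"
  shows "set_weakly_pseudoconcave X Osh A 1"
  unfolding set_weakly_pseudoconcave_def
proof (intro ballI notI)
  let ?T = "subtopology X A"
  have H: "Hausdorff_space X"
    using X by (simp add: reduced_complex_space_def)
  have AX: "A \<subseteq> topspace X" by (rule locally_closed_in_subset[OF A])
  fix p assume p: "p \<in> A" and "set_pseudoconvex_at X Osh A 1 p"
  then obtain \<omega> N U Z z \<rho> \<omega>' where m: "p \<in> \<omega>" "is_local_model X Osh \<omega> N U Z z"
    and \<rho>: "smooth_C N U \<rho>" and \<omega>': "openin X \<omega>'" "p \<in> \<omega>'" "\<omega>' \<subseteq> \<omega>"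
    and le: "z ` (A \<inter> \<omega>') \<subseteq> {w \<in> U. \<rho> w \<le> \<rho> (z p)}"
    and pos: "int (num_pos_eigenvalues (complex_hessian N \<rho> (z p))) \<ge> int N - 1 + 1"
    unfolding set_pseudoconvex_at_def by blast
  note props = local_model_props[OF m(2)]
  have zp: "z p \<in> U" using props(3,5) m(1) by blast
  have zC: "z x \<in> Cspace N" if "x \<in> \<omega>" for x
    using props(2,3,5) that open_in_C_subset by blast
  obtain P e r where P: "\<And>V. holo_C N V P" "P (z p) = 0" and e: "0 < e" and r: "0 < r"
    and low: "\<And>v. v \<in> Cspace N \<Longrightarrow> sqdist N (z p) v \<le> r \<Longrightarrow>
      v \<in> U \<and> Re (P v) + e * sqdist N (z p) v \<le> \<rho> v - \<rho> (z p)"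
    using levi_positive_lower_bound[OF props(2) \<rho> zp] pos by auto
  obtain U0 where U0: "openin ?T U0" "p \<in> U0"
    "\<And>V u. openin ?T V \<Longrightarrow> relatively_compact_in ?T V U0 \<Longrightarrow>
      u \<in> germ_sections ?T (restricted_holo_germs X Osh A) V \<Longrightarrow>
      continuous_map (subtopology ?T (?T closure_of V)) euclidean u \<Longrightarrow>
      sup_norm_on V u \<le> sup_norm_on (?T frontier_of V) u"
  proof (rule local_max_principleE[OF max])
    show "p \<in> topspace ?T" using p AX by auto
  qed blast
  \<comment> \<open>\<open>U0\<close> for the maximum principle, \<open>\<omega>'\<close> for the
    inequality on \<rho>, the chart ball for the Taylor bound.\<close>
  define W where "W = U0 \<inter> (A \<inter> \<omega>') \<inter> {x \<in> A \<inter> \<omega>. sqdist N (z p) (z x) < r}"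
  have W: "openin ?T W"
    unfolding W_def
    by (intro openin_Int[OF openin_Int[OF U0(1) openin_subtopology_Int2[OF \<omega>'(1)]]]
        openin_chart_ball[OF m(2)])
  have pW: "p \<in> W"
    using U0(2) p m(1) \<omega>'(2) r by (simp add: W_def)
  obtain s where s: "s > 0" "compactin X {x \<in> A \<inter> \<omega>. sqdist N (z p) (z x) \<le> s}"
    "{x \<in> A \<inter> \<omega>. sqdist N (z p) (z x) \<le> s} \<subseteq> W"
    using compact_chart_ball[OF H m(2) A p m(1) W pW] by blast
  define K where "K = {x \<in> A \<inter> \<omega>. sqdist N (z p) (z x) \<le> s}"
  define V where "V = {x \<in> A \<inter> \<omega>. sqdist N (z p) (z x) < s}"
  have K: "compactin ?T K" "K \<subseteq> W" "V \<subseteq> K" "K \<subseteq> \<omega>" "K \<subseteq> A"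
    using s by (auto simp: K_def V_def compactin_subtopology)
  have "K \<subseteq> U0" using K(2) by (auto simp: W_def)
  have HT: "Hausdorff_space ?T" by (rule Hausdorff_space_subtopology[OF H])
  note rc = relatively_compact_inI[OF HT K(1,3) \<open>K \<subseteq> U0\<close>]
  have V: "openin ?T V"
    unfolding V_def by (rule openin_chart_ball[OF m(2)])
  define u where "u x = exp (P (z x))" for x
  have cu: "continuous_map (subtopology X S) euclidean u" if "S \<subseteq> \<omega>" for S
  proof -
    have "continuous_on UNIV (\<lambda>w. exp (P w))"
      using P(1)[of UNIV] by (intro continuous_on_exp) (simp add: holo_C_def)
    then show ?thesis
      unfolding u_def by (rule continuous_map_chart_compose[OF m(2) that subset_UNIV])
  qed
  \<comment> \<open>P is holomorphic on the whole number space, so one ambient function serves at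
    all points of Z.\<close>
  have "(\<lambda>w. exp (P w)) \<in> model_sections N Z"
    unfolding model_sections_def
  proof (intro CollectI ballI exI conjI)
    fix a assume "a \<in> Z"
    show "open_in_C N (Cspace N)" by simp
    show "a \<in> Cspace N"
      using \<open>a \<in> Z\<close> props(2,3) open_in_C_subset by blast
    show "holo_C N (Cspace N) (\<lambda>w. exp (P w))" by (intro holo_C_exp P(1))
  qed auto
  moreover have "openin (top_of_set Z) T \<Longrightarrow> (g \<in> model_sections N T) = (g \<circ> z \<in> Osh {x \<in> \<omega>. z x \<in> T})" for T g
    using m(2) unfolding is_local_model_def by blast
  ultimately have "(\<lambda>w. exp (P w)) \<circ> z \<in> Osh {x \<in> \<omega>. z x \<in> Z}"
    by simp
  moreover have "{x \<in> \<omega>. z x \<in> Z} = \<omega>" using props(5) by blast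
  ultimately have uO: "u \<in> Osh \<omega>"
    by (simp add: u_def[abs_def] o_def)
  \<comment> \<open>On A the upper bound for \<rho> from pseudoconvexity meets the lower bound from
    the Levi form; as |exp P| = exp (Re P), they give decay away from p.\<close>
  have bound: "cmod (u x) \<le> exp (- e * sqdist N (z p) (z x))" if "x \<in> K" for x
  proof -
    have x: "x \<in> A" "x \<in> \<omega>" "x \<in> \<omega>'" "sqdist N (z p) (z x) \<le> r"
      using that K(2) by (auto simp: W_def)
    then have "\<rho> (z x) \<le> \<rho> (z p)"
      using le by blast
    then have "Re (P (z x)) \<le> - e * sqdist N (z p) (z x)"
      using low[OF zC[OF x(2)] x(4)] by linarith
    then show ?thesis
      by (simp add: u_def norm_exp_eq_Re)
  qed
  have "sup_norm_on V u \<le> sup_norm_on (?T frontier_of V) u"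
  proof (rule U0(3)[OF V rc(1)])
    have "V \<subseteq> A" "V \<subseteq> \<omega>" by (auto simp: V_def)
    then have "continuous_map (subtopology ?T V) euclidean u"
      using cu[of V] by (simp add: subtopology_subtopology inf_absorb2)
    moreover have "germ_at ?T x u \<in> restricted_holo_germs X Osh A" if "x \<in> V" for x
      unfolding restricted_holo_germs_def using uO props(1) that by (auto simp: V_def)
    ultimately show "u \<in> germ_sections ?T (restricted_holo_germs X Osh A) V"
      by (simp add: germ_sections_def)
    have "?T closure_of V \<subseteq> A" "?T closure_of V \<subseteq> \<omega>"
      using rc(2) K(4,5) by auto
    then show "continuous_map (subtopology ?T (?T closure_of V)) euclidean u"
      using cu[of "?T closure_of V"] by (simp add: subtopology_subtopology inf_absorb2)
  qed
  moreover have "1 \<le> sup_norm_on V u"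
  proof -
    have "p \<in> V" using p m(1) s(1) by (simp add: V_def)
    moreover have "cmod (u x) \<le> 1" if "x \<in> V" for x
    proof -
      have "- e * sqdist N (z p) (z x) \<le> 0"
        using e by (simp add: mult_nonneg_nonneg)
      then have "exp (- e * sqdist N (z p) (z x)) \<le> 1"
        by (subst exp_le_one_iff)
      then show ?thesis
        using bound[OF subsetD[OF K(3) that]] by (rule order_trans[rotated])
    qed
    ultimately have "cmod (u p) \<le> sup_norm_on V u"
      by (rule sup_norm_on_upper)
    then show ?thesis
      by (simp add: u_def P(2))
  qed
  \<comment> \<open>Boundary points lie in \<open>K\<close> but not in \<open>V\<close>, so their
    squared distance is at least s. The bound is positive, which settles an empty boundary
    too.\<close>
  moreover have "sup_norm_on (?T frontier_of V) u \<le> exp (- e * s)"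
  proof (rule sup_norm_on_least)
    fix y assume "y \<in> ?T frontier_of V"
    then have y: "y \<in> K" "y \<notin> V"
      using rc(2) by (auto simp: frontier_of_openin[OF V])
    then have "s \<le> sqdist N (z p) (z y)"
      by (auto simp: K_def V_def)
    then have "exp (- e * sqdist N (z p) (z y)) \<le> exp (- e * s)"
      using e by simp
    then show "cmod (u y) \<le> exp (- e * s)"
      using bound[OF y(1)] by linarith
  qed simp
  moreover have "exp (- e * s) < 1"
    using e s(1) by simp
  ultimately show False by linarith
qed

theorem proposition3p1:
  fixes X :: "'a topology"
    and Osh :: "'a set \<Rightarrow> ('a \<Rightarrow> complex) set"
    and A :: "'a set"
  assumes "reduced_complex_space X Osh"
    and "pure_dimensional X Osh"
    and "locally_closed_in X A"
  shows "(set_weakly_pseudoconcave X Osh A 1 \<longleftrightarrow>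
            local_max_principle (subtopology X A) (restricted_holo_germs X Osh A)) \<and>
         (set_weakly_pseudoconcave X Osh A 1 \<longleftrightarrow>
            (\<exists>\<alpha> :: 'i rel. Well_order \<alpha> \<and> \<alpha> \<noteq> {} \<and>
               local_max_principle (subtopology X A) (iter_germs X Osh A \<alpha>))) \<and>
         (set_weakly_pseudoconcave X Osh A 1 \<longleftrightarrow>
            local_max_principle (subtopology X A) (LACR_germs X Osh A))"
proof -
  let ?T = "subtopology X A"
  let ?O = "restricted_holo_germs X Osh A"
  have 14: "local_max_principle ?T (LACR_germs X Osh A)" if "set_weakly_pseudoconcave X Osh A 1"
    using local_max_principle_LACR[OF assms(1,3) that] .
  have 43: "\<exists>\<alpha> :: 'i rel. Well_order \<alpha> \<and> \<alpha> \<noteq> {} \<and> local_max_principle ?T (iter_germs X Osh A \<alpha>)"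
    if "local_max_principle ?T (LACR_germs X Osh A)"
  proof (intro exI conjI)
    \<comment> \<open>Any nonzero ordinal on 'i would serve, as all iterates lie in the LACR germs;
      the cardinal of the type is one, since types are inhabited.\<close>
    show "Well_order (card_of (UNIV :: 'i set))" by (rule card_of_Well_order)
    show "card_of (UNIV :: 'i set) \<noteq> {}"
      using Field_card_of[of "UNIV :: 'i set"] by (auto simp del: Field_card_of)
    show "local_max_principle ?T (iter_germs X Osh A (card_of (UNIV :: 'i set)))"
      by (rule local_max_principle_antimono[OF iter_germs_subset_LACR that])
  qed
  have 32: "local_max_principle ?T ?O"
    if \<alpha>: "Well_order \<alpha>" "\<alpha> \<noteq> {}" "local_max_principle ?T (iter_germs X Osh A \<alpha>)" for \<alpha> :: "'i rel"
  proof (rule local_max_principle_antimono[OF _ \<alpha>(3)])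
    \<comment> \<open>Stage 0 lies below \<alpha>, and one approximation step does not lose
      it.\<close>
    have "?O \<subseteq> (\<Union>s\<in>{s :: 'i rel. (s, \<alpha>) \<in> ordLess}. iter_germs X Osh A s)"
      using empty_ordLess[OF \<alpha>(1,2)] iter_germs_zero[where ?'b = 'i, of X Osh A] by blast
    then have "approx_germs ?T ?O \<subseteq> iter_germs X Osh A \<alpha>"
      unfolding iter_germs_pos[OF \<alpha>(2)] by (rule approx_germs_mono)
    then show "?O \<subseteq> iter_germs X Osh A \<alpha>"
      using restricted_holo_germs_subset_approx[OF assms(1) locally_closed_in_subset[OF assms(3)]]
      by blast
  qed
  have 21: "set_weakly_pseudoconcave X Osh A 1" if "local_max_principle ?T ?O"
    using weakly_pseudoconcave_of_local_max_principle[OF assms(1,3) that] .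
  show ?thesis
    using 14 43 32 21 by blast
qed

end
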